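(* Let $q=e^{2\pi i\tau}$. For $\beta\in\{0,1\}$ let $\mathrm{C}\Psi_{2,1}(q)=\frac{(q^2;q^2)_{\infty}^5}{(q;q)_{\infty}^4(q^4;q^4)_{\infty}^2}=\sum_{n\ge0}c\psi_{2,1}(n)q^n$ and $\mathrm{C}\Psi_{2,0}(q)=\frac{(q^4;q^4)_{\infty}^2}{(q;q)_{\infty}^2(q^2;q^2)_{\infty}}=\sum_{n\ge0}c\psi_{2,0}(n)q^n$. For $\alpha\ge 1$ let $a\in\{0,1\}$ with $a\equiv\alpha\pmod 2$ and define $$L_{\alpha}^{(\beta)} := \frac{1}{\mathrm{C}\Psi_{2,\beta}\left(q^{1+4a}\right)}\sum_{\substack{n\ge0\\ 3\cdot 2^{\beta+1}n\equiv (-1)^{\beta+1}\bmod{5^{\alpha}}}} c\psi_{2,\beta}(n)\, q^{\lfloor n/5^{\alpha}\rfloor + \beta},$$ regarded as a function of $\tau$. Let $W\tau=\frac{4\tau-1}{100\tau-24}$ and let $\varphi(q)=\sum_{n=-\infty}^{\infty}q^{n^2}$ be Ramanujan's theta function. Then for every $\alpha\ge1$ and $\beta\in\{0,1\}$, with $a\equiv\alpha\pmod2$, $a\in\{0,1\}$, $$\varphi\left((-1)^{\beta+1}q^{1+4a}\right)\, L_{\alpha}^{(\beta)}(W\tau) \in\mathbb{Z}[[q^4]]+q\,\mathbb{Z}[[q^4]],$$ where $L_{\alpha}^{(\beta)}(W\tau)$ is expanded as a series in $q=e^{2\pi i\tau}$.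
   Context: $(q^a;q^b)_{\infty} = \prod_{m\ge 0}(1-q^{bm+a})$. One has $\varphi(q)=\frac{(q^2;q^2)_\infty^5}{(q;q)_\infty^2(q^4;q^4)_\infty^2}$ and $\varphi(-q)=\frac{(q;q)_\infty^2}{(q^2;q^2)_\infty}$. *)

theory Defs
  imports "HOL-Complex_Analysis.Complex_Analysis" "HOL-Number_Theory.Cong"
begin

definition qpoch :: "nat \<Rightarrow> nat \<Rightarrow> complex \<Rightarrow> complex" where
  "qpoch a b q = (\<Prod>m. 1 - q ^ (b * m + a))"

text \<open>
  The parameter \<open>\<beta>\<close> of the next definitions ranges over 0 and 1 only; for all other values they
  are meaningless.
\<close>

definition CPsi2 :: "nat \<Rightarrow> complex \<Rightarrow> complex" where
  "CPsi2 \<beta> q =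
     (if \<beta> = 0 then qpoch 4 4 q ^ 2 / (qpoch 1 1 q ^ 2 * qpoch 2 2 q)
      else qpoch 2 2 q ^ 5 / (qpoch 1 1 q ^ 4 * qpoch 4 4 q ^ 2))"

text \<open>
  The coefficients of the power series of \<open>CPsi2 \<beta>\<close>; see \<open>sums_cpsi2\<close> below.
\<close>

definition cpsi2 :: "nat \<Rightarrow> nat \<Rightarrow> complex" where
  "cpsi2 \<beta> n = fps_nth (fps_expansion (CPsi2 \<beta>) 0) n"

definition nome :: "complex \<Rightarrow> complex" where
  "nome \<tau> = exp (2 * of_real pi * \<i> * \<tau>)"

definition L_fun :: "nat \<Rightarrow> nat \<Rightarrow> complex \<Rightarrow> complex" where
  "L_fun \<beta> \<alpha> \<tau> =
     1 / CPsi2 \<beta> (nome \<tau> ^ (1 + 4 * (\<alpha> mod 2))) *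
     (\<Sum>\<^sub>\<infinity>n | [3 * 2 ^ (\<beta> + 1) * int n = (- 1) ^ (\<beta> + 1)] (mod 5 ^ \<alpha>).
        cpsi2 \<beta> n * nome \<tau> ^ (n div 5 ^ \<alpha> + \<beta>))"

definition W_map :: "complex \<Rightarrow> complex" where
  "W_map \<tau> = (4 * \<tau> - 1) / (100 * \<tau> - 24)"

definition ramanujan_phi :: "complex \<Rightarrow> complex" where
  "ramanujan_phi q = (\<Sum>\<^sub>\<infinity>n::int. q ^ nat (n ^ 2))"

text \<open>The set $Z[[q^4]] + q\,Z[[q^4]]$ of formal power series in $q$.\<close>

definition Zq4_plus_q_Zq4 :: "int fps set" where
  "Zq4_plus_q_Zq4 = {(A oo fps_X ^ 4) + fps_X * (B oo fps_X ^ 4) | A B. True}"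

lemma qpoch_aux:
  fixes r :: real
  assumes "a \<ge> 1" "b \<ge> 1" "0 < r" "r < 1"
  shows "uniformly_convergent_on (cball 0 r) (\<lambda>N q::complex. \<Prod>m<N. 1 - q ^ (b * m + a))"
proof -
  have le: "norm (- (q ^ (b * m + a))) \<le> r ^ m" if q: "q \<in> cball 0 r" for q :: complex and m
  proof -
    have "norm (- (q ^ (b * m + a))) \<le> r ^ (b * m + a)"
      using q by (simp add: norm_power power_mono)
    also have "\<dots> \<le> r ^ m"
    proof (rule power_decreasing)
      have "m \<le> b * m" using mult_le_mono1[OF assms(2), of m] by simp
      thus "m \<le> b * m + a" by (rule trans_le_add1)
    qed (use \<open>0 < r\<close> \<open>r < 1\<close> in auto)
    finally show ?thesis .
  qed
  have "uniformly_convergent_on (cball 0 r)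
          (\<lambda>N q::complex. \<Sum>m<N. norm (- (q ^ (b * m + a))))"
    by (rule Weierstrass_m_test'[where M = "\<lambda>m. r ^ m"])
       (use le \<open>0 < r\<close> \<open>r < 1\<close> in \<open>auto simp: summable_geometric\<close>)
  hence "uniformly_convergent_on (cball 0 r)
          (\<lambda>N q::complex. \<Prod>m<N. 1 + - (q ^ (b * m + a)))"
    by (intro uniformly_convergent_on_prod) (auto intro!: continuous_intros)
  thus ?thesis by simp
qed

lemma qpoch_convergent:
  assumes "a \<ge> 1" "b \<ge> 1" "norm (q::complex) < 1"
  shows "convergent_prod (\<lambda>m. 1 - q ^ (b * m + a))"
proof -
  have "norm (norm (1 - q ^ (b * m + a) - 1)) \<le> norm q ^ m" for m
  proof -
    have "m \<le> b * m" using mult_le_mono1[OF assms(2), of m] by simp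
    hence "m \<le> b * m + a" by (rule trans_le_add1)
    thus ?thesis using assms by (simp add: norm_power power_decreasing)
  qed
  hence "summable (\<lambda>m. norm (1 - q ^ (b * m + a) - 1))"
    using assms(3)
    by (intro summable_comparison_test'[OF summable_geometric[of "norm q"], of 0]) simp_all
  hence "abs_convergent_prod (\<lambda>m. 1 - q ^ (b * m + a))"
    by (simp add: abs_convergent_prod_conv_summable)
  thus ?thesis by (rule abs_convergent_prod_imp_convergent_prod)
qed

lemma qpoch_nonzero:
  assumes "a \<ge> 1" "b \<ge> 1" "norm (q::complex) < 1"
  shows "qpoch a b q \<noteq> 0"
  unfolding qpoch_def
proof (rule prodinf_nonzero[OF qpoch_convergent[OF assms]])
  fix m
  have "norm (q ^ (b * m + a)) < 1"
    using assms by (simp add: norm_power power_less_one_iff)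
  thus "1 - q ^ (b * m + a) \<noteq> 0" by auto
qed

lemma qpoch_holomorphic:
  assumes "a \<ge> 1" "b \<ge> 1"
  shows "qpoch a b holomorphic_on ball 0 1"
proof (rule holomorphic_uniform_sequence)
  show "(\<lambda>q::complex. \<Prod>m<N. 1 - q ^ (b * m + a)) holomorphic_on ball 0 1" for N
    by (intro holomorphic_intros)
  fix x :: complex assume x: "x \<in> ball 0 1"
  define d where "d = (1 - norm x) / 2"
  have d: "d > 0" "norm x + d < 1" using x by (auto simp: d_def field_simps)
  have sub: "cball x d \<subseteq> cball 0 (norm x + d)"
    by (simp add: cball_subset_cball_iff)
  have "uniformly_convergent_on (cball 0 (norm x + d))
          (\<lambda>N q::complex. \<Prod>m<N. 1 - q ^ (b * m + a))"
    by (rule qpoch_aux) (use assms d in \<open>auto intro: add_nonneg_pos\<close>)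
  then obtain g where g: "uniform_limit (cball 0 (norm x + d))
          (\<lambda>N q::complex. \<Prod>m<N. 1 - q ^ (b * m + a)) g sequentially"
    by (auto simp: uniformly_convergent_on_def)
  have "g q = qpoch a b q" if q: "q \<in> cball 0 (norm x + d)" for q
  proof -
    have "(\<lambda>N. \<Prod>m\<le>N. 1 - q ^ (b * m + a)) \<longlonglongrightarrow> qpoch a b q"
      unfolding qpoch_def using q d assms
      by (intro convergent_prod_LIMSEQ qpoch_convergent) auto
    moreover have "(\<lambda>N. \<Prod>m\<le>N. 1 - q ^ (b * m + a)) \<longlonglongrightarrow> g q"
      using LIMSEQ_Suc[OF tendsto_uniform_limitI[OF g q]] by (simp add: lessThan_Suc_atMost)
    ultimately show ?thesis by (rule LIMSEQ_unique[symmetric])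
  qed
  hence "uniform_limit (cball 0 (norm x + d))
          (\<lambda>N q::complex. \<Prod>m<N. 1 - q ^ (b * m + a)) (qpoch a b) sequentially"
    using g by (subst uniform_limit_cong'[symmetric]) auto
  hence "uniform_limit (cball x d)
          (\<lambda>N q::complex. \<Prod>m<N. 1 - q ^ (b * m + a)) (qpoch a b) sequentially"
    using sub by (rule uniform_limit_on_subset)
  thus "\<exists>d>0. cball x d \<subseteq> ball 0 1 \<and> uniform_limit (cball x d)
          (\<lambda>N q::complex. \<Prod>m<N. 1 - q ^ (b * m + a)) (qpoch a b) sequentially"
    using d sub by (intro exI[of _ d]) (auto simp: subset_iff)
qed auto

lemma CPsi2_holomorphic: "CPsi2 \<beta> holomorphic_on ball 0 1"
  unfolding CPsi2_def
  by (cases "\<beta> = 0")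
     (auto intro!: holomorphic_intros qpoch_holomorphic simp: qpoch_nonzero)

theorem sums_cpsi2:
  assumes "norm q < 1"
  shows "(\<lambda>n. cpsi2 \<beta> n * q ^ n) sums CPsi2 \<beta> q"
proof -
  have "CPsi2 \<beta> holomorphic_on eball 0 1"
    using CPsi2_holomorphic[of \<beta>] by (simp add: one_ereal_def)
  hence 1: "fps_conv_radius (fps_expansion (CPsi2 \<beta>) 0) \<ge> 1"
    and 2: "eval_fps (fps_expansion (CPsi2 \<beta>) 0) q = CPsi2 \<beta> q"
    using assms conv_radius_fps_expansion eval_fps_expansion'[of "CPsi2 \<beta>" 0 1 q]
    by (auto simp: one_ereal_def)
  have "ereal (norm q) < fps_conv_radius (fps_expansion (CPsi2 \<beta>) 0)"
    using assms 1 by (meson ereal_less(3) less_le_trans)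
  from sums_eval_fps[OF this] show ?thesis
    by (simp add: 2 cpsi2_def)
qed

end

theory Submission
  imports Defs "HOL-Real_Asymp.Real_Asymp"
begin

text \<open>
  Both generating functions are quotients of a theta series by a squared eta function:
  \<open>CPsi2 1 = \<phi>(q) / (q;q)\<^sup>2\<close> and \<open>CPsi2 0 = \<psi>(q\<^sup>2) / (q;q)\<^sup>2\<close>. The sum over an arithmetic progression
  modulo \<open>5\<^sup>\<alpha>\<close> is an average of the quotient over the points \<open>(\<tau> + 24 r) / 5\<^sup>\<alpha>\<close>. Composing these
  points with \<open>W\<close> gives \<open>\<gamma>(4 (\<tau> + 24 r') / 5\<^sup>\<alpha>)\<close>, where \<open>\<gamma>\<close> has determinant 1 and \<open>r'\<close> again runs
  through all residues. Theta inversion shows that \<open>\<gamma>\<close> takes \<open>\<phi>(q)\<close> to \<open>\<phi>(q)\<close>, \<open>\<psi>(q\<^sup>2)\<close> to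
  \<open>\<phi>(-q)\<close>, and \<open>(q;q)\<close> to \<open>(q\<^sup>4;q\<^sup>4)\<close>; the Gauss sums that occur are positive square roots of powers
  of 5, and the multiplier of \<open>\<eta>\<^sup>2\<close> is a character modulo 12, so all automorphy factors agree with the one
  of the denominator of \<open>L\<close> and cancel. What remains is \<open>(q\<^sup>4;q\<^sup>4)\<^sup>2\<close> at \<open>q\<^bsup>1 + 4 a\<^esup>\<close> times a
  dissection of \<open>\<phi>(\<plusminus>q) / (q\<^sup>4;q\<^sup>4)\<^sup>2\<close>, whose exponents are 0 or 1 modulo 4 because squares are.
\<close>

section \<open>Sums over the integers\<close>

text \<open>With V = 25 \<tau> - 6 the map of determinant 4 reads W \<tau> = 1/25 - 1/(100 V), so
  every point in question has the form A/N - 1/(4 N V) with N a power of 5. The scale p = 1 + 4a is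
  5^a, and it has two effects. First, the average has N = 5^(\<alpha> + 2) and the denominator has N
  = 5^(2 - a); these exponents have equal parity, and modulo 12 a power of 5 sees only this parity,
  so the automorphy factors agree. Second, p is congruent to 5^\<alpha> modulo 12, which makes the
  exponents of q integral both before and after W. Steps of 24 in the average cancel the denominator
  24 of the eta exponents. After W they are steps of 600 in A, so A stays 1 modulo 60: modulo 5 this
  fixes the sign of the Gauss sums, modulo 12 the eta multiplier. Finally the residues 0 and 1
  modulo 4 survive the dissection because 5^\<alpha> is 1 modulo 4 and the shift of exponents,
  (5^\<alpha> p - 1)/3, is a multiple of 4.\<close>

lemma summable_on_int_split:
  fixes f :: "int \<Rightarrow> 'a :: banach"
  assumes "(\<lambda>n. f (int n)) summable_on UNIV" "(\<lambda>n. f (- int n)) summable_on UNIV"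
  shows "f summable_on UNIV"
proof -
  have "f summable_on range int"
    using assms(1) by (subst summable_on_reindex) (auto simp: inj_on_def o_def)
  moreover have "f summable_on range (\<lambda>n. - int n)"
    using assms(2) by (subst summable_on_reindex) (auto simp: inj_on_def o_def)
  ultimately have "f summable_on (range int \<union> range (\<lambda>n. - int n))"
    by (metis summable_on_Un_disjoint summable_on_subset_banach sup.cobounded2 Diff_disjoint Un_Diff_cancel Diff_subset)
  moreover have "(UNIV :: int set) = range int \<union> range (\<lambda>n. - int n)"
  proof (intro set_eqI iffI UNIV_I)
    fix x :: int
    show "x \<in> range int \<union> range (\<lambda>n. - int n)"
      by (cases x rule: int_cases2) auto
  qed
  ultimately show ?thesis by simp
qed

text \<open>By t^2 >= t - 1/4 a Gaussian is dominated by a geometric sequence in |n|;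
  \<open>K\<close> absorbs the shift \<open>x\<close>.\<close>

lemma summable_on_gauss:
  fixes c x :: real
  assumes "c > 0"
  shows "(\<lambda>n::int. exp (- c * (of_int n + x)\<^sup>2)) summable_on UNIV"
proof -
  define K where "K = exp (c * (1/4 + \<bar>x\<bar>))"
  have 0: "(\<lambda>n::nat. K * exp (-c) ^ n) summable_on UNIV"
    using assms by (intro summable_nonneg_imp_summable_on summable_mult)
      (auto simp: K_def intro!: summable_geometric)
  have le: "exp (- c * (of_int n + x)\<^sup>2) \<le> K * exp (-c) ^ nat \<bar>n\<bar>" for n :: int
  proof -
    define u where "u = \<bar>of_int n\<bar> - \<bar>x\<bar>"
    have "u\<^sup>2 \<le> (of_int n + x)\<^sup>2"
      unfolding u_def by (rule abs_le_square_iff[THEN iffD1]) linarith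
    moreover have "0 \<le> (u - 1/2)\<^sup>2" by simp
    ultimately have "(of_int n + x)\<^sup>2 \<ge> \<bar>of_int n\<bar> - (1/4 + \<bar>x\<bar>)"
      by (simp add: power2_eq_square algebra_simps u_def)
    hence "c * (of_int n + x)\<^sup>2 \<ge> c * (\<bar>of_int n\<bar> - (1/4 + \<bar>x\<bar>))"
      using assms by (intro mult_left_mono) auto
    hence "exp (- c * (of_int n + x)\<^sup>2) \<le> exp (c * (1/4 + \<bar>x\<bar>) + - c * \<bar>of_int n\<bar>)"
      by (simp add: algebra_simps)
    also have "\<dots> = K * exp (-c) ^ nat \<bar>n\<bar>"
      by (simp only: exp_add K_def) (simp add: mult.commute flip: exp_of_nat_mult)
    finally show ?thesis .
  qed
  show ?thesis
  proof (rule summable_on_int_split)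
    show "(\<lambda>n. exp (- c * (of_int (int n) + x)\<^sup>2)) summable_on UNIV"
      by (rule summable_on_comparison_test[OF 0]) (use le[of "int _"] in auto)
    show "(\<lambda>n. exp (- c * (of_int (- int n) + x)\<^sup>2)) summable_on UNIV"
      by (rule summable_on_comparison_test[OF 0]) (use le[of "- int _"] in auto)
  qed
qed

text \<open>Tannery's theorem, transported from series to unordered sums over the integers by the
  enumeration \<open>int_decode\<close>; absolute convergence makes the order irrelevant. Both
  limits of finite identities, for the triple product and for theta inversion, rest on it.\<close>

lemma tendsto_infsum_int:
  fixes f :: "nat \<Rightarrow> int \<Rightarrow> 'a :: {real_normed_algebra, banach}"
  assumes lim: "\<And>k. (\<lambda>n. f n k) \<longlonglongrightarrow> b k"
    and bound: "\<forall>\<^sub>F n in sequentially. \<forall>k. norm (f n k) \<le> M k"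
    and M: "M summable_on UNIV"
  shows "(\<lambda>n. \<Sum>\<^sub>\<infinity>k. f n k) \<longlonglongrightarrow> (\<Sum>\<^sub>\<infinity>k. b k)"
proof -
  have inj: "inj int_decode" and surj: "surj int_decode"
    by (auto simp: inj_int_decode surj_int_decode)
  have reindex: "(\<Sum>\<^sub>\<infinity>k. h k) = suminf (\<lambda>j. h (int_decode j))"
    if "summable (\<lambda>j. norm (h (int_decode j)))" for h :: "int \<Rightarrow> 'a"
  proof -
    have "(\<Sum>\<^sub>\<infinity>k. h k) = (\<Sum>\<^sub>\<infinity>j. h (int_decode j))"
      using infsum_reindex[OF inj, of h] by (simp add: surj o_def)
    also have "\<dots> = suminf (\<lambda>j. h (int_decode j))"
      using norm_summable_imp_has_sum[OF that summable_sums[OF summable_norm_cancel[OF that]]]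
      by (rule infsumI)
    finally show ?thesis .
  qed
  have "(\<lambda>j. M (int_decode j)) summable_on UNIV"
    using M summable_on_reindex[OF inj, of M] by (simp add: surj o_def)
  hence M': "summable (\<lambda>j. M (int_decode j))"
    by (rule summable_on_imp_summable)
  have "\<forall>\<^sub>F (k, n) in at_top \<times>\<^sub>F sequentially. norm (f n (int_decode k)) \<le> M (int_decode k)"
    unfolding eventually_prod_filter
    by (rule exI[of _ "\<lambda>_. True"], rule exI, rule conjI[OF _ conjI[OF bound]]) auto
  from tannerys_theorem[OF lim this M']
  have T: "\<forall>\<^sub>F n in sequentially. summable (\<lambda>k. norm (f n (int_decode k)))"
    "summable (\<lambda>k. norm (b (int_decode k)))"
    "(\<lambda>n. suminf (\<lambda>k. f n (int_decode k))) \<longlonglongrightarrow> suminf (\<lambda>k. b (int_decode k))"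
    by auto
  show ?thesis
    unfolding reindex[OF T(2)]
    by (rule Lim_transform_eventually[OF T(3)], rule eventually_mono[OF T(1)]) (simp add: reindex)
qed

section \<open>The Jacobi triple product\<close>

definition qfact :: "complex \<Rightarrow> nat \<Rightarrow> complex" where
  "qfact p k = (\<Prod>i<k. 1 - p ^ Suc i)"

text \<open>Gaussian binomial coefficient. The quotient form shows its limit directly, since all
  three \<open>qfact\<close> tend to \<open>euler\<close>; the value 0 beyond \<open>M\<close> lets
  the Pascal recursion hold at the boundary.\<close>

definition qbinom :: "complex \<Rightarrow> nat \<Rightarrow> nat \<Rightarrow> complex" where
  "qbinom p M k = (if k \<le> M then qfact p M / (qfact p k * qfact p (M - k)) else 0)"

lemma one_minus_power_nonzero: "norm (p::complex) < 1 \<Longrightarrow> 1 - p ^ Suc i \<noteq> 0"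
proof
  assume p: "norm p < 1" and "1 - p ^ Suc i = 0"
  hence "p ^ Suc i = 1" by simp
  hence "norm p ^ Suc i = 1" by (metis norm_one norm_power)
  moreover have "norm p ^ Suc i < 1" using p by (metis power_Suc_less_one norm_ge_zero power_less_one_iff zero_less_Suc)
  ultimately show False by simp
qed

lemma qfact_nonzero: "norm p < 1 \<Longrightarrow> qfact p k \<noteq> 0"
  unfolding qfact_def using one_minus_power_nonzero by simp

lemma qfact_Suc: "qfact p (Suc k) = qfact p k * (1 - p ^ Suc k)"
  by (simp add: qfact_def)

lemma qbinom_0: "norm p < 1 \<Longrightarrow> qbinom p M 0 = 1"
  using qfact_nonzero[of p M] by (simp add: qbinom_def qfact_def)

lemma qbinom_Suc_Suc:
  assumes "norm p < 1" "k \<le> M"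
  shows "qbinom p (Suc M) (Suc k) = qbinom p M (Suc k) + p ^ (M - k) * qbinom p M k"
proof (cases "k = M")
  case True
  thus ?thesis using qfact_nonzero[OF assms(1)] by (simp add: qbinom_def qfact_def[of _ 0])
next
  case False
  then obtain d where d: "M = k + Suc d" using assms(2) by (metis less_imp_Suc_add le_neq_implies_less add_Suc_right)
  have nz: "qfact p j \<noteq> 0" "1 - p ^ Suc j \<noteq> 0" for j
    using assms(1) qfact_nonzero one_minus_power_nonzero by auto
  have nz2: "1 - p * p ^ j \<noteq> 0" for j using nz(2)[of j] by simp
  show ?thesis
    using nz(1)[of k] nz(1)[of d] nz2[of k] nz2[of d]
    by (simp add: d qbinom_def qfact_Suc[of p k] qfact_Suc[of p d] qfact_Suc[of p "Suc (k + d)"] divide_simps)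
       (simp add: algebra_simps power_add)
qed

lemma q_binomial_theorem:
  assumes "norm p < 1"
  shows "(\<Prod>k<M. 1 + x * p ^ k) = (\<Sum>k\<le>M. qbinom p M k * p ^ (k choose 2) * x ^ k)"
proof (induction M)
  case 0
  show ?case by (simp add: qbinom_0[OF assms] binomial_eq_0)
next
  case (Suc M)
  define A where "A = (\<lambda>k. qbinom p M k * p ^ (k choose 2) * x ^ k)"
  have shift: "(\<Sum>k\<le>M. A k) = A 0 + (\<Sum>k\<le>M. A (Suc k))"
  proof -
    have "(\<Sum>k\<le>M. A k) = (\<Sum>k\<le>Suc M. A k)" by (simp add: A_def qbinom_def)
    thus ?thesis by (simp only: sum.atMost_Suc_shift)
  qed
  have "(\<Sum>k\<le>Suc M. qbinom p (Suc M) k * p ^ (k choose 2) * x ^ k)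
        = 1 + (\<Sum>k\<le>M. qbinom p (Suc M) (Suc k) * p ^ (Suc k choose 2) * x ^ Suc k)"
    by (simp only: sum.atMost_Suc_shift) (simp add: qbinom_0[OF assms] numeral_2_eq_2)
  also have "(\<Sum>k\<le>M. qbinom p (Suc M) (Suc k) * p ^ (Suc k choose 2) * x ^ Suc k)
      = (\<Sum>k\<le>M. A (Suc k) + x * p ^ M * A k)"
  proof (rule sum.cong[OF refl])
    fix k assume "k \<in> {..M}"
    hence k: "k \<le> M" by simp
    have "p ^ (Suc k choose 2) = p ^ k * p ^ (k choose 2)"
      by (simp add: numeral_2_eq_2 power_add)
    moreover have "p ^ M = p ^ (M - k) * p ^ k" using k by (simp flip: power_add)
    ultimately show "qbinom p (Suc M) (Suc k) * p ^ (Suc k choose 2) * x ^ Suc k = A (Suc k) + x * p ^ M * A k"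
      using qbinom_Suc_Suc[OF assms k] by (simp add: A_def algebra_simps)
  qed
  also have "1 + \<dots> = (\<Sum>k\<le>M. A k) * (1 + x * p ^ M)"
  proof -
    have "A 0 = 1" by (simp add: A_def qbinom_0[OF assms] binomial_eq_0)
    thus ?thesis using shift by (simp add: sum.distrib ring_distribs flip: sum_distrib_left)
  qed
  finally show ?case using Suc.IH by (simp add: A_def)
qed

text \<open>The q-binomial theorem for 2 N factors in base q^2, recentred at the middle index. The
  lower N factors contain negative powers of q; taking out the term with z turns each of them into a
  factor in 1/z.\<close>

lemma jacobi_finite:
  fixes q z :: complex
  assumes q: "norm q < 1" "q \<noteq> 0" and z: "z \<noteq> 0"
  shows "(\<Prod>k<N. (1 + z * q ^ (2 * k + 1)) * (1 + inverse z * q ^ (2 * k + 1))) =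
         (\<Sum>n = - int N..int N. qbinom (q\<^sup>2) (2 * N) (nat (n + int N)) * (q ^ nat (n\<^sup>2) * z powi n))"
proof -
  define p where "p = q\<^sup>2"
  have p: "norm p < 1" using q by (simp add: p_def norm_power power_less_one_iff)
  \<comment> \<open>With the start z q^(1 - 2 N) the exponents of q run through the odd numbers from
    1 - 2 N to 2 N - 1.\<close>
  define x where "x = z * q / q ^ (2 * N)"
  have "(\<Prod>k<2 * N. 1 + x * p ^ k) = (\<Prod>k<N. 1 + x * p ^ k) * (\<Prod>k<N. 1 + x * p ^ (N + k))"
    by (simp add: mult_2 lessThan_atLeast0 prod.atLeastLessThan_concat[of 0 N "N + N", symmetric]
        prod.atLeastLessThan_shift_bounds[where m = 0, simplified] add.commute)
  also have "(\<Prod>k<N. 1 + x * p ^ (N + k)) = (\<Prod>k<N. 1 + z * q ^ (2 * k + 1))"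
    by (intro prod.cong refl) (use q in \<open>simp add: x_def p_def power_add flip: power_mult\<close>)
  also have "(\<Prod>k<N. 1 + x * p ^ k) = (\<Prod>k<N. 1 + x * p ^ (N - Suc k))"
    by (rule prod.nat_diff_reindex[symmetric])
  also have "\<dots> = (\<Prod>k<N. z / q ^ (2 * k + 1) * (1 + inverse z * q ^ (2 * k + 1)))"
  proof (intro prod.cong refl)
    fix k assume "k \<in> {..<N}"
    then obtain d where d: "N = Suc (k + d)" by (auto dest: less_imp_Suc_add)
    show "1 + x * p ^ (N - Suc k) = z / q ^ (2 * k + 1) * (1 + inverse z * q ^ (2 * k + 1))"
      using q z by (simp add: d x_def p_def power_add field_simps flip: power_mult)
  qed
  also have "\<dots> = (\<Prod>k<N. z / q ^ (2 * k + 1)) * (\<Prod>k<N. 1 + inverse z * q ^ (2 * k + 1))"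
    by (rule prod.distrib)
  \<comment> \<open>The odd numbers below 2 N add up to N^2.\<close>
  also have "(\<Prod>k<N. z / q ^ (2 * k + 1)) = z ^ N / q ^ N\<^sup>2"
  proof (induction N)
    case (Suc N)
    have "(Suc N)\<^sup>2 = N\<^sup>2 + (2 * N + 1)" by (simp add: power2_eq_square)
    thus ?case using Suc by (simp add: power_add mult_ac)
  qed auto
  finally have eq: "(\<Prod>k<2 * N. 1 + x * p ^ k) = z ^ N / q ^ N\<^sup>2 *
      (\<Prod>k<N. (1 + z * q ^ (2 * k + 1)) * (1 + inverse z * q ^ (2 * k + 1)))"
    by (simp add: prod.distrib mult_ac)
  have "(\<Prod>k<N. (1 + z * q ^ (2 * k + 1)) * (1 + inverse z * q ^ (2 * k + 1)))
      = q ^ N\<^sup>2 / z ^ N * (\<Prod>k<2 * N. 1 + x * p ^ k)"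
    unfolding eq using q z by simp
  also have "\<dots> = (\<Sum>k\<le>2 * N. q ^ N\<^sup>2 / z ^ N * (qbinom p (2 * N) k * p ^ (k choose 2) * x ^ k))"
    by (simp add: q_binomial_theorem[OF p] sum_distrib_left)
  also have "\<dots> = (\<Sum>n = - int N..int N. qbinom p (2 * N) (nat (n + int N)) * (q ^ nat (n\<^sup>2) * z powi n))"
  proof (rule sum.reindex_bij_witness[of _ "\<lambda>n. nat (n + int N)" "\<lambda>k. int k - int N"])
    fix k assume "k \<in> {..2 * N}"
    have p': "p ^ (k choose 2) = q powi (int k * (int k - 1))"
    proof -
      have "2 * (k choose 2) = k * (k - 1)"
        by (cases k) (simp_all add: choose_two dvd_mult_div_cancel)
      hence "p ^ (k choose 2) = q ^ (k * (k - 1))" by (simp add: p_def flip: power_mult)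
      moreover have "int (k * (k - 1)) = int k * (int k - 1)" by (cases k) (auto simp: algebra_simps)
      ultimately show ?thesis by (metis power_int_of_nat)
    qed
    have x': "x ^ k = z powi int k * q powi ((1 - 2 * int N) * int k)"
    proof -
      have "x = z * q powi (1 - 2 * int N)"
        using q by (simp add: x_def power_int_diff) (metis of_nat_mult of_nat_numeral power_int_of_nat)
      moreover have "(q powi (1 - 2 * int N)) ^ k = q powi ((1 - 2 * int N) * int k)"
        by (metis power_int_mult power_int_of_nat)
      ultimately show ?thesis by (simp add: power_mult_distrib)
    qed
    have sq: "q ^ nat ((int k - int N)\<^sup>2) = q powi ((int k - int N)\<^sup>2)"
      by (simp add: power_int_def)
    have N2: "q ^ N\<^sup>2 = q powi ((int N)\<^sup>2)"
      by (metis of_nat_power power_int_of_nat)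
    have "q ^ N\<^sup>2 * p ^ (k choose 2) * q powi ((1 - 2 * int N) * int k) = q powi ((int k - int N)\<^sup>2)"
      unfolding p' N2 using q by (simp add: algebra_simps power2_eq_square flip: power_int_add)
    moreover have "z powi (int k - int N) = z powi int k / z ^ N"
      using z by (simp add: power_int_diff)
    ultimately show "qbinom p (2 * N) (nat (int k - int N + int N)) *
          (q ^ nat ((int k - int N)\<^sup>2) * z powi (int k - int N)) =
          q ^ N\<^sup>2 / z ^ N * (qbinom p (2 * N) k * p ^ (k choose 2) * x ^ k)"
      unfolding x' sq by (simp add: mult_ac)
  qed auto
  finally show ?thesis by (simp add: p_def)
qed

section \<open>Infinite products and the limit of the finite identity\<close>

definition euler :: "complex \<Rightarrow> complex" where
  "euler q = qpoch 1 1 q"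

lemma qpoch_eq_euler: "k \<ge> 1 \<Longrightarrow> qpoch k k q = euler (q ^ k)"
  unfolding qpoch_def euler_def by (simp only: flip: power_mult) (simp add: algebra_simps)

lemma euler_nonzero: "norm q < 1 \<Longrightarrow> euler q \<noteq> 0"
  by (simp add: euler_def qpoch_nonzero)

lemma qpoch_LIMSEQ:
  assumes "a \<ge> 1" "b \<ge> 1" "norm q < 1"
  shows "(\<lambda>N. \<Prod>m<N. 1 - q ^ (b * m + a)) \<longlonglongrightarrow> qpoch a b q"
proof -
  have "(\<lambda>N. \<Prod>m\<le>N. 1 - q ^ (b * m + a)) \<longlonglongrightarrow> qpoch a b q"
    unfolding qpoch_def by (intro convergent_prod_LIMSEQ qpoch_convergent assms)
  thus ?thesis
    by (subst filterlim_sequentially_Suc[symmetric]) (simp add: lessThan_Suc_atMost)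
qed

lemma qfact_LIMSEQ: "norm p < 1 \<Longrightarrow> qfact p \<longlonglongrightarrow> euler p"
  using qpoch_LIMSEQ[of 1 1 p] by (simp add: qfact_def[abs_def] euler_def)

text \<open>Completing the square in n turns the norm of each term into a constant times a shifted
  Gaussian.\<close>

lemma summable_on_jacobi:
  fixes q z :: complex
  assumes q: "norm q < 1" "q \<noteq> 0" and z: "z \<noteq> 0"
  shows "(\<lambda>n::int. norm (q ^ nat (n\<^sup>2) * z powi n)) summable_on UNIV"
proof -
  define c where "c = - ln (norm q)"
  define d where "d = ln (norm z)"
  have c: "c > 0" using q by (simp add: c_def)
  have "norm (q ^ nat (n\<^sup>2) * z powi n) = exp (d\<^sup>2 / (4 * c)) * exp (- c * (of_int n + - d / (2 * c))\<^sup>2)" for n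
  proof -
    have "norm q = exp (- c)" "norm z = exp d" using q z by (simp_all add: c_def d_def)
    hence "norm (q ^ nat (n\<^sup>2) * z powi n) = exp (- c * of_int n ^ 2) * exp (of_int n * d)"
      by (simp add: norm_mult norm_power norm_power_int mult.commute exp_power_int flip: exp_of_nat_mult)
    also have "\<dots> = exp (d\<^sup>2 / (4 * c)) * exp (- c * (of_int n + - d / (2 * c))\<^sup>2)"
      using c by (simp flip: exp_add) (simp add: power2_eq_square field_simps)
    finally show ?thesis .
  qed
  thus ?thesis
    using summable_on_cmult_right[OF summable_on_gauss[OF c, of "- d / (2 * c)"],
        of "exp (d\<^sup>2 / (4 * c))"] by simp
qed

text \<open>Limit of \<open>jacobi_finite\<close>: each \<open>qbinom\<close> tends to the
  reciprocal of \<open>euler (q^2)\<close>, and all of them are bounded by one constant. The product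
  enters as a sequence with limit \<open>L\<close>, so that each special z can supply it in a
  convenient closed form.\<close>

theorem jacobi_triple_product:
  fixes q z :: complex
  assumes q: "norm q < 1" "q \<noteq> 0" and z: "z \<noteq> 0"
    and L: "(\<lambda>N. \<Prod>k<N. (1 + z * q ^ (2 * k + 1)) * (1 + inverse z * q ^ (2 * k + 1))) \<longlonglongrightarrow> L"
  shows "(\<Sum>\<^sub>\<infinity>n::int. q ^ nat (n\<^sup>2) * z powi n) = euler (q\<^sup>2) * L"
proof -
  define p where "p = q\<^sup>2"
  have p: "norm p < 1" using q by (simp add: p_def norm_power power_less_one_iff)
  define h where "h = (\<lambda>n::int. q ^ nat (n\<^sup>2) * z powi n)"
  define f where "f = (\<lambda>N n. (if n \<in> {- int N..int N} then qbinom p (2 * N) (nat (n + int N)) else 0) * h n)"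
  have conv: "qfact p \<longlonglongrightarrow> euler p" "(\<lambda>k. inverse (qfact p k)) \<longlonglongrightarrow> inverse (euler p)"
    using qfact_LIMSEQ[OF p] euler_nonzero[OF p] by (auto intro!: tendsto_inverse)
  obtain B1 where B1: "\<And>k. norm (qfact p k) \<le> B1"
    using convergent_imp_Bseq[OF convergentI[OF conv(1)]] unfolding Bseq_def by blast
  obtain B2 where B2: "\<And>k. norm (inverse (qfact p k)) \<le> B2" "B2 > 0"
    using convergent_imp_Bseq[OF convergentI[OF conv(2)]] unfolding Bseq_def by blast
  have B1': "B1 \<ge> 0" using B1[of 0] norm_ge_zero order_trans by blast
  have qb: "norm (qbinom p M k) \<le> B1 * B2 * B2" for M k
  proof -
    have "norm (qfact p M * inverse (qfact p k) * inverse (qfact p (M - k))) \<le> B1 * B2 * B2"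
      unfolding norm_mult using B1 B1' B2 by (intro mult_mono mult_nonneg_nonneg) (auto simp: less_imp_le)
    moreover have "0 \<le> B1 * B2 * B2" using B1' B2 by simp
    ultimately show ?thesis by (simp add: qbinom_def field_simps)
  qed
  have "(\<lambda>N. \<Sum>\<^sub>\<infinity>n. f N n) \<longlonglongrightarrow> (\<Sum>\<^sub>\<infinity>n. inverse (euler p) * h n)"
  proof (rule tendsto_infsum_int)
    fix n :: int
    define m where "m = nat \<bar>n\<bar>"
    have lim: "(\<lambda>N. qfact p (2 * N) * (inverse (qfact p (nat (n + int N))) * inverse (qfact p (nat (int N - n)))))
        \<longlonglongrightarrow> euler p * (inverse (euler p) * inverse (euler p))"
    proof (intro tendsto_mult filterlim_compose[OF conv(1)] filterlim_compose[OF conv(2)])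
      show "filterlim (\<lambda>N. nat (n + int N)) at_top at_top"
        unfolding filterlim_at_top
      proof
        fix Z show "\<forall>\<^sub>F x in sequentially. Z \<le> nat (n + int x)"
          using eventually_ge_at_top[of "Z + m"] by eventually_elim (auto simp: m_def)
      qed
      show "filterlim (\<lambda>N. nat (int N - n)) at_top at_top"
        unfolding filterlim_at_top
      proof
        fix Z show "\<forall>\<^sub>F x in sequentially. Z \<le> nat (int x - n)"
          using eventually_ge_at_top[of "Z + m"] by eventually_elim (auto simp: m_def)
      qed
    qed (auto intro!: mult_nat_left_at_top)
    have "(\<lambda>N. qfact p (2 * N) * (inverse (qfact p (nat (n + int N))) * inverse (qfact p (nat (int N - n)))) * h n)
        \<longlonglongrightarrow> inverse (euler p) * h n"
    proof -
      have "euler p * (inverse (euler p) * inverse (euler p)) = inverse (euler p)"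
        using euler_nonzero[OF p] by simp
      thus ?thesis using tendsto_mult[OF lim tendsto_const[of "h n"]] by (simp only:)
    qed
    thus "(\<lambda>N. f N n) \<longlonglongrightarrow> inverse (euler p) * h n"
    proof (rule Lim_transform_eventually)
      show "\<forall>\<^sub>F N in sequentially. qfact p (2 * N) * (inverse (qfact p (nat (n + int N))) *
          inverse (qfact p (nat (int N - n)))) * h n = f N n"
        using eventually_ge_at_top[of m]
      proof eventually_elim
        case (elim N)
        have "n \<in> {- int N..int N}" "nat (n + int N) \<le> 2 * N" "2 * N - nat (n + int N) = nat (int N - n)"
          using elim by (auto simp: m_def)
        thus ?case by (simp add: f_def qbinom_def field_simps)
      qed
    qed
  next
    show "\<forall>\<^sub>F N in sequentially. \<forall>n. norm (f N n) \<le> B1 * B2 * B2 * norm (h n)"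
      using qb B1' B2 by (intro always_eventually allI) (auto simp: f_def norm_mult intro!: mult_right_mono)
    show "(\<lambda>n. B1 * B2 * B2 * norm (h n)) summable_on UNIV"
      unfolding h_def by (intro summable_on_cmult_right summable_on_jacobi q z)
  qed
  moreover have "(\<Sum>\<^sub>\<infinity>n. f N n) = (\<Prod>k<N. (1 + z * q ^ (2 * k + 1)) * (1 + inverse z * q ^ (2 * k + 1)))" for N
  proof -
    have "(\<Sum>\<^sub>\<infinity>n. f N n) = (\<Sum>\<^sub>\<infinity>n\<in>{- int N..int N}. f N n)"
      by (rule infsum_cong_neutral) (auto simp: f_def)
    also have "\<dots> = (\<Prod>k<N. (1 + z * q ^ (2 * k + 1)) * (1 + inverse z * q ^ (2 * k + 1)))"
      unfolding jacobi_finite[OF assms(1-3)] by (simp add: f_def h_def p_def)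
    finally show ?thesis .
  qed
  ultimately have "L = (\<Sum>\<^sub>\<infinity>n. inverse (euler p) * h n)"
    using L by (simp add: LIMSEQ_unique)
  also have "\<dots> = inverse (euler p) * (\<Sum>\<^sub>\<infinity>n. h n)"
    using euler_nonzero[OF p] by (intro infsum_cmult_right') 
  finally show ?thesis using euler_nonzero[OF p] by (simp add: h_def p_def field_simps)
qed

lemma euler_split:
  assumes "norm q < 1"
  shows "euler q = qpoch 1 2 q * euler (q\<^sup>2)"
proof -
  have q2: "norm (q\<^sup>2) < 1" using assms by (simp add: norm_power power_less_one_iff)
  have eq: "(\<Prod>m<2 * N. 1 - q ^ (1 * m + 1)) = (\<Prod>m<N. 1 - q ^ (2 * m + 1)) * (\<Prod>m<N. 1 - (q\<^sup>2) ^ (1 * m + 1))" for N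
    by (induction N) (simp_all add: power2_eq_square power_mult power_mult_distrib mult_ac)
  have "(\<lambda>N. \<Prod>m<2 * N. 1 - q ^ (1 * m + 1)) \<longlonglongrightarrow> euler q"
    unfolding euler_def by (rule filterlim_compose[OF qpoch_LIMSEQ]) (auto intro!: mult_nat_left_at_top assms)
  moreover have "(\<lambda>N. \<Prod>m<2 * N. 1 - q ^ (1 * m + 1)) \<longlonglongrightarrow> qpoch 1 2 q * euler (q\<^sup>2)"
    unfolding eq euler_def by (intro tendsto_mult qpoch_LIMSEQ assms q2) auto
  ultimately show ?thesis by (rule LIMSEQ_unique)
qed

text \<open>Each factor is rewritten by 1 + x = (1 - x^2) / (1 - x), so the limit is a quotient of
  two known products.\<close>

lemma prod_one_plus_LIMSEQ:
  assumes q: "norm q < 1" and "a \<ge> 1" "b \<ge> 1"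
  shows "(\<lambda>N. \<Prod>k<N. 1 + q ^ (b * k + a)) \<longlonglongrightarrow> qpoch a b (q\<^sup>2) / qpoch a b q"
proof -
  have q2: "norm (q\<^sup>2) < 1" using assms by (simp add: norm_power power_less_one_iff)
  have eq: "1 + q ^ (b * k + a) = (1 - (q\<^sup>2) ^ (b * k + a)) / (1 - q ^ (b * k + a))" for k
  proof -
    have "1 - q ^ (b * k + a) \<noteq> 0"
      using one_minus_power_nonzero[OF q, of "b * k + a - 1"] assms(2) by simp
    moreover have "(1 + q ^ (b * k + a)) * (1 - q ^ (b * k + a)) = 1 - (q\<^sup>2) ^ (b * k + a)"
      by (simp only: power2_eq_square power_mult_distrib) (simp add: algebra_simps)
    ultimately show ?thesis by (simp add: field_simps)
  qed
  show ?thesis unfolding eq prod_dividef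
    by (intro tendsto_divide qpoch_LIMSEQ qpoch_nonzero q q2 assms(2,3))
qed

theorem theta3_product:
  assumes q: "norm q < 1" "q \<noteq> 0"
  shows "(\<Sum>\<^sub>\<infinity>n::int. q ^ nat (n\<^sup>2)) = euler (q\<^sup>2) ^ 5 / (euler q ^ 2 * euler (q ^ 4) ^ 2)"
proof -
  have q2: "norm (q\<^sup>2) < 1" "norm (q ^ 4) < 1" using assms by (simp_all add: norm_power power_less_one_iff)
  note lim = prod_one_plus_LIMSEQ[OF q(1), of 1 2]
  have "(\<Sum>\<^sub>\<infinity>n::int. q ^ nat (n\<^sup>2) * 1 powi n) = euler (q\<^sup>2) * (qpoch 1 2 (q\<^sup>2) / qpoch 1 2 q * (qpoch 1 2 (q\<^sup>2) / qpoch 1 2 q))"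
    using tendsto_mult[OF lim lim] by (intro jacobi_triple_product q) (auto simp: prod.distrib)
  moreover have "qpoch 1 2 q = euler q / euler (q\<^sup>2)" "qpoch 1 2 (q\<^sup>2) = euler (q\<^sup>2) / euler (q ^ 4)"
    using euler_split[OF q(1)] euler_split[OF q2(1)] euler_nonzero[OF q2(1)] euler_nonzero[OF q2(2)]
    by (simp_all add: field_simps flip: power_mult)
  ultimately show ?thesis
    using euler_nonzero[OF q2(1)] by (simp add: field_simps eval_nat_numeral)
qed

theorem theta2_product:
  assumes q: "norm q < 1" "q \<noteq> 0"
  shows "(\<Sum>\<^sub>\<infinity>n::int. q ^ nat (n\<^sup>2) * q powi n) = 2 * euler (q ^ 4) ^ 2 / euler (q\<^sup>2)"
proof -
  have q2: "norm (q\<^sup>2) < 1" using assms by (simp_all add: norm_power power_less_one_iff)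
  define a where "a = (\<lambda>N. \<Prod>k<N. 1 + (q\<^sup>2) ^ (1 * k + 1))"
  have lim: "a \<longlonglongrightarrow> euler (q ^ 4) / euler (q\<^sup>2)"
    unfolding a_def using prod_one_plus_LIMSEQ[OF q2, of 1 1] by (simp add: euler_def flip: power_mult)
  \<comment> \<open>For z = q the factor with k = 0 in the second product is 2 and the others are
    those of \<open>a\<close> moved by one index, which explains the lengths N + 1 and N.\<close>
  have eq: "(\<Prod>k<Suc N. (1 + q * q ^ (2 * k + 1)) * (1 + inverse q * q ^ (2 * k + 1))) = a (Suc N) * (2 * a N)" for N
  proof -
    have "(\<Prod>k<Suc N. 1 + inverse q * q ^ (2 * k + 1)) = (\<Prod>k<Suc N. 1 + (q\<^sup>2) ^ k)"
      using q by (intro prod.cong refl) (simp flip: power_mult)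
    also have "\<dots> = 2 * a N"
      by (simp add: prod.lessThan_Suc_shift a_def del: prod.lessThan_Suc)
    finally have 1: "(\<Prod>k<Suc N. 1 + inverse q * q ^ (2 * k + 1)) = 2 * a N" .
    have 2: "(\<Prod>k<Suc N. 1 + q * q ^ (2 * k + 1)) = a (Suc N)"
      unfolding a_def by (intro prod.cong refl) (simp flip: power_mult, simp add: power2_eq_square)
    show ?thesis unfolding prod.distrib 1 2 ..
  qed
  have "(\<Sum>\<^sub>\<infinity>n::int. q ^ nat (n\<^sup>2) * q powi n) =
        euler (q\<^sup>2) * (euler (q ^ 4) / euler (q\<^sup>2) * (2 * (euler (q ^ 4) / euler (q\<^sup>2))))"
  proof (rule jacobi_triple_product[OF q q(2)])
    show "(\<lambda>N. \<Prod>k<N. (1 + q * q ^ (2 * k + 1)) * (1 + inverse q * q ^ (2 * k + 1)))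
      \<longlonglongrightarrow> euler (q ^ 4) / euler (q\<^sup>2) * (2 * (euler (q ^ 4) / euler (q\<^sup>2)))"
      by (subst filterlim_sequentially_Suc[symmetric], subst eq)
         (intro tendsto_mult tendsto_const LIMSEQ_Suc lim)
  qed
  thus ?thesis using euler_nonzero[OF q2] by (simp add: field_simps power2_eq_square)
qed

section \<open>Inversion of theta functions\<close>

lemma nome_add: "nome (x + y) = nome x * nome y"
  by (simp add: nome_def ring_distribs exp_add)

lemma nome_0 [simp]: "nome 0 = 1"
  by (simp add: nome_def)

lemma nome_nonzero [simp]: "nome x \<noteq> 0"
  by (simp add: nome_def)

lemma nome_diff: "nome (x - y) = nome x / nome y"
  by (simp add: nome_def ring_distribs exp_diff)

lemma nome_of_nat_mult: "nome (of_nat n * x) = nome x ^ n"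
  by (simp add: nome_def mult_ac flip: exp_of_nat_mult)

lemma nome_of_int_mult: "nome (of_int n * x) = nome x powi n"
  by (simp add: nome_def exp_power_int mult_ac)

lemma nome_of_int [simp]: "nome (of_int n) = 1"
  using exp_integer_2pi[of "of_int n"] by (simp add: nome_def mult_ac)

lemma nome_of_nat [simp]: "nome (of_nat n) = 1"
  using nome_of_int[of "int n"] by (simp del: nome_of_int)

lemma nome_1 [simp]: "nome 1 = 1"
  using nome_of_int[of 1] by (simp del: nome_of_int)

lemma nome_half [simp]: "nome (1 / 2) = -1"
  by (simp add: nome_def)

lemma norm_nome: "norm (nome x) = exp (- 2 * pi * Im x)"
  by (simp add: nome_def norm_exp_eq_Re)

lemma norm_nome_less_1: "Im x > 0 \<Longrightarrow> norm (nome x) < 1"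
  by (simp add: norm_nome)

lemma nome_eq_1_iff: "nome x = 1 \<longleftrightarrow> x \<in> \<int>"
proof
  assume "nome x = 1"
  then obtain n :: int where n: "Re (2 * of_real pi * \<i> * x) = 0" "Im (2 * of_real pi * \<i> * x) = of_int (2 * n) * pi"
    unfolding nome_def exp_eq_1 by auto
  hence "x = of_int n" by (simp add: complex_eq_iff)
  thus "x \<in> \<int>" by simp
next
  assume "x \<in> \<int>" thus "nome x = 1" by (elim Ints_cases) simp
qed

lemma sum_roots_of_unity:
  fixes N :: nat and a :: int
  assumes N: "N > 0"
  shows "(\<Sum>j<N. nome (of_int a * of_nat j / of_nat N)) = (if int N dvd a then of_nat N else 0)"
proof -
  define z where "z = nome (of_int a / of_nat N)"
  have z: "nome (of_int a * of_nat j / of_nat N) = z ^ j" for j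
    unfolding z_def by (simp add: mult_ac flip: nome_of_nat_mult)
  have zN: "z ^ N = 1"
    unfolding z_def using N by (simp flip: nome_of_nat_mult)
  have "z = 1 \<longleftrightarrow> int N dvd a"
  proof -
    have "z = 1 \<longleftrightarrow> (of_int a / of_int (int N) :: complex) \<in> \<int>"
      by (simp add: z_def nome_eq_1_iff)
    also have "\<dots> \<longleftrightarrow> int N dvd a"
      using N by (subst of_int_div_of_int_in_Ints_iff) auto
    finally show ?thesis .
  qed
  thus ?thesis unfolding z using zN by (auto simp: sum_gp_strict)
qed

lemma sum_roots_of_unity_symm:
  fixes a :: int
  shows "(\<Sum>j=-int s..int s. nome (of_int (a * j) / of_nat (2 * s + 1))) =
         (if int (2 * s + 1) dvd a then of_nat (2 * s + 1) else 0)"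
proof -
  have "(\<Sum>j=-int s..int s. nome (of_int (a * j) / of_nat (2 * s + 1))) =
    (\<Sum>i<2 * s + 1. nome (of_int a * of_nat i / of_nat (2 * s + 1)) * nome (- of_int a * of_nat s / of_nat (2 * s + 1)))"
    by (rule sum.reindex_bij_witness[of _ "\<lambda>i. int i - int s" "\<lambda>j. nat (j + int s)"])
       (auto simp: ring_distribs diff_divide_distrib add_divide_distrib simp flip: nome_add)
  also have "\<dots> = (if int (2 * s + 1) dvd a then of_nat (2 * s + 1) else 0) * nome (- of_int a * of_nat s / of_nat (2 * s + 1))"
    unfolding sum_distrib_right[symmetric] by (subst sum_roots_of_unity) auto
  also have "\<dots> = (if int (2 * s + 1) dvd a then of_nat (2 * s + 1) else 0)"
  proof (cases "int (2 * s + 1) dvd a")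
    case True
    then obtain b where b: "a = int (2 * s + 1) * b" by (elim dvdE)
    have "- of_int a * of_nat s / of_nat (2 * s + 1) = (of_int (- b * int s) :: complex)"
    proof -
      have nz: "(of_nat (2 * s + 1) :: complex) \<noteq> 0" by (simp only: of_nat_eq_0_iff)
      have "(of_int a :: complex) = of_nat (2 * s + 1) * of_int b"
        unfolding b by (simp only: of_int_mult of_int_of_nat_eq)
      thus ?thesis using nz by (simp only: of_int_mult of_int_minus of_int_of_nat_eq) (simp add: field_simps)
    qed
    hence "nome (- of_int a * of_nat s / of_nat (2 * s + 1)) = 1" by (simp only: nome_of_int)
    thus ?thesis by (simp only: mult_1_right)
  qed auto
  finally show ?thesis .
qed

text \<open>Binomial expansion of a sum of two conjugate exponentials; the even exponent leaves only
  integral frequencies, from -m to m.\<close>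

lemma cos_power_even:
  fixes u :: real
  shows "complex_of_real ((2 * cos (pi * u)) ^ (2 * m)) =
    (\<Sum>k=- int m..int m. of_nat ((2 * m) choose nat (int m + k)) * nome (of_int k * of_real u))"
proof -
  have c: "complex_of_real (2 * cos (pi * u)) = nome (of_real u / 2) + nome (- of_real u / 2)"
    by (simp add: nome_def cos_exp_eq mult_ac flip: cos_of_real)
  have "complex_of_real ((2 * cos (pi * u)) ^ (2 * m)) = (nome (of_real u / 2) + nome (- of_real u / 2)) ^ (2 * m)"
    by (simp only: of_real_power c)
  also have "\<dots> = (\<Sum>k\<le>2 * m. of_nat ((2 * m) choose k) * nome (of_real u / 2) ^ k * nome (- of_real u / 2) ^ (2 * m - k))"
    by (rule binomial_ring)
  also have "\<dots> = (\<Sum>k=- int m..int m. of_nat ((2 * m) choose nat (int m + k)) * nome (of_int k * of_real u))"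
  proof (rule sum.reindex_bij_witness[of _ "\<lambda>k. nat (int m + k)" "\<lambda>k. int k - int m"])
    fix k assume k: "k \<in> {..2 * m}"
    have "of_nat k * (of_real u / 2) + of_nat (2 * m - k) * (- of_real u / 2) = of_int (int k - int m) * complex_of_real u"
      using k by (simp add: of_nat_diff field_simps)
    thus "of_nat ((2 * m) choose nat (int m + (int k - int m))) * nome (of_int (int k - int m) * of_real u) =
        of_nat ((2 * m) choose k) * nome (of_real u / 2) ^ k * nome (- of_real u / 2) ^ (2 * m - k)"
      by (simp only: nome_of_nat_mult[symmetric] mult.assoc nome_add[symmetric]) simp
  qed auto
  finally show ?thesis .
qed

text \<open>
  Polya's finite form of the inversion formula. If \<open>m\<close> grows like \<open>T (2 s + 1)\<^sup>2\<close>, then both the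
  powers of cosines and the quotients of binomial coefficients tend to Gaussians.
\<close>

lemma polya_identity:
  fixes x :: real and s m :: nat
  defines "l \<equiv> 2 * s + 1"
  shows "(\<Sum>j=-int s..int s. complex_of_real ((2 * cos (pi * ((of_int j + x) / of_nat l))) ^ (2 * m))) =
    of_nat l * (\<Sum>j | int l * \<bar>j\<bar> \<le> int m. of_nat ((2 * m) choose nat (int m + int l * j)) * nome (of_int j * of_real x))"
proof -
  have l: "l > 0" by (simp add: l_def)
  have fin: "finite {j. int l * \<bar>j\<bar> \<le> int m}"
  proof (rule finite_subset)
    show "{j. int l * \<bar>j\<bar> \<le> int m} \<subseteq> {- int m..int m}"
    proof safe
      fix j assume "int l * \<bar>j\<bar> \<le> int m"
      moreover have "1 * \<bar>j\<bar> \<le> int l * \<bar>j\<bar>" using l by (intro mult_right_mono) auto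
      ultimately show "j \<in> {- int m..int m}" by auto
    qed
  qed auto
  define C where "C = (\<lambda>k. of_nat ((2 * m) choose nat (int m + k)) :: complex)"
  have "(\<Sum>j=-int s..int s. complex_of_real ((2 * cos (pi * ((of_int j + x) / of_nat l))) ^ (2 * m))) =
    (\<Sum>j=-int s..int s. \<Sum>k=- int m..int m. C k * nome (of_int k * of_real x / of_nat l) * nome (of_int (k * j) / of_nat l))"
    unfolding cos_power_even C_def
    by (intro sum.cong refl) (simp add: add_divide_distrib ring_distribs nome_add mult_ac)
  also have "\<dots> = (\<Sum>k=- int m..int m. C k * nome (of_int k * of_real x / of_nat l) * (\<Sum>j=-int s..int s. nome (of_int (k * j) / of_nat l)))"
    by (subst sum.swap) (simp only: sum_distrib_left)
  \<comment> \<open>Summing over l equally spaced points keeps only the frequencies divisible by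
    l.\<close>
  also have "\<dots> = (\<Sum>k=- int m..int m. C k * nome (of_int k * of_real x / of_nat l) * (if int l dvd k then of_nat l else 0))"
    unfolding l_def by (subst sum_roots_of_unity_symm) (rule refl)
  also have "\<dots> = (\<Sum>k\<in>{k\<in>{- int m..int m}. int l dvd k}. of_nat l * (C k * nome (of_int k * of_real x / of_nat l)))"
    by (rule sum.mono_neutral_cong_right) auto
  also have "\<dots> = (\<Sum>j | int l * \<bar>j\<bar> \<le> int m. of_nat l * (C (int l * j) * nome (of_int j * of_real x)))"
  proof (rule sum.reindex_bij_witness[of _ "\<lambda>j. int l * j" "\<lambda>k. k div int l"])
    fix k assume "k \<in> {k\<in>{- int m..int m}. int l dvd k}"
    thus "k div int l \<in> {j. int l * \<bar>j\<bar> \<le> int m}"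
      using l by (auto elim!: dvdE simp: abs_mult abs_if split: if_splits)
  next
    fix j assume "j \<in> {j. int l * \<bar>j\<bar> \<le> int m}"
    hence "\<bar>int l * j\<bar> \<le> int m" by (simp add: abs_mult)
    thus "int l * j \<in> {k\<in>{- int m..int m}. int l dvd k}" by auto
  qed (use l in \<open>auto elim!: dvdE\<close>)
  finally show ?thesis unfolding C_def sum_distrib_left .
qed

section \<open>Gaussian limits of binomial coefficients and of powers of cosines\<close>

lemma binomial_ratio:
  assumes "k \<le> m"
  shows "real ((2 * m) choose (m + k)) / real ((2 * m) choose m) = (\<Prod>i<k. (real m - real i) / (real m + real i + 1))"
  using assms
proof (induction k)
  case (Suc k)
  have "(2 * m - (m + k)) * ((2 * m) choose (m + k)) = Suc (m + k) * ((2 * m) choose Suc (m + k))"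
    using binomial_absorb_comp[of "2 * m" "m + k"] Suc_times_binomial[of "m + k" "2 * m - 1"] Suc.prems
    by simp
  hence "real ((2 * m - (m + k)) * ((2 * m) choose (m + k))) = real (Suc (m + k) * ((2 * m) choose Suc (m + k)))"
    by (rule arg_cong)
  hence "real ((2 * m) choose Suc (m + k)) = real ((2 * m) choose (m + k)) * ((real m - real k) / (real m + real k + 1))"
    using Suc.prems by (simp add: field_simps of_nat_diff)
  hence "real ((2 * m) choose (m + Suc k)) / real ((2 * m) choose m) =
    real ((2 * m) choose (m + k)) / real ((2 * m) choose m) * ((real m - real k) / (real m + real k + 1))"
    by simp
  thus ?case using Suc by (simp only: prod.lessThan_Suc Suc_leD)
qed auto

lemma prod_exp_odd: "(\<Prod>i<k. exp (- (2 * real i + 1) / c)) = exp (- (real k)\<^sup>2 / c)"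
proof -
  have "(\<Sum>i<k. - (2 * real i + 1) / c) = - (real k)\<^sup>2 / c"
  proof (induction k)
    case (Suc k)
    have "- (real k)\<^sup>2 / c + - (2 * real k + 1) / c = - (real (Suc k))\<^sup>2 / c"
      by (simp add: power2_eq_square algebra_simps flip: add_divide_distrib)
    thus ?case using Suc by simp
  qed auto
  thus ?thesis by (simp flip: exp_sum)
qed

text \<open>Each factor is 1 - (2 i + 1) / (m + i + 1). The inequality 1 + x <= exp x, with all
  denominators enlarged to m + k, leaves exponents that add up to k^2 by
  \<open>prod_exp_odd\<close>.\<close>

lemma binomial_ratio_le:
  assumes "k \<le> m" "m > 0"
  shows "real ((2 * m) choose (m + k)) / real ((2 * m) choose m) \<le> exp (- (real k)\<^sup>2 / (real m + real k))"
proof -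
  have "(\<Prod>i<k. (real m - real i) / (real m + real i + 1)) \<le> (\<Prod>i<k. exp (- (2 * real i + 1) / (real m + real k)))"
  proof (rule prod_mono)
    fix i assume "i \<in> {..<k}"
    hence i: "i < k" by simp
    have "(real m - real i) / (real m + real i + 1) = 1 + - (2 * real i + 1) / (real m + real i + 1)"
      by (simp add: field_simps)
    also have "\<dots> \<le> exp (- (2 * real i + 1) / (real m + real i + 1))" by (rule exp_ge_add_one_self)
    also have "\<dots> \<le> exp (- (2 * real i + 1) / (real m + real k))"
    proof -
      have "(2 * real i + 1) / (real m + real k) \<le> (2 * real i + 1) / (real m + real i + 1)"
        using i assms by (intro divide_left_mono) auto
      thus ?thesis by (simp only: exp_le_cancel_iff minus_divide_left[symmetric] neg_le_iff_le)
    qed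
    finally show "0 \<le> (real m - real i) / (real m + real i + 1) \<and>
      (real m - real i) / (real m + real i + 1) \<le> exp (- (2 * real i + 1) / (real m + real k))"
      using i assms by auto
  qed
  also have "\<dots> = exp (- (real k)\<^sup>2 / (real m + real k))"
    by (rule prod_exp_odd)
  finally show ?thesis by (simp add: binomial_ratio[OF assms(1)])
qed

text \<open>The same inequality applied to the reciprocals of the factors, whose denominators exceed
  m - k.\<close>

lemma binomial_ratio_ge:
  assumes "k < m"
  shows "real ((2 * m) choose (m + k)) / real ((2 * m) choose m) \<ge> exp (- (real k)\<^sup>2 / (real m - real k))"
proof -
  have "(\<Prod>i<k. (real m - real i) / (real m + real i + 1)) \<ge> (\<Prod>i<k. exp (- (2 * real i + 1) / (real m - real k)))"
  proof (rule prod_mono)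
    fix i assume "i \<in> {..<k}"
    hence i: "i < k" by simp
    have "(real m + real i + 1) / (real m - real i) = 1 + (2 * real i + 1) / (real m - real i)"
      using i assms by (simp add: field_simps)
    also have "\<dots> \<le> exp ((2 * real i + 1) / (real m - real i))" by (rule exp_ge_add_one_self)
    also have "\<dots> \<le> exp ((2 * real i + 1) / (real m - real k))"
      using i assms by (simp, intro divide_left_mono) auto
    finally have "inverse (exp ((2 * real i + 1) / (real m - real k))) \<le> inverse ((real m + real i + 1) / (real m - real i))"
      using i assms by (intro le_imp_inverse_le) auto
    thus "0 \<le> exp (- (2 * real i + 1) / (real m - real k)) \<and>
      exp (- (2 * real i + 1) / (real m - real k)) \<le> (real m - real i) / (real m + real i + 1)"
      by (simp only: exp_minus minus_divide_left[symmetric]) simp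
  qed
  also have "(\<Prod>i<k. exp (- (2 * real i + 1) / (real m - real k))) = exp (- (real k)\<^sup>2 / (real m - real k))"
    by (rule prod_exp_odd)
  finally show ?thesis using assms by (simp add: binomial_ratio)
qed

text \<open>The left side is exactly the reciprocal of the m-th partial product in Wallis'
  formula.\<close>

lemma central_binomial_wallis:
  "(\<lambda>m. (real ((2 * m) choose m) / 4 ^ m)\<^sup>2 * (2 * real m + 1)) \<longlonglongrightarrow> 2 / pi"
proof -
  have eq: "(real ((2 * m) choose m) / 4 ^ m)\<^sup>2 * (2 * real m + 1) = inverse (\<Prod>k=1..m. (4 * (real k)\<^sup>2) / (4 * (real k)\<^sup>2 - 1))" for m
  proof (induction m)
    case (Suc m)
    have b: "real ((2 * Suc m) choose Suc m) = real ((2 * m) choose m) * (2 * (2 * real m + 1) / (real m + 1))"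
    proof -
      have "real ((2 * Suc m) choose Suc m) = fact (2 * Suc m) / (fact (Suc m) * fact (Suc m))"
        by (subst binomial_fact) auto
      also have "\<dots> = fact (2 * m) / (fact m * fact m) * (2 * (2 * real m + 1) / (real m + 1))"
        by (simp add: divide_simps) (simp add: algebra_simps)
      also have "fact (2 * m) / (fact m * fact m) = real ((2 * m) choose m)"
        by (subst binomial_fact) auto
      finally show ?thesis .
    qed
    \<comment> \<open>The ratio of consecutive terms, by 4 (m + 1)^2 - 1 = (2 m + 1) (2 m + 3);
      \<open>c\<close> and \<open>d\<close> hide the binomial coefficient and the power of
      4.\<close>
    have r: "(c * (2 * (2 * real m + 1) / (real m + 1)) / (4 * d))\<^sup>2 * (2 * real m + 3)
       = (c / d)\<^sup>2 * (2 * real m + 1) * inverse ((4 * (real m + 1)\<^sup>2) / (4 * (real m + 1)\<^sup>2 - 1))" for c d :: real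
    proof -
      have "4 * (real m + 1)\<^sup>2 - 1 = (2 * real m + 1) * (2 * real m + 3)"
        by (simp add: power2_eq_square algebra_simps)
      moreover have "(c * (2 * B / A) / (4 * d))\<^sup>2 * C = (c / d)\<^sup>2 * B * inverse ((4 * A\<^sup>2) / (B * C))"
        if "B \<noteq> 0" for A B C
        using that by (simp add: power_mult_distrib power_divide power2_eq_square mult_ac)
      moreover have "2 * real m + 1 \<noteq> 0" by linarith
      ultimately show ?thesis by (simp only:)
    qed
    have "(real ((2 * Suc m) choose Suc m) / 4 ^ Suc m)\<^sup>2 * (2 * real (Suc m) + 1)
       = (real ((2 * m) choose m) * (2 * (2 * real m + 1) / (real m + 1)) / (4 * 4 ^ m))\<^sup>2 * (2 * real m + 3)"
      unfolding b by simp
    also have "\<dots> = inverse (\<Prod>k=1..m. (4 * (real k)\<^sup>2) / (4 * (real k)\<^sup>2 - 1)) *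
        inverse ((4 * (real m + 1)\<^sup>2) / (4 * (real m + 1)\<^sup>2 - 1))"
      unfolding r Suc.IH ..
    also have "\<dots> = inverse (\<Prod>k=1..Suc m. (4 * (real k)\<^sup>2) / (4 * (real k)\<^sup>2 - 1))"
    proof -
      have "(\<Prod>k=1..Suc m. (4 * (real k)\<^sup>2) / (4 * (real k)\<^sup>2 - 1)) =
        (4 * (real (Suc m))\<^sup>2) / (4 * (real (Suc m))\<^sup>2 - 1) * (\<Prod>k=1..m. (4 * (real k)\<^sup>2) / (4 * (real k)\<^sup>2 - 1))"
        by (rule prod.nat_ivl_Suc') simp
      moreover have "real (Suc m) = real m + 1" by simp
      ultimately show ?thesis by (simp only: inverse_mult_distrib mult.commute)
    qed
    finally show ?case .
  qed auto
  show ?thesis unfolding eq using tendsto_inverse[OF wallis] by simp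
qed

text \<open>By concavity the sine lies above its chord on [0, pi/2]. This yields a Gaussian majorant
  of the cosine powers that is uniform in s.\<close>

lemma sin_pi_ge:
  assumes "\<bar>u\<bar> \<le> 1 / 2"
  shows "4 * u\<^sup>2 \<le> (sin (pi * u))\<^sup>2"
proof -
  have *: "2 * v \<le> sin (pi * v)" if v: "0 \<le> v" "v \<le> 1 / 2" for v
  proof -
    have "convex_on {0..pi/2} (\<lambda>x. - sin x)"
      by (rule f''_ge0_imp_convex[where f' = "\<lambda>x. - cos x" and f'' = sin])
         (auto intro!: derivative_eq_intros sin_ge_zero)
    from convex_onD[OF this, of "2 * v" 0 "pi / 2"] show ?thesis using v by (simp add: mult_ac)
  qed
  have "2 * \<bar>u\<bar> \<le> sin (pi * \<bar>u\<bar>)" using assms by (intro *) auto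
  hence "(2 * \<bar>u\<bar>)\<^sup>2 \<le> (sin (pi * \<bar>u\<bar>))\<^sup>2" by (intro power_mono) auto
  thus ?thesis by (cases "u \<ge> 0") (auto simp: power_mult_distrib)
qed

definition polya_len :: "nat \<Rightarrow> nat" where "polya_len s = 2 * s + 1"

definition polya_exp :: "real \<Rightarrow> nat \<Rightarrow> nat" where
  "polya_exp T s = nat \<lfloor>T * (real (polya_len s))\<^sup>2\<rfloor>"

lemma polya_len_pos: "real (polya_len s) > 0"
  by (simp add: polya_len_def)

lemma polya_exp_le: "T > 0 \<Longrightarrow> real (polya_exp T s) \<le> T * (real (polya_len s))\<^sup>2"
  unfolding polya_exp_def by (simp add: of_nat_floor)

lemma polya_exp_ge: "T > 0 \<Longrightarrow> real (polya_exp T s) \<ge> T * (real (polya_len s))\<^sup>2 - 1"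
  unfolding polya_exp_def by linarith

lemma polya_exp_ratio:
  assumes "T > 0"
  shows "(\<lambda>s. real (polya_exp T s) / (real (polya_len s))\<^sup>2) \<longlonglongrightarrow> T"
proof (rule real_tendsto_sandwich)
  show "(\<lambda>s. T - 1 / (real (polya_len s))\<^sup>2) \<longlonglongrightarrow> T"
    unfolding polya_len_def by real_asymp
  show "\<forall>\<^sub>F s in sequentially. T - 1 / (real (polya_len s))\<^sup>2 \<le> real (polya_exp T s) / (real (polya_len s))\<^sup>2"
  proof (intro always_eventually allI)
    fix s
    have "T - 1 / (real (polya_len s))\<^sup>2 = (T * (real (polya_len s))\<^sup>2 - 1) / (real (polya_len s))\<^sup>2"
      using polya_len_pos[of s] by (simp add: diff_divide_distrib)
    also have "\<dots> \<le> real (polya_exp T s) / (real (polya_len s))\<^sup>2"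
      by (intro divide_right_mono polya_exp_ge assms) auto
    finally show "T - 1 / (real (polya_len s))\<^sup>2 \<le> real (polya_exp T s) / (real (polya_len s))\<^sup>2" .
  qed
  show "\<forall>\<^sub>F s in sequentially. real (polya_exp T s) / (real (polya_len s))\<^sup>2 \<le> T"
  proof (intro always_eventually allI)
    fix s show "real (polya_exp T s) / (real (polya_len s))\<^sup>2 \<le> T"
      using polya_exp_le[OF assms, of s] polya_len_pos[of s] by (simp add: field_simps)
  qed
qed auto

lemma polya_exp_at_top:
  assumes "T > 0"
  shows "filterlim (polya_exp T) at_top sequentially"
proof -
  have "filterlim (\<lambda>s. real (polya_exp T s)) at_top sequentially"
  proof (rule filterlim_at_top_mono)
    show "filterlim (\<lambda>s. T * (real (polya_len s))\<^sup>2 - 1) at_top sequentially"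
      unfolding polya_len_def using assms by real_asymp
  qed (use polya_exp_ge[OF assms] in auto)
  thus ?thesis by (simp add: filterlim_sequentially_iff_filterlim_real)
qed

text \<open>From cos^2 = 1 - sin^2 and, in the companion \<open>cos_sq_power_ge\<close>, 1 / cos^2 =
  1 + tan^2, both estimated by 1 + x <= exp x. Sine and tangent agree to first order, so the two
  bounds enclose the same limit.\<close>

lemma cos_sq_power_le: "(cos t ^ (2 * m) :: real) \<le> exp (- real m * (sin t)\<^sup>2)"
proof -
  have "(cos t)\<^sup>2 = 1 + - (sin t)\<^sup>2" by (simp add: cos_squared_eq)
  also have "\<dots> \<le> exp (- (sin t)\<^sup>2)" by (rule exp_ge_add_one_self)
  finally have "((cos t)\<^sup>2) ^ m \<le> exp (- (sin t)\<^sup>2) ^ m" by (intro power_mono) auto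
  thus ?thesis by (simp add: power_mult flip: exp_of_nat_mult)
qed

lemma cos_sq_power_ge:
  assumes "cos t \<noteq> (0::real)"
  shows "cos t ^ (2 * m) \<ge> exp (- real m * (tan t)\<^sup>2)"
proof -
  have "inverse ((cos t)\<^sup>2) = 1 + (tan t)\<^sup>2"
    using assms by (simp add: tan_def power_divide sin_squared_eq field_simps)
  also have "\<dots> \<le> exp ((tan t)\<^sup>2)" by (rule exp_ge_add_one_self)
  finally have "inverse (exp ((tan t)\<^sup>2)) \<le> inverse (inverse ((cos t)\<^sup>2))"
    using assms by (intro le_imp_inverse_le) auto
  hence "exp (- (tan t)\<^sup>2) \<le> (cos t)\<^sup>2" by (simp add: exp_minus)
  hence "exp (- (tan t)\<^sup>2) ^ m \<le> ((cos t)\<^sup>2) ^ m" by (intro power_mono) auto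
  thus ?thesis by (simp add: power_mult flip: exp_of_nat_mult)
qed

lemma cos_power_tendsto:
  assumes T: "T > 0"
  shows "(\<lambda>s. cos (y / real (polya_len s)) ^ (2 * polya_exp T s)) \<longlonglongrightarrow> exp (- T * y\<^sup>2)"
proof (rule real_tendsto_sandwich)
  let ?l = "\<lambda>s. real (polya_len s)" and ?m = "\<lambda>s. real (polya_exp T s)"
  have eq: "- ?m s * z\<^sup>2 = - (?m s / (?l s)\<^sup>2) * (?l s * z)\<^sup>2" for s z
    using polya_len_pos[of s] by (simp add: power_mult_distrib)
  have s: "(\<lambda>s. ?l s * sin (y / ?l s)) \<longlonglongrightarrow> y" unfolding polya_len_def by real_asymp
  have t: "(\<lambda>s. ?l s * tan (y / ?l s)) \<longlonglongrightarrow> y" unfolding polya_len_def tan_def by real_asymp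
  have "(\<lambda>s. cos (y / ?l s)) \<longlonglongrightarrow> 1" unfolding polya_len_def by real_asymp
  hence "\<forall>\<^sub>F s in sequentially. cos (y / ?l s) > 0" by (rule order_tendstoD) auto
  thus "\<forall>\<^sub>F s in sequentially. exp (- ?m s * (tan (y / ?l s))\<^sup>2) \<le> cos (y / ?l s) ^ (2 * polya_exp T s)"
    by eventually_elim (intro cos_sq_power_ge, auto)
  show "\<forall>\<^sub>F s in sequentially. cos (y / ?l s) ^ (2 * polya_exp T s) \<le> exp (- ?m s * (sin (y / ?l s))\<^sup>2)"
    by (intro always_eventually allI cos_sq_power_le)
  show "(\<lambda>s. exp (- ?m s * (sin (y / ?l s))\<^sup>2)) \<longlonglongrightarrow> exp (- T * y\<^sup>2)"
    unfolding eq by (intro tendsto_intros polya_exp_ratio T s)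
  show "(\<lambda>s. exp (- ?m s * (tan (y / ?l s))\<^sup>2)) \<longlonglongrightarrow> exp (- T * y\<^sup>2)"
    unfolding eq by (intro tendsto_intros polya_exp_ratio T t)
qed

lemma central_binomial_reflect:
  assumes "\<bar>k\<bar> \<le> int m"
  shows "(2 * m) choose nat (int m + k) = (2 * m) choose (m + nat \<bar>k\<bar>)"
proof (cases "k \<ge> 0")
  case True
  thus ?thesis by (simp add: nat_add_distrib)
next
  case False
  have "nat (int m + k) \<le> 2 * m" "2 * m - nat (int m + k) = m + nat \<bar>k\<bar>" using False assms by auto
  thus ?thesis using binomial_symmetric[of "nat (int m + k)" "2 * m"] by simp
qed

text \<open>The coefficients in \<open>polya_identity\<close>, divided by the central one so that
  they converge; the central one is treated in \<open>polya_const_tendsto\<close>.\<close>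

definition polya_coeff :: "real \<Rightarrow> nat \<Rightarrow> int \<Rightarrow> real" where
  "polya_coeff T s j = (if int (polya_len s) * \<bar>j\<bar> \<le> int (polya_exp T s)
     then real ((2 * polya_exp T s) choose (polya_exp T s + polya_len s * nat \<bar>j\<bar>)) /
          real ((2 * polya_exp T s) choose polya_exp T s) else 0)"

lemma polya_coeff_le:
  assumes T: "T > 0"
  shows "\<bar>polya_coeff T s j\<bar> \<le> exp (- (1 / (2 * T)) * (of_int j)\<^sup>2)"
proof (cases "int (polya_len s) * \<bar>j\<bar> \<le> int (polya_exp T s) \<and> j \<noteq> 0")
  case True
  define l m where "l = polya_len s" and "m = polya_exp T s"
  define k where "k = l * nat \<bar>j\<bar>"
  have k: "k \<le> m"
  proof -
    have "int k \<le> int m" using True by (simp add: k_def l_def m_def)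
    thus ?thesis by simp
  qed
  have l: "real l > 0" using polya_len_pos by (simp add: l_def)
  hence "k > 0" using True by (simp add: k_def)
  hence m: "real m > 0" using k by simp
  have "\<bar>polya_coeff T s j\<bar> = real ((2 * m) choose (m + k)) / real ((2 * m) choose m)"
    using True by (simp add: polya_coeff_def l_def m_def k_def)
  also have "\<dots> \<le> exp (- (real k)\<^sup>2 / (real m + real k))"
    by (rule binomial_ratio_le) (use k m in auto)
  \<comment> \<open>From k <= m the denominator m + k is at most 2 m <= 2 T l^2; losing the factor 2
    against the limit is harmless for a majorant.\<close>
  also have "\<dots> \<le> exp (- (1 / (2 * T)) * (of_int j)\<^sup>2)"
  proof -
    have m2: "real m \<le> T * (real l)\<^sup>2" using polya_exp_le[OF T] by (simp add: m_def l_def)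
    have k2: "(real k)\<^sup>2 = (real l)\<^sup>2 * (of_int j)\<^sup>2"
      by (simp add: k_def power_mult_distrib)
    have "(1 / (2 * T)) * (of_int j)\<^sup>2 = (real k)\<^sup>2 / (2 * (T * (real l)\<^sup>2))"
      using l T by (simp add: k2)
    also have "\<dots> \<le> (real k)\<^sup>2 / (real m + real k)"
      using m2 k m l T by (intro divide_left_mono mult_pos_pos) auto
    finally show ?thesis by (simp flip: minus_divide_left)
  qed
  finally show ?thesis .
next
  case False
  thus ?thesis by (auto simp: polya_coeff_def)
qed

lemma polya_coeff_tendsto:
  assumes T: "T > 0"
  shows "(\<lambda>s. polya_coeff T s j) \<longlonglongrightarrow> exp (- (1 / T) * (of_int j)\<^sup>2)"
proof -
  define a where "a = real (nat \<bar>j\<bar>)"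
  have a2: "a\<^sup>2 = (of_int j)\<^sup>2" by (simp add: a_def)
  let ?l = "\<lambda>s. real (polya_len s)" and ?m = "\<lambda>s. real (polya_exp T s)"
  let ?k = "\<lambda>s. real (polya_len s * nat \<bar>j\<bar>)"
  have inv: "(\<lambda>s. a / ?l s) \<longlonglongrightarrow> 0" unfolding polya_len_def by real_asymp
  have up: "(\<lambda>s. exp (- (a\<^sup>2 / (?m s / (?l s)\<^sup>2 + a / ?l s)))) \<longlonglongrightarrow> exp (- (a\<^sup>2 / (T + 0)))"
    by (intro tendsto_intros polya_exp_ratio T inv) (use T in auto)
  have lo: "(\<lambda>s. exp (- (a\<^sup>2 / (?m s / (?l s)\<^sup>2 - a / ?l s)))) \<longlonglongrightarrow> exp (- (a\<^sup>2 / (T - 0)))"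
    by (intro tendsto_intros polya_exp_ratio T inv) (use T in auto)
  \<comment> \<open>Dividing by the squared length expresses the exponents through quantities with
    known limits; \<open>w\<close> is 1 for the upper and -1 for the lower bound.\<close>
  have quot: "x ^ 2 * y ^ 2 / (z + w * (x * y)) = y ^ 2 / (z / x ^ 2 + w * (y / x))"
    if "x > 0" for x y z w :: real
  proof -
    have "y ^ 2 / (z / x ^ 2 + w * (y / x)) = (x ^ 2 * y ^ 2) / (x ^ 2 * (z / x ^ 2 + w * (y / x)))"
      using that by simp
    also have "x ^ 2 * (z / x ^ 2 + w * (y / x)) = z + w * (x * y)"
      using that by (simp add: field_simps power2_eq_square)
    finally show ?thesis by simp
  qed
  have k: "?k s = ?l s * a" for s by (simp add: a_def)
  have up_eq: "- (?k s)\<^sup>2 / (?m s + ?k s) = - (a\<^sup>2 / (?m s / (?l s)\<^sup>2 + a / ?l s))" for s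
    using quot[OF polya_len_pos[of s], of a "?m s" 1] unfolding k power_mult_distrib by simp
  have lo_eq: "- (?k s)\<^sup>2 / (?m s - ?k s) = - (a\<^sup>2 / (?m s / (?l s)\<^sup>2 - a / ?l s))" for s
    using quot[OF polya_len_pos[of s], of a "?m s" "-1"] unfolding k power_mult_distrib by simp
  have "(\<lambda>s. ?m s / (?l s)\<^sup>2 - a / ?l s) \<longlonglongrightarrow> T - 0"
    by (intro tendsto_intros polya_exp_ratio T inv)
  hence "\<forall>\<^sub>F s in sequentially. ?m s / (?l s)\<^sup>2 - a / ?l s > 0"
    by (rule order_tendstoD) (use T in auto)
  hence ev: "\<forall>\<^sub>F s in sequentially. polya_len s * nat \<bar>j\<bar> < polya_exp T s"
  proof eventually_elim
    case (elim s)
    have "?m s / (?l s)\<^sup>2 - a / ?l s = (?m s - ?l s * a) / (?l s)\<^sup>2"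
      using polya_len_pos[of s] by (simp add: field_simps power2_eq_square)
    hence "?l s * a < ?m s" using elim polya_len_pos[of s] by (simp add: zero_less_divide_iff)
    hence "?k s < ?m s" by (simp only: k)
    thus ?case by (simp only: of_nat_less_iff)
  qed
  have val: "polya_coeff T s j = real ((2 * polya_exp T s) choose (polya_exp T s + polya_len s * nat \<bar>j\<bar>)) /
          real ((2 * polya_exp T s) choose polya_exp T s)"
    if "polya_len s * nat \<bar>j\<bar> < polya_exp T s" for s
  proof -
    have "int (polya_len s * nat \<bar>j\<bar>) \<le> int (polya_exp T s)" using that by linarith
    thus ?thesis by (simp add: polya_coeff_def)
  qed
  have "(\<lambda>s. polya_coeff T s j) \<longlonglongrightarrow> exp (- (a\<^sup>2 / T))"
  proof (rule real_tendsto_sandwich)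
    show "\<forall>\<^sub>F s in sequentially. exp (- (a\<^sup>2 / (?m s / (?l s)\<^sup>2 - a / ?l s))) \<le> polya_coeff T s j"
      using ev by eventually_elim (simp only: val lo_eq[symmetric], rule binomial_ratio_ge, auto)
    show "\<forall>\<^sub>F s in sequentially. polya_coeff T s j \<le> exp (- (a\<^sup>2 / (?m s / (?l s)\<^sup>2 + a / ?l s)))"
      using ev by eventually_elim (simp only: val up_eq[symmetric], rule binomial_ratio_le, auto)
  qed (use up lo in simp_all)
  thus ?thesis by (simp add: a2)
qed

text \<open>Square root of the Wallis limit 2 / pi divided by the limit 2 T of (2 m + 1) /
  l^2.\<close>

lemma polya_const_tendsto:
  assumes T: "T > 0"
  shows "(\<lambda>s. real (polya_len s) * (real ((2 * polya_exp T s) choose polya_exp T s) / 4 ^ polya_exp T s))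
         \<longlonglongrightarrow> 1 / sqrt (pi * T)"
proof -
  let ?l = "\<lambda>s. real (polya_len s)" and ?m = "\<lambda>s. real (polya_exp T s)"
  define c where "c = (\<lambda>m. real ((2 * m) choose m) / 4 ^ m)"
  have inv: "(\<lambda>s. 1 / (?l s)\<^sup>2) \<longlonglongrightarrow> 0" unfolding polya_len_def by real_asymp
  have 1: "(\<lambda>s. (c (polya_exp T s))\<^sup>2 * (2 * ?m s + 1)) \<longlonglongrightarrow> 2 / pi"
    unfolding c_def by (rule filterlim_compose[OF central_binomial_wallis polya_exp_at_top[OF T]])
  have 2: "(\<lambda>s. 2 * (?m s / (?l s)\<^sup>2) + 1 / (?l s)\<^sup>2) \<longlonglongrightarrow> 2 * T + 0"
    by (intro tendsto_intros polya_exp_ratio T inv)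
  have "(\<lambda>s. sqrt (((c (polya_exp T s))\<^sup>2 * (2 * ?m s + 1)) / (2 * (?m s / (?l s)\<^sup>2) + 1 / (?l s)\<^sup>2)))
     \<longlonglongrightarrow> sqrt ((2 / pi) / (2 * T + 0))"
    by (rule tendsto_real_sqrt[OF tendsto_divide[OF 1 2]]) (use T in auto)
  moreover have "sqrt (((c (polya_exp T s))\<^sup>2 * (2 * ?m s + 1)) / (2 * (?m s / (?l s)\<^sup>2) + 1 / (?l s)\<^sup>2)) = ?l s * c (polya_exp T s)" for s
  proof -
    have l: "?l s > 0" by (rule polya_len_pos)
    have "2 * (?m s / (?l s)\<^sup>2) + 1 / (?l s)\<^sup>2 = (2 * ?m s + 1) / (?l s)\<^sup>2"
      by (simp add: add_divide_distrib)
    moreover have "2 * ?m s + 1 \<noteq> 0" by linarith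
    ultimately have "((c (polya_exp T s))\<^sup>2 * (2 * ?m s + 1)) / (2 * (?m s / (?l s)\<^sup>2) + 1 / (?l s)\<^sup>2) = (?l s * c (polya_exp T s))\<^sup>2"
      using l by (simp add: power_mult_distrib)
    moreover have "?l s * c (polya_exp T s) \<ge> 0" by (simp add: c_def)
    ultimately show ?thesis by simp
  qed
  ultimately show ?thesis using T by (simp add: c_def real_sqrt_divide)
qed

text \<open>Both sides of \<open>polya_identity\<close>, divided by 4^m, converge by Tannery's
  theorem. The bound on \<open>x\<close> keeps all cosine arguments in [-pi/2, pi/2], where
  \<open>sin_pi_ge\<close> supplies the majorant.\<close>

lemma theta_inversion_real:
  fixes T x :: real
  assumes T: "T > 0" and x: "\<bar>x\<bar> \<le> 1 / 2"
  shows "(\<Sum>\<^sub>\<infinity>j::int. complex_of_real (exp (- T * (pi * (of_int j + x))\<^sup>2))) =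
         of_real (1 / sqrt (pi * T)) * (\<Sum>\<^sub>\<infinity>j::int. of_real (exp (- (1 / T) * (of_int j)\<^sup>2)) * nome (of_int j * of_real x))"
proof -
  let ?l = "\<lambda>s. real (polya_len s)" and ?m = "\<lambda>s. real (polya_exp T s)"
  define f where "f = (\<lambda>s (j::int). complex_of_real
     (if \<bar>j\<bar> \<le> int s then cos (pi * (of_int j + x) / ?l s) ^ (2 * polya_exp T s) else 0))"
  define g where "g = (\<lambda>s (j::int). complex_of_real (polya_coeff T s j) * nome (of_int j * of_real x))"
  define A where "A = (\<lambda>s. ?l s * (real ((2 * polya_exp T s) choose polya_exp T s) / 4 ^ polya_exp T s))"
  have fg: "(\<Sum>\<^sub>\<infinity>j. f s j) = of_real (A s) * (\<Sum>\<^sub>\<infinity>j. g s j)" for s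
  proof -
    define l m where "l = polya_len s" and "m = polya_exp T s"
    have l: "l = 2 * s + 1" by (simp add: l_def polya_len_def)
    have C: "real ((2 * m) choose m) \<noteq> 0" by simp
    let ?J = "{j. int l * \<bar>j\<bar> \<le> int m}"
    have "(\<Sum>\<^sub>\<infinity>j. f s j) = (\<Sum>\<^sub>\<infinity>j\<in>{-int s..int s}. f s j)"
      by (rule infsum_cong_neutral) (auto simp: f_def)
    also have "\<dots> = (\<Sum>j=-int s..int s. complex_of_real ((2 * cos (pi * ((of_int j + x) / of_nat l))) ^ (2 * m)) / 4 ^ m)"
      unfolding infsum_finite[OF finite_atLeastAtMost_int]
      by (rule sum.cong) (auto simp: f_def l_def m_def power_mult_distrib power_mult)
    also have "\<dots> = of_nat l * (\<Sum>j\<in>?J. of_nat ((2 * m) choose nat (int m + int l * j)) * nome (of_int j * of_real x)) / 4 ^ m"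
      unfolding sum_divide_distrib[symmetric] l polya_identity by simp
    also have "(\<Sum>j\<in>?J. of_nat ((2 * m) choose nat (int m + int l * j)) * nome (of_int j * of_real x))
      = (\<Sum>j\<in>?J. of_real (real ((2 * m) choose m)) * g s j)"
    proof (rule sum.cong[OF refl])
      fix j assume j: "j \<in> ?J"
      have "nat \<bar>int l * j\<bar> = l * nat \<bar>j\<bar>" by (simp add: abs_mult nat_mult_distrib)
      hence "(2 * m) choose nat (int m + int l * j) = (2 * m) choose (m + l * nat \<bar>j\<bar>)"
        using central_binomial_reflect[of "int l * j" m] j by (simp add: abs_mult)
      moreover have "real ((2 * m) choose m) * polya_coeff T s j = real ((2 * m) choose (m + l * nat \<bar>j\<bar>))"
        using j by (simp add: polya_coeff_def l_def m_def)
      ultimately have "complex_of_real (real ((2 * m) choose m)) * of_real (polya_coeff T s j) =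
          of_nat ((2 * m) choose nat (int m + int l * j))"
        by (metis of_real_mult of_real_of_nat_eq)
      thus "of_nat ((2 * m) choose nat (int m + int l * j)) * nome (of_int j * of_real x)
         = of_real (real ((2 * m) choose m)) * g s j"
        by (simp add: g_def flip: mult.assoc)
    qed
    also have "\<dots> = of_real (real ((2 * m) choose m)) * (\<Sum>\<^sub>\<infinity>j\<in>?J. g s j)"
    proof -
      have "?J \<subseteq> {- int m..int m}"
      proof safe
        fix j assume "int l * \<bar>j\<bar> \<le> int m"
        moreover have "1 * \<bar>j\<bar> \<le> int l * \<bar>j\<bar>" unfolding l by (intro mult_right_mono) auto
        ultimately show "j \<in> {- int m..int m}" by auto
      qed
      hence "finite ?J" by (rule finite_subset) auto
      thus ?thesis by (simp add: sum_distrib_left)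
    qed
    also have "(\<Sum>\<^sub>\<infinity>j\<in>?J. g s j) = (\<Sum>\<^sub>\<infinity>j. g s j)"
      by (rule infsum_cong_neutral) (auto simp: g_def polya_coeff_def l_def m_def)
    finally show ?thesis by (simp add: A_def l_def m_def)
  qed
  have "(\<lambda>s. \<Sum>\<^sub>\<infinity>j. f s j) \<longlonglongrightarrow> (\<Sum>\<^sub>\<infinity>j::int. complex_of_real (exp (- T * (pi * (of_int j + x))\<^sup>2)))"
  proof (rule tendsto_infsum_int)
    fix j :: int
    have "\<forall>\<^sub>F s in sequentially. complex_of_real (cos (pi * (of_int j + x) / ?l s) ^ (2 * polya_exp T s)) = f s j"
      using eventually_ge_at_top[of "nat \<bar>j\<bar>"] by eventually_elim (auto simp: f_def)
    moreover have "(\<lambda>s. complex_of_real (cos (pi * (of_int j + x) / ?l s) ^ (2 * polya_exp T s)))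
        \<longlonglongrightarrow> complex_of_real (exp (- T * (pi * (of_int j + x))\<^sup>2))"
      by (intro tendsto_of_real cos_power_tendsto T)
    ultimately show "(\<lambda>s. f s j) \<longlonglongrightarrow> complex_of_real (exp (- T * (pi * (of_int j + x))\<^sup>2))"
      by (rule Lim_transform_eventually[rotated])
  next
    have "\<forall>\<^sub>F s in sequentially. ?m s / (?l s)\<^sup>2 > T / 2"
      by (rule order_tendstoD[OF polya_exp_ratio[OF T]]) (use T in auto)
    thus "\<forall>\<^sub>F s in sequentially. \<forall>j. norm (f s j) \<le> exp (- (2 * T) * (of_int j + x)\<^sup>2)"
    proof (eventually_elim, intro allI)
      case (elim s)
      fix j :: int
      show "norm (f s j) \<le> exp (- (2 * T) * (of_int j + x)\<^sup>2)"
      proof (cases "\<bar>j\<bar> \<le> int s")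
        case True
        define u where "u = (of_int j + x) / ?l s"
        have l: "?l s > 0" by (rule polya_len_pos)
        have "\<bar>of_int j + x\<bar> \<le> real s + 1 / 2" using True x by linarith
        hence u: "\<bar>u\<bar> \<le> 1 / 2" using l by (simp add: u_def polya_len_def field_simps)
        have "norm (f s j) = cos (pi * u) ^ (2 * polya_exp T s)"
          using True by (simp add: f_def u_def norm_power power_mult)
        also have "\<dots> \<le> exp (- ?m s * (sin (pi * u))\<^sup>2)" by (rule cos_sq_power_le)
        also have "\<dots> \<le> exp (- (2 * T) * (of_int j + x)\<^sup>2)"
        proof -
          have "2 * T * (of_int j + x)\<^sup>2 = T / 2 * (4 * (of_int j + x)\<^sup>2)" by simp
          also have "\<dots> \<le> ?m s / (?l s)\<^sup>2 * (4 * (of_int j + x)\<^sup>2)"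
            using elim by (intro mult_right_mono) auto
          also have "\<dots> = ?m s * (4 * u\<^sup>2)" by (simp add: u_def power_divide)
          also have "\<dots> \<le> ?m s * (sin (pi * u))\<^sup>2"
            by (intro mult_left_mono sin_pi_ge u) auto
          finally show ?thesis by simp
        qed
        finally show ?thesis .
      qed (auto simp: f_def)
    qed
    show "(\<lambda>j::int. exp (- (2 * T) * (of_int j + x)\<^sup>2)) summable_on UNIV"
      by (rule summable_on_gauss) (use T in auto)
  qed
  moreover have "(\<lambda>s. \<Sum>\<^sub>\<infinity>j. g s j) \<longlonglongrightarrow> (\<Sum>\<^sub>\<infinity>j::int. of_real (exp (- (1 / T) * (of_int j)\<^sup>2)) * nome (of_int j * of_real x))"
  proof (rule tendsto_infsum_int)
    show "(\<lambda>s. g s j) \<longlonglongrightarrow> of_real (exp (- (1 / T) * (of_int j)\<^sup>2)) * nome (of_int j * of_real x)" for j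
      unfolding g_def by (intro tendsto_intros polya_coeff_tendsto T)
    show "\<forall>\<^sub>F s in sequentially. \<forall>j. norm (g s j) \<le> exp (- (1 / (2 * T)) * (of_int j + 0)\<^sup>2)"
      using polya_coeff_le[OF T] by (simp add: g_def norm_mult norm_nome)
    show "(\<lambda>j::int. exp (- (1 / (2 * T)) * (of_int j + 0)\<^sup>2)) summable_on UNIV"
      by (rule summable_on_gauss) (use T in auto)
  qed
  hence "(\<lambda>s. of_real (A s) * (\<Sum>\<^sub>\<infinity>j. g s j)) \<longlonglongrightarrow> of_real (1 / sqrt (pi * T)) *
     (\<Sum>\<^sub>\<infinity>j::int. of_real (exp (- (1 / T) * (of_int j)\<^sup>2)) * nome (of_int j * of_real x))"
    unfolding A_def by (intro tendsto_mult tendsto_of_real polya_const_tendsto T)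
  ultimately show ?thesis unfolding fg by (rule LIMSEQ_unique)
qed

section \<open>Theta functions with real characteristics on the upper half plane\<close>

definition jtheta :: "real \<Rightarrow> real \<Rightarrow> complex \<Rightarrow> complex" where
  "jtheta x y w = (\<Sum>\<^sub>\<infinity>n::int. nome ((of_int n + of_real x)\<^sup>2 * w + of_int n * of_real y))"

lemma norm_jtheta_term:
  "norm (nome ((of_int n + of_real x)\<^sup>2 * w + of_int n * of_real y)) = exp (- (2 * pi * Im w) * (of_int n + x)\<^sup>2)"
proof -
  have "(of_int n + of_real x)\<^sup>2 = complex_of_real ((of_int n + x)\<^sup>2)" by simp
  hence "Im ((of_int n + of_real x)\<^sup>2 * w + of_int n * of_real y) = (of_int n + x)\<^sup>2 * Im w"
    by (simp only: plus_complex.sel Im_complex_of_real times_complex.sel Re_complex_of_real) simp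
  thus ?thesis by (simp add: norm_nome mult_ac)
qed

lemma jtheta_abs_summable:
  "Im w > 0 \<Longrightarrow> (\<lambda>n::int. norm (nome ((of_int n + of_real x)\<^sup>2 * w + of_int n * of_real y))) summable_on UNIV"
  unfolding norm_jtheta_term by (rule summable_on_gauss) simp

lemma jtheta_summable:
  "Im w > 0 \<Longrightarrow> (\<lambda>n::int. nome ((of_int n + of_real x)\<^sup>2 * w + of_int n * of_real y)) summable_on UNIV"
  by (rule abs_summable_summable[OF jtheta_abs_summable])

lemma jtheta_shift1: "jtheta (x + of_int k) 0 w = jtheta x 0 w"
  unfolding jtheta_def
  by (rule infsum_reindex_bij_witness[of _ "\<lambda>n. n - k" "\<lambda>n. n + k"]) (auto simp: algebra_simps)

lemma jtheta_shift2: "jtheta 0 (y + of_int k) w = jtheta 0 y w"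
  unfolding jtheta_def
proof (rule infsum_cong)
  fix n :: int
  have "(of_int n + of_real 0)\<^sup>2 * w + of_int n * of_real (y + of_int k) =
      ((of_int n + of_real 0)\<^sup>2 * w + of_int n * of_real y) + of_int (n * k)"
    by (simp add: algebra_simps)
  thus "nome ((of_int n + of_real 0)\<^sup>2 * w + of_int n * of_real (y + of_int k)) =
      nome ((of_int n + of_real 0)\<^sup>2 * w + of_int n * of_real y)"
    by (simp only: nome_add nome_of_int) simp
qed

abbreviation uhp :: "complex set" where "uhp \<equiv> {w. Im w > 0}"

lemma uhp_open: "open uhp"
  by (rule open_halfspace_Im_gt)

lemma uhp_connected: "connected uhp"
  by (intro convex_connected convex_halfspace_Im_gt)

lemma uhp_inverse:
  assumes "Im v > 0"
  shows "Im (- 1 / v) > 0"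
proof -
  have "(Re v)\<^sup>2 + (Im v)\<^sup>2 > 0" using assms by (simp add: sum_power2_gt_zero_iff)
  moreover have "Im (- 1 / v) = Im v / ((Re v)\<^sup>2 + (Im v)\<^sup>2)" by (simp add: Im_divide)
  ultimately show ?thesis using assms by simp
qed

lemma nome_holomorphic [holomorphic_intros]: "f holomorphic_on A \<Longrightarrow> (\<lambda>x. nome (f x)) holomorphic_on A"
  unfolding nome_def by (intro holomorphic_intros)

text \<open>On a closed disc the imaginary part is at least \<open>d\<close>, which gives one
  Gaussian majorant for all its points. The symmetric intervals turn the limit over finite sets into
  the limit of a sequence.\<close>

lemma jtheta_holomorphic: "jtheta x y holomorphic_on uhp"
proof (rule holomorphic_uniform_sequence[OF uhp_open])
  let ?f = "\<lambda>(n::int) w. nome ((of_int n + of_real x)\<^sup>2 * w + of_int n * of_real y)"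
  show "(\<lambda>w. \<Sum>n\<in>{- int K..int K}. ?f n w) holomorphic_on uhp" for K
    by (intro holomorphic_intros)
  fix w assume "w \<in> uhp"
  hence w: "Im w > 0" by simp
  define d where "d = Im w / 2"
  have d: "d > 0" using w by (simp add: d_def)
  have im: "Im v \<ge> d" if "v \<in> cball w d" for v
    using that abs_Im_le_cmod[of "w - v"] by (auto simp: dist_norm d_def)
  have "uniform_limit (cball w d) (\<lambda>X v. \<Sum>n\<in>X. ?f n v) (\<lambda>v. \<Sum>\<^sub>\<infinity>n. ?f n v) (finite_subsets_at_top UNIV)"
  proof (rule Weierstrass_m_test_general)
    fix n :: int and v assume v: "v \<in> cball w d"
    have "2 * pi * d * (of_int n + x)\<^sup>2 \<le> 2 * pi * Im v * (of_int n + x)\<^sup>2"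
      using im[OF v] by (intro mult_right_mono mult_left_mono) auto
    thus "norm (?f n v) \<le> exp (- (2 * pi * d) * (of_int n + x)\<^sup>2)"
      unfolding norm_jtheta_term by simp
  next
    show "(\<lambda>n::int. exp (- (2 * pi * d) * (of_int n + x)\<^sup>2)) summable_on UNIV"
      using d by (intro summable_on_gauss) simp
  qed
  moreover have "filterlim (\<lambda>K. {- int K..int K}) (finite_subsets_at_top UNIV) sequentially"
  proof (rule filterlim_finite_subsets_at_top[THEN iffD2], intro allI impI)
    fix X :: "int set" assume X: "finite X \<and> X \<subseteq> UNIV"
    define M where "M = Max (insert 0 (abs ` X))"
    have "\<bar>x\<bar> \<le> M" if "x \<in> X" for x unfolding M_def using X that by (intro Max_ge) auto
    hence X': "X \<subseteq> {- M..M}" by force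
    show "\<forall>\<^sub>F K in sequentially. finite {- int K..int K} \<and> X \<subseteq> {- int K..int K} \<and> {- int K..int K} \<subseteq> UNIV"
      by (rule eventually_mono[OF eventually_ge_at_top[of "nat M"]]) (use X' in force)
  qed
  ultimately have "uniform_limit (cball w d) (\<lambda>K v. \<Sum>n\<in>{- int K..int K}. ?f n v) (jtheta x y) sequentially"
    unfolding jtheta_def[abs_def] by (rule filterlim_compose)
  moreover have "cball w d \<subseteq> uhp" using im d by force
  ultimately show "\<exists>d>0. cball w d \<subseteq> uhp \<and>
      uniform_limit (cball w d) (\<lambda>K v. \<Sum>n\<in>{- int K..int K}. ?f n v) (jtheta x y) sequentially"
    using d by blast
qed

lemma jtheta_inversion_imag:
  fixes t :: real
  assumes t: "t > 0"
  shows "jtheta x 0 (- 1 / (4 * (\<i> * of_real t))) = csqrt (- 2 * \<i> * (\<i> * of_real t)) * jtheta 0 x (\<i> * of_real t)"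
proof -
  \<comment> \<open>Both sides have period 1 in \<open>x\<close>, so the nearest integer may be
    removed to meet the bound in \<open>theta_inversion_real\<close>.\<close>
  define k where "k = round x"
  define x' where "x' = x - of_int k"
  have x': "\<bar>x'\<bar> \<le> 1 / 2" unfolding x'_def k_def using of_int_round_abs_le[of x] by (simp add: abs_minus_commute)
  have x: "x = x' + of_int k" by (simp add: x'_def)
  \<comment> \<open>Chosen so that T pi^2 = pi / (2 t) and 1 / T = 2 pi t, the decay rates of the
    theta series at -1 / (4 i t) and at i t.\<close>
  define T where "T = 1 / (2 * pi * t)"
  have T: "T > 0" using t by (simp add: T_def)
  have 1: "jtheta x' 0 (- 1 / (4 * (\<i> * of_real t))) = (\<Sum>\<^sub>\<infinity>j::int. complex_of_real (exp (- T * (pi * (of_int j + x'))\<^sup>2)))"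
    unfolding jtheta_def
  proof (rule infsum_cong)
    fix j :: int
    have "2 * of_real pi * \<i> * ((of_int j + of_real x')\<^sup>2 * (- 1 / (4 * (\<i> * of_real t))) + of_int j * of_real 0) =
        complex_of_real (- T * (pi * (of_int j + x'))\<^sup>2)"
      using t by (simp add: T_def field_simps power2_eq_square)
    thus "nome ((of_int j + of_real x')\<^sup>2 * (- 1 / (4 * (\<i> * of_real t))) + of_int j * of_real 0) =
        complex_of_real (exp (- T * (pi * (of_int j + x'))\<^sup>2))"
      by (simp only: nome_def exp_of_real)
  qed
  have 2: "jtheta 0 x' (\<i> * of_real t) = (\<Sum>\<^sub>\<infinity>j::int. of_real (exp (- (1 / T) * (of_int j)\<^sup>2)) * nome (of_int j * of_real x'))"
    unfolding jtheta_def nome_add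
  proof (rule infsum_cong)
    fix j :: int
    have "2 * of_real pi * \<i> * ((of_int j + of_real 0)\<^sup>2 * (\<i> * of_real t)) = complex_of_real (- (1 / T) * (of_int j)\<^sup>2)"
      using t by (simp add: T_def field_simps power2_eq_square)
    thus "nome ((of_int j + of_real 0)\<^sup>2 * (\<i> * of_real t)) * nome (of_int j * of_real x') =
        of_real (exp (- (1 / T) * (of_int j)\<^sup>2)) * nome (of_int j * of_real x')"
      by (simp only: nome_def exp_of_real)
  qed
  have 3: "csqrt (- 2 * \<i> * (\<i> * of_real t)) = of_real (1 / sqrt (pi * T))"
  proof -
    have "- 2 * \<i> * (\<i> * of_real t) = complex_of_real (2 * t)" by (simp add: field_simps)
    also have "csqrt \<dots> = of_real (sqrt (2 * t))" using t by (subst csqrt_of_real_nonneg) auto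
    also have "sqrt (2 * t) = 1 / sqrt (pi * T)" using t by (simp add: T_def real_sqrt_divide)
    finally show ?thesis .
  qed
  show ?thesis
    unfolding x jtheta_shift1 jtheta_shift2 1 2 3 by (rule theta_inversion_real[OF T x'])
qed

text \<open>Analytic continuation from the imaginary axis. Since the series run in powers of
  \<open>nome\<close>, inversion is w to -1 / (4 w); the number -2 i w has positive real part, so
  the principal square root is holomorphic there.\<close>

theorem jtheta_inversion:
  assumes w: "Im w > 0"
  shows "jtheta x 0 (- 1 / (4 * w)) = csqrt (- 2 * \<i> * w) * jtheta 0 x w"
proof -
  have inv: "Im (- 1 / (4 * v)) > 0" if "Im v > 0" for v
    using that by (intro uhp_inverse) simp
  have "jtheta x 0 (- 1 / (4 * w)) - csqrt (- 2 * \<i> * w) * jtheta 0 x w = 0"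
  proof (rule analytic_continuation[where S = uhp and U = "(\<lambda>t. \<i> * of_real t) ` {0<..}" and \<xi> = \<i>
        and f = "\<lambda>w. jtheta x 0 (- 1 / (4 * w)) - csqrt (- 2 * \<i> * w) * jtheta 0 x w"])
    have 1: "(\<lambda>w. jtheta x 0 (- 1 / (4 * w))) holomorphic_on uhp"
    proof (rule holomorphic_on_compose_gen[OF _ jtheta_holomorphic, unfolded o_def])
      show "(\<lambda>w. - 1 / (4 * w)) holomorphic_on uhp" by (intro holomorphic_intros) auto
      show "(\<lambda>w. - 1 / (4 * w)) ` uhp \<subseteq> uhp" using inv by auto
    qed
    have 2: "(\<lambda>w. csqrt (- 2 * \<i> * w)) holomorphic_on uhp"
      by (intro holomorphic_intros) (auto simp: complex_nonpos_Reals_iff)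
    show "(\<lambda>w. jtheta x 0 (- 1 / (4 * w)) - csqrt (- 2 * \<i> * w) * jtheta 0 x w) holomorphic_on uhp"
      by (intro holomorphic_intros 1 2 jtheta_holomorphic)
    show "\<i> islimpt (\<lambda>t. \<i> * of_real t) ` {0<..}"
    proof (rule islimpt_sequential[THEN iffD2], intro exI conjI allI)
      show "\<i> * of_real (1 + 1 / real (Suc n)) \<in> (\<lambda>t. \<i> * of_real t) ` {0<..} - {\<i>}" for n
      proof -
        have "1 / real (Suc n) > 0" by simp
        hence "\<i> * of_real (1 + 1 / real (Suc n)) \<noteq> \<i>" by (auto simp: complex_eq_iff)
        moreover have "1 + 1 / real (Suc n) \<in> {0<..}" by (simp add: add_pos_pos)
        ultimately show ?thesis by blast
      qed
      have "(\<lambda>n. \<i> * of_real (1 + 1 / real (Suc n))) \<longlonglongrightarrow> \<i> * of_real (1 + 0)"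
        by (intro tendsto_intros LIMSEQ_Suc lim_1_over_n)
      thus "(\<lambda>n. \<i> * of_real (1 + 1 / real (Suc n))) \<longlonglongrightarrow> \<i>" by simp
    qed
    fix z assume "z \<in> (\<lambda>t. \<i> * of_real t) ` {0<..}"
    thus "jtheta x 0 (- 1 / (4 * z)) - csqrt (- 2 * \<i> * z) * jtheta 0 x z = 0"
      using jtheta_inversion_imag by auto
  qed (use w in \<open>auto simp: uhp_open uhp_connected\<close>)
  thus ?thesis by simp
qed

section \<open>Quadratic Gauss sums and theta functions near rational points\<close>

lemma nome_cong:
  assumes "[a = b] (mod int N)" "N > 0"
  shows "nome (of_int a / of_nat N) = nome (of_int b / of_nat N)"
proof -
  obtain k where "a - b = int N * k" using assms(1) unfolding cong_iff_dvd_diff by (elim dvdE)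
  hence "a = b + int N * k" by simp
  hence "of_int a / of_nat N = of_int b / of_nat N + (of_int k :: complex)" using assms(2) by (simp add: field_simps)
  thus ?thesis by (simp only: nome_add nome_of_int) simp
qed

definition gauss_sum :: "int \<Rightarrow> nat \<Rightarrow> complex" where
  "gauss_sum A N = (\<Sum>j=0..<int N. nome (of_int (A * j\<^sup>2) / of_nat N))"

lemma sum_periodic_shift:
  fixes F :: "int \<Rightarrow> complex"
  assumes N: "N > 0" and per: "\<And>i. F (i mod int N) = F i"
  shows "(\<Sum>i=0..<int N. F (i + c)) = (\<Sum>i=0..<int N. F i)"
  by (rule sum.reindex_bij_witness[of _ "\<lambda>i. (i - c) mod int N" "\<lambda>i. (i + c) mod int N"])
     (use N in \<open>auto simp: per mod_simps\<close>)

text \<open>Completing the square: \<open>D\<close> is the inverse of 4 A modulo N, so i moves to i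
  + 2 D l and the constant -D l^2 remains.\<close>

lemma gauss_sum_linear:
  assumes N: "N > 0" and AD: "int N dvd 4 * A * D - 1"
  shows "(\<Sum>i=0..<int N. nome (of_int (A * i\<^sup>2 + l * i) / of_nat N)) =
         nome (- of_int (D * l\<^sup>2) / of_nat N) * gauss_sum A N"
proof -
  define F where "F = (\<lambda>i::int. nome (of_int (A * i\<^sup>2) / of_nat N))"
  have "nome (of_int (A * i\<^sup>2 + l * i) / of_nat N) = nome (- of_int (D * l\<^sup>2) / of_nat N) * F (i + 2 * D * l)" for i
  proof -
    obtain k where k: "4 * A * D - 1 = int N * k" using AD by (elim dvdE)
    have "(- (D * l\<^sup>2) + A * (i + 2 * D * l)\<^sup>2) - (A * i\<^sup>2 + l * i) = (4 * A * D - 1) * (i * l + D * l\<^sup>2)"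
      by (simp add: power2_eq_square algebra_simps)
    hence "[- (D * l\<^sup>2) + A * (i + 2 * D * l)\<^sup>2 = A * i\<^sup>2 + l * i] (mod int N)"
      unfolding cong_iff_dvd_diff k by simp
    from nome_cong[OF this N] show ?thesis
      by (simp add: F_def add_divide_distrib diff_divide_distrib flip: nome_add)
  qed
  moreover have "F (i mod int N) = F i" for i
    unfolding F_def by (rule nome_cong[OF _ N]) (unfold cong_def, metis mod_mult_right_eq power_mod)
  ultimately show ?thesis
    using sum_periodic_shift[OF N, of F "2 * D * l"]
    by (simp add: gauss_sum_def F_def flip: sum_distrib_left)
qed

lemma infsum_int_residues:
  fixes f :: "int \<Rightarrow> complex"
  assumes N: "N > 0" and f: "f summable_on UNIV"
  shows "(\<Sum>\<^sub>\<infinity>n. f n) = (\<Sum>i=0..<int N. \<Sum>\<^sub>\<infinity>k. f (int N * k + i))"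
proof -
  define h where "h = (\<lambda>(i, k). int N * k + i)"
  have bij: "bij_betw h ({0..<int N} \<times> UNIV) UNIV"
    by (rule bij_betw_byWitness[where f' = "\<lambda>n. (n mod int N, n div int N)"]) (use N in \<open>auto simp: h_def\<close>)
  have "(\<lambda>x. f (h x)) summable_on ({0..<int N} \<times> UNIV)"
    using f by (subst summable_on_reindex_bij_betw[OF bij])
  hence "(\<Sum>\<^sub>\<infinity>i\<in>{0..<int N}. \<Sum>\<^sub>\<infinity>k. f (h (i, k))) = (\<Sum>\<^sub>\<infinity>x\<in>{0..<int N} \<times> UNIV. f (h x))"
    by (rule infsum_Sigma_banach)
  also have "\<dots> = (\<Sum>\<^sub>\<infinity>n. f n)" by (rule infsum_reindex_bij_betw[OF bij])
  finally show ?thesis by (simp add: h_def)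
qed

lemma has_sum_finite_sum:
  fixes f :: "'i \<Rightarrow> 'b \<Rightarrow> 'c :: topological_comm_monoid_add"
  assumes "finite I" "\<And>i. i \<in> I \<Longrightarrow> (f i has_sum S i) A"
  shows "((\<lambda>x. \<Sum>i\<in>I. f i x) has_sum (\<Sum>i\<in>I. S i)) A"
  using assms by (induction I rule: finite_induct) (auto intro!: has_sum_add has_sum_0)

text \<open>Behaviour near the rational point A/N. On a residue class of n modulo N the part A/N
  contributes a fixed root of unity, so inversion applies to each class. The sum over the classes is
  then a Gauss sum with linear term l, whose phase -D l^2 / N moves the argument by -D / N.\<close>

theorem jtheta_cusp:
  fixes A D :: int and N b :: nat
  assumes N: "odd N" and AD: "int N dvd 4 * A * D - 1" and V: "Im V > 0"
  shows "jtheta (b / 2) 0 (of_int A / of_nat N - 1 / (4 * of_nat N * V)) =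
    nome (of_nat (b\<^sup>2) * of_int A * of_nat N / 4) * csqrt (- 2 * \<i> * (V / of_nat N)) * gauss_sum A N *
    jtheta 0 (b / 2) ((V - of_int D) / of_nat N)"
proof -
  obtain h where h: "N = 2 * h + 1" using N by (elim oddE)
  have N0: "N > 0" by (simp add: h)
  have Nc: "(of_nat N :: complex) \<noteq> 0" using N0 by simp
  define z where "z = - 1 / (4 * of_nat N * V)"
  define t where "t = of_int A / of_nat N + z"
  define w where "w = V / of_nat N"
  have w: "Im w > 0" using V N0 by (simp add: w_def Im_divide_of_nat)
  have V0: "V \<noteq> 0" using V by auto
  have z: "(of_nat N)\<^sup>2 * z = - 1 / (4 * w)" using Nc V0 by (simp add: z_def w_def field_simps power2_eq_square)
  have "Im z > 0" unfolding z_def using V N0 by (intro uhp_inverse) simp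
  hence t: "Im t > 0" using N0 by (simp add: t_def Im_divide_of_nat)
  define c where "c = nome (of_nat (b\<^sup>2) * of_int A * of_nat N / 4)"
  let ?T = "\<lambda>x w n. nome ((of_int n + of_real x)\<^sup>2 * w + of_int n * of_real 0)"
  \<comment> \<open>As N is odd, b / 2 may be replaced by b N / 2; then N k + i + b N / 2 is N times
    k + b / 2 + i / N.\<close>
  have "jtheta (b / 2) 0 t = jtheta (b / 2 + of_int (int (b * h))) 0 t" by (rule jtheta_shift1[symmetric])
  also have "b / 2 + of_int (int (b * h)) = b * N / 2" by (simp add: h field_simps)
  also have "jtheta (b * N / 2) 0 t = (\<Sum>i=0..<int N. \<Sum>\<^sub>\<infinity>k. ?T (b * N / 2) t (int N * k + i))"
    unfolding jtheta_def by (rule infsum_int_residues[OF N0 jtheta_summable[OF t]])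
  also have "\<dots> = (\<Sum>i=0..<int N. \<Sum>\<^sub>\<infinity>k. c * nome (of_int (A * i\<^sup>2) / of_nat N) * ?T (b / 2 + of_int i / N) ((of_nat N)\<^sup>2 * z) k)"
  proof (intro sum.cong infsum_cong refl)
    fix i k :: int
    have "(of_int (int N * k + i) + of_real (b * N / 2))\<^sup>2 * t =
       (of_int (A * (int N * k\<^sup>2 + 2 * k * i + int N * k * int b + int b * i)) + of_nat (b\<^sup>2) * of_int A * of_nat N / 4 + of_int (A * i\<^sup>2) / of_nat N) +
       (of_int k + of_real (b / 2 + of_int i / N))\<^sup>2 * ((of_nat N)\<^sup>2 * z)"
      using Nc by (simp add: t_def ring_distribs) (simp add: field_simps power2_eq_square)
    thus "?T (b * N / 2) t (int N * k + i) = c * nome (of_int (A * i\<^sup>2) / of_nat N) * ?T (b / 2 + of_int i / N) ((of_nat N)\<^sup>2 * z) k"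
      by (simp only: nome_add nome_of_int c_def) simp
  qed
  also have "\<dots> = (\<Sum>i=0..<int N. c * nome (of_int (A * i\<^sup>2) / of_nat N) * jtheta (b / 2 + of_int i / N) 0 ((of_nat N)\<^sup>2 * z))"
    by (simp only: jtheta_def infsum_cmult_right')
  also have "\<dots> = c * csqrt (- 2 * \<i> * w) * (\<Sum>i=0..<int N. nome (of_int (A * i\<^sup>2) / of_nat N) * jtheta 0 (b / 2 + of_int i / N) w)"
    unfolding z jtheta_inversion[OF w] by (simp add: sum_distrib_left mult_ac)
  also have "(\<Sum>i=0..<int N. nome (of_int (A * i\<^sup>2) / of_nat N) * jtheta 0 (b / 2 + of_int i / N) w) =
     (\<Sum>\<^sub>\<infinity>l. \<Sum>i=0..<int N. nome (of_int (A * i\<^sup>2) / of_nat N) * nome ((of_int l + of_real 0)\<^sup>2 * w + of_int l * of_real (b / 2 + of_int i / N)))"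
    (is "_ = (\<Sum>\<^sub>\<infinity>l. ?S l)")
  proof -
    have "((\<lambda>l. ?S l) has_sum (\<Sum>i=0..<int N. nome (of_int (A * i\<^sup>2) / of_nat N) * jtheta 0 (b / 2 + of_int i / N) w)) UNIV"
      unfolding jtheta_def
      by (intro has_sum_finite_sum has_sum_cmult_right has_sum_infsum jtheta_summable w) auto
    thus ?thesis by (rule infsumI[symmetric])
  qed
  also have "\<dots> = (\<Sum>\<^sub>\<infinity>l. gauss_sum A N * nome ((of_int l + of_real 0)\<^sup>2 * ((V - of_int D) / of_nat N) + of_int l * of_real (b / 2)))"
  proof (rule infsum_cong)
    fix l :: int
    have "?S l = (\<Sum>i=0..<int N. nome ((of_int l + of_real 0)\<^sup>2 * w + of_int l * of_real (b / 2)) * nome (of_int (A * i\<^sup>2 + l * i) / of_nat N))"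
      unfolding nome_add[symmetric] by (intro sum.cong refl arg_cong[of _ _ nome]) (simp add: field_simps)
    also have "\<dots> = nome ((of_int l + of_real 0)\<^sup>2 * w + of_int l * of_real (b / 2)) * nome (- of_int (D * l\<^sup>2) / of_nat N) * gauss_sum A N"
      by (simp only: sum_distrib_left[symmetric] gauss_sum_linear[OF N0 AD] mult.assoc)
    also have "nome ((of_int l + of_real 0)\<^sup>2 * w + of_int l * of_real (b / 2)) * nome (- of_int (D * l\<^sup>2) / of_nat N)
       = nome ((of_int l + of_real 0)\<^sup>2 * ((V - of_int D) / of_nat N) + of_int l * of_real (b / 2))"
      unfolding nome_add[symmetric] by (intro arg_cong[of _ _ nome]) (use Nc in \<open>simp add: w_def field_simps\<close>)
    finally show "?S l = gauss_sum A N * nome ((of_int l + of_real 0)\<^sup>2 * ((V - of_int D) / of_nat N) + of_int l * of_real (b / 2))"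
      by (simp only: mult.commute)
  qed
  also have "\<dots> = gauss_sum A N * jtheta 0 (b / 2) ((V - of_int D) / of_nat N)"
    by (simp only: jtheta_def infsum_cmult_right')
  finally show ?thesis by (simp add: t_def z_def c_def w_def mult_ac)
qed

text \<open>For j = u + 5^(k+1) v the sum over v vanishes unless 5 divides u, and the terms with u =
  5 w form the sum for 5^k.\<close>

lemma gauss_sum_5_step:
  assumes A: "[A = 1] (mod 5)"
  shows "gauss_sum A (5 ^ (k + 2)) = 5 * gauss_sum A (5 ^ k)"
proof -
  define M where "M = (5 ^ (k + 1) :: nat)"
  have M0: "int M > 0" by (simp add: M_def)
  have N: "5 ^ (k + 2) = 5 * M" by (simp add: M_def)
  have Mk: "M = 5 * 5 ^ k" by (simp add: M_def)
  have cop: "5 dvd 2 * A * u \<longleftrightarrow> 5 dvd u" for u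
  proof -
    obtain l where "A - 1 = 5 * l" using A unfolding cong_iff_dvd_diff by (elim dvdE)
    hence "2 * A * u = 2 * u + 5 * (2 * l * u)" by (simp add: algebra_simps flip: distrib_right)
    thus ?thesis by presburger
  qed
  have "gauss_sum A (5 * M) = (\<Sum>(u, v)\<in>{0..<int M} \<times> {0..<5}. nome (of_int (A * u\<^sup>2) / of_nat (5 * M)) * nome (of_int (2 * A * u * v) / of_nat 5))"
    unfolding gauss_sum_def
  proof (rule sum.reindex_bij_witness[of _ "\<lambda>(u, v). u + int M * v" "\<lambda>j. (j mod int M, j div int M)"])
    fix j assume j: "j \<in> {0..<int (5 * M)}"
    have "int M * (j div int M) \<le> j" using M0 by (simp add: mult_div_mod_eq[symmetric] minus_mod_eq_mult_div[symmetric])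
    also have "j < int M * 5" using j by simp
    finally have "j div int M < 5" using M0 by simp
    thus "(j mod int M, j div int M) \<in> {0..<int M} \<times> {0..<5}" using j M0 by (auto simp: pos_imp_zdiv_nonneg_iff)
    define u v where "u = j mod int M" and "v = j div int M"
    have j_eq: "j = u + int M * v" by (simp add: u_def v_def)
    \<comment> \<open>The term in v^2 is integral and disappears under \<open>nome\<close>.\<close>
    have "of_int (A * j\<^sup>2) / of_nat (5 * M) =
       (of_int (A * u\<^sup>2) / of_nat (5 * M) + of_int (2 * A * u * v) / of_nat 5) + (of_int (A * 5 ^ k * v\<^sup>2) :: complex)"
      using M0 by (simp add: j_eq Mk field_simps power2_eq_square)
    thus "(case (j mod int M, j div int M) of (u, v) \<Rightarrow> nome (of_int (A * u\<^sup>2) / of_nat (5 * M)) * nome (of_int (2 * A * u * v) / of_nat 5)) = nome (of_int (A * j\<^sup>2) / of_nat (5 * M))"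
      unfolding prod.case u_def[symmetric] v_def[symmetric] by (simp only: nome_add nome_of_int) simp
  next
    fix p assume "p \<in> {0..<int M} \<times> {0..<5::int}"
    then obtain u v where p: "p = (u, v)" "0 \<le> u" "u < int M" "0 \<le> v" "v < 5" by auto
    have "int M * v \<le> int M * 4" using p M0 by (intro mult_left_mono) auto
    hence "u + int M * v < 5 * int M" using p by linarith
    thus "(case p of (u, v) \<Rightarrow> u + int M * v) \<in> {0..<int (5 * M)}" using p by simp
    show "((case p of (u, v) \<Rightarrow> u + int M * v) mod int M, (case p of (u, v) \<Rightarrow> u + int M * v) div int M) = p"
      using p by simp
  qed auto
  also have "\<dots> = (\<Sum>u=0..<int M. nome (of_int (A * u\<^sup>2) / of_nat (5 * M)) * (\<Sum>v=0..<5. nome (of_int (2 * A * u * v) / of_nat 5)))"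
    by (simp add: sum.cartesian_product[symmetric] sum_distrib_left)
  also have "\<dots> = (\<Sum>u=0..<int M. nome (of_int (A * u\<^sup>2) / of_nat (5 * M)) * (if 5 dvd u then 5 else 0))"
  proof (intro sum.cong refl arg_cong2[of _ _ _ _ "(*)"])
    fix u :: int
    have "(\<Sum>v=0..<5. nome (of_int (2 * A * u * v) / of_nat 5)) = (\<Sum>j<5. nome (of_int (2 * A * u) * of_nat j / of_nat 5))"
      by (rule sum.reindex_bij_witness[of _ int nat]) auto
    also have "\<dots> = (if 5 dvd u then 5 else 0)" using cop by (subst sum_roots_of_unity) auto
    finally show "(\<Sum>v=0..<5. nome (of_int (2 * A * u * v) / of_nat 5)) = (if 5 dvd u then 5 else 0)" .
  qed
  also have "\<dots> = (\<Sum>u\<in>{u\<in>{0..<int M}. 5 dvd u}. nome (of_int (A * u\<^sup>2) / of_nat (5 * M)) * 5)"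
    by (rule sum.mono_neutral_cong_right) auto
  also have "\<dots> = (\<Sum>u=0..<int (5 ^ k). nome (of_int (A * u\<^sup>2) / of_nat (5 ^ k)) * 5)"
    by (rule sum.reindex_bij_witness[of _ "\<lambda>u. 5 * u" "\<lambda>u. u div 5"])
       (auto simp: Mk field_simps power2_eq_square elim!: dvdE)
  finally show ?thesis unfolding N gauss_sum_def by (simp add: sum_distrib_left mult.commute)
qed

text \<open>With z = exp (2 pi i / 5) the sum is 1 + 2 z + 2 z^4, a real number with square 5; it is
  positive because cos (2 pi / 5) is.\<close>

lemma gauss_sum_5:
  assumes A: "[A = 1] (mod 5)"
  shows "gauss_sum A 5 = of_real (sqrt 5)"
proof -
  define z where "z = nome (1 / 5)"
  have z5: "z ^ 5 = 1" unfolding z_def nome_of_nat_mult[symmetric] by simp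
  have zk: "nome (of_int (A * j\<^sup>2) / of_nat 5) = z ^ nat (j\<^sup>2 mod 5)" for j
  proof -
    have "[A * j\<^sup>2 = 1 * j\<^sup>2] (mod 5)" by (rule cong_scalar_right[OF A])
    hence "[A * j\<^sup>2 = j\<^sup>2 mod 5] (mod int 5)" by (simp add: cong_def)
    hence "nome (of_int (A * j\<^sup>2) / of_nat 5) = nome (of_int (j\<^sup>2 mod 5) / of_nat 5)" by (rule nome_cong) simp
    also have "\<dots> = z ^ nat (j\<^sup>2 mod 5)" unfolding z_def nome_of_nat_mult[symmetric] by simp
    finally show ?thesis .
  qed
  have set: "{0..<int 5} = {0, 1, 2, 3, 4}" by auto
  have S: "gauss_sum A 5 = 1 + 2 * z + 2 * z ^ 4"
    unfolding gauss_sum_def zk set by simp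
  have "(\<Sum>j<5. nome (of_int 1 * of_nat j / of_nat 5)) = 0"
    by (subst sum_roots_of_unity) auto
  moreover have "nome (of_int 1 * of_nat j / of_nat 5) = z ^ j" for j
    unfolding z_def nome_of_nat_mult[symmetric] by simp
  ultimately have "(\<Sum>j<5. z ^ j) = 0" by (simp only:)
  hence z0: "1 + z + z ^ 2 + z ^ 3 + z ^ 4 = 0"
    by (simp add: eval_nat_numeral algebra_simps)
  have "(1 + 2 * z + 2 * z ^ 4)\<^sup>2 = 1 + 4 * z + 4 * z ^ 2 + 4 * z ^ 4 + 8 * z ^ 5 + 4 * (z ^ 5 * z ^ 3)"
    by (simp add: eval_nat_numeral algebra_simps)
  also have "\<dots> = 5 + 4 * (1 + z + z ^ 2 + z ^ 3 + z ^ 4)" unfolding z5 by simp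
  finally have sq: "(gauss_sum A 5)\<^sup>2 = 5" using z0 by (simp add: S)
  have z4: "z ^ 4 = cnj z"
  proof -
    have "norm z = 1" by (simp add: z_def norm_nome)
    hence "z * cnj z = 1" by (simp add: complex_norm_square[symmetric])
    moreover have "z * z ^ 4 = 1" using z5 by (simp add: eval_nat_numeral)
    ultimately show ?thesis by (metis mult_left_cancel mult_zero_left zero_neq_one)
  qed
  have real: "gauss_sum A 5 = of_real (1 + 4 * Re z)"
    unfolding S z4 by (simp add: complex_eq_iff)
  have "Re z = cos (2 * pi / 5)" by (simp add: z_def nome_def Re_exp mult_ac)
  moreover have "cos (2 * pi / 5) > 0" by (rule cos_gt_zero) auto
  ultimately have pos: "1 + 4 * Re z > 0" by simp
  have "(1 + 4 * Re z)\<^sup>2 = 5"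
    using sq unfolding real by (metis of_real_eq_iff of_real_numeral of_real_power)
  hence "1 + 4 * Re z = sqrt 5" using pos by (metis less_imp_le real_sqrt_unique)
  thus ?thesis using real by simp
qed

theorem gauss_sum_5_power:
  assumes "[A = 1] (mod 5)"
  shows "gauss_sum A (5 ^ k) = of_real (sqrt (5 ^ k))"
proof (induction k rule: induct_nat_012)
  case 0
  have "{0..<int (5 ^ 0)} = {0}" by auto
  thus ?case by (simp add: gauss_sum_def)
next
  case 1
  thus ?case using gauss_sum_5[OF assms] by simp
next
  case (ge2 k)
  have "gauss_sum A (5 ^ (k + 2)) = 5 * of_real (sqrt (5 ^ k))"
    using gauss_sum_5_step[OF assms] ge2 by simp
  also have "5 = complex_of_real (sqrt (5 ^ 2))" by simp
  finally show ?case by (simp add: real_sqrt_mult)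
qed

section \<open>The eta function\<close>

lemma jtheta_00:
  assumes "Im \<tau> > 0"
  shows "jtheta 0 0 \<tau> = euler (nome \<tau> ^ 2) ^ 5 / (euler (nome \<tau>) ^ 2 * euler (nome \<tau> ^ 4) ^ 2)"
    and "jtheta 0 0 \<tau> = (\<Sum>\<^sub>\<infinity>n::int. nome \<tau> ^ nat (n\<^sup>2))"
proof -
  have "jtheta 0 0 \<tau> = (\<Sum>\<^sub>\<infinity>n::int. nome \<tau> ^ nat (n\<^sup>2))"
    unfolding jtheta_def by (simp flip: nome_of_nat_mult)
  thus "jtheta 0 0 \<tau> = (\<Sum>\<^sub>\<infinity>n::int. nome \<tau> ^ nat (n\<^sup>2))"
    and "jtheta 0 0 \<tau> = euler (nome \<tau> ^ 2) ^ 5 / (euler (nome \<tau>) ^ 2 * euler (nome \<tau> ^ 4) ^ 2)"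
    using theta3_product[of "nome \<tau>"] norm_nome_less_1[OF assms] by auto
qed

text \<open>Only the factors with odd exponent change, from 1 - x to 1 + x, and
  \<open>prod_one_plus_LIMSEQ\<close> evaluates their product.\<close>

lemma euler_uminus:
  assumes q: "norm q < 1"
  shows "euler (- q) = euler (q ^ 2) ^ 3 / (euler q * euler (q ^ 4))"
proof -
  have q2: "norm (q ^ 2) < 1" "norm (q ^ 4) < 1" using q by (simp_all add: norm_power power_less_one_iff)
  have "(\<lambda>N. \<Prod>m<N. 1 - (- q) ^ (2 * m + 1)) \<longlonglongrightarrow> qpoch 1 2 (- q)"
    by (rule qpoch_LIMSEQ) (use q in auto)
  moreover have "(\<lambda>N. \<Prod>m<N. 1 - (- q) ^ (2 * m + 1)) \<longlonglongrightarrow> qpoch 1 2 (q\<^sup>2) / qpoch 1 2 q"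
    using prod_one_plus_LIMSEQ[OF q, of 1 2] by simp
  ultimately have "qpoch 1 2 (- q) = qpoch 1 2 (q\<^sup>2) / qpoch 1 2 q"
    by (rule LIMSEQ_unique)
  moreover have "euler (- q) = qpoch 1 2 (- q) * euler (q\<^sup>2)" using euler_split[of "- q"] q by simp
  moreover have "qpoch 1 2 q = euler q / euler (q\<^sup>2)" "qpoch 1 2 (q\<^sup>2) = euler (q\<^sup>2) / euler (q ^ 4)"
    using euler_split[OF q] euler_split[OF q2(1)] euler_nonzero[OF q2(1)] euler_nonzero[OF q2(2)]
    by (simp_all add: field_simps flip: power_mult)
  ultimately show ?thesis by (simp add: power3_eq_cube)
qed

text \<open>As n and n^2 have the same parity, moving the argument by 1/2 produces the sign
  (-1)^n.\<close>

lemma jtheta_0_half: "jtheta 0 (1 / 2) \<tau> = jtheta 0 0 (\<tau> + 1 / 2)"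
  unfolding jtheta_def
proof (rule infsum_cong)
  fix n :: int
  have "even (n\<^sup>2 - n)" by simp
  then obtain k where k: "n\<^sup>2 - n = 2 * k" by (elim evenE)
  hence "of_int (n\<^sup>2 - n) = (of_int (2 * k) :: complex)" by (simp only:)
  hence "(of_int n + of_real 0)\<^sup>2 * (\<tau> + 1 / 2) + of_int n * of_real 0 =
      ((of_int n + of_real 0)\<^sup>2 * \<tau> + of_int n * of_real (1 / 2)) + of_int k"
    by (simp add: field_simps)
  thus "nome ((of_int n + of_real 0)\<^sup>2 * \<tau> + of_int n * of_real (1 / 2)) =
      nome ((of_int n + of_real 0)\<^sup>2 * (\<tau> + 1 / 2) + of_int n * of_real 0)"
    by (simp only: nome_add nome_of_int mult_1_right)
qed

lemma jtheta_0_half_product: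
  assumes "Im \<tau> > 0"
  shows "jtheta 0 (1 / 2) \<tau> = euler (nome \<tau>) ^ 2 / euler (nome \<tau> ^ 2)"
proof -
  define q where "q = nome \<tau>"
  have q: "norm q < 1" using norm_nome_less_1[OF assms] by (simp add: q_def)
  have q2: "norm (q ^ 2) < 1" "norm (q ^ 4) < 1" using q by (simp_all add: norm_power power_less_one_iff)
  have "nome (\<tau> + 1 / 2) = - q" by (simp add: nome_add q_def)
  hence "jtheta 0 (1 / 2) \<tau> = euler (q ^ 2) ^ 5 / (euler (- q) ^ 2 * euler (q ^ 4) ^ 2)"
    using jtheta_00(1)[of "\<tau> + 1 / 2"] assms by (simp add: jtheta_0_half)
  thus ?thesis
    using euler_nonzero[OF q] euler_nonzero[OF q2(1)] euler_nonzero[OF q2(2)]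
    by (simp add: euler_uminus[OF q] q_def[symmetric] field_simps eval_nat_numeral)
qed

lemma jtheta_half_0_product:
  assumes "Im \<tau> > 0"
  shows "jtheta (1 / 2) 0 \<tau> = nome (\<tau> / 4) * (2 * euler (nome \<tau> ^ 4) ^ 2 / euler (nome \<tau> ^ 2))"
proof -
  have "jtheta (1 / 2) 0 \<tau> = (\<Sum>\<^sub>\<infinity>n::int. nome (\<tau> / 4) * (nome \<tau> ^ nat (n\<^sup>2) * nome \<tau> powi n))"
    unfolding jtheta_def nome_of_nat_mult[symmetric] nome_of_int_mult[symmetric] nome_add[symmetric]
    by (intro infsum_cong arg_cong[of _ _ nome]) (simp add: power2_eq_square field_simps)
  also have "\<dots> = nome (\<tau> / 4) * (\<Sum>\<^sub>\<infinity>n::int. nome \<tau> ^ nat (n\<^sup>2) * nome \<tau> powi n)"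
    by (rule infsum_cmult_right')
  finally show ?thesis using theta2_product[of "nome \<tau>"] norm_nome_less_1[OF assms] by simp
qed

definition eta :: "complex \<Rightarrow> complex" where
  "eta \<tau> = nome (\<tau> / 24) * euler (nome \<tau>)"

lemma eta_nonzero: "Im \<tau> > 0 \<Longrightarrow> eta \<tau> \<noteq> 0"
  by (simp add: eta_def euler_nonzero norm_nome_less_1)

lemma eta_holomorphic: "eta holomorphic_on uhp"
proof -
  have "(\<lambda>\<tau>. qpoch 1 1 (nome \<tau>)) holomorphic_on uhp"
  proof (rule holomorphic_on_compose_gen[OF _ qpoch_holomorphic, unfolded o_def])
    show "nome holomorphic_on uhp" using nome_holomorphic[of "\<lambda>x. x" uhp] by simp
    show "nome ` uhp \<subseteq> ball 0 1" by (auto simp: norm_nome_less_1)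
  qed auto
  thus ?thesis unfolding eta_def[abs_def] euler_def by (intro holomorphic_intros) auto
qed

text \<open>Inversion permutes the three theta constants, so this product determines the inversion
  of \<open>eta\<close> up to a cube root of unity. The argument \<tau> / 2 accounts for theta
  series in powers of \<open>nome\<close> instead of its square root.\<close>

lemma eta_cubed:
  assumes "Im \<tau> > 0"
  shows "eta \<tau> ^ 3 = jtheta (1 / 2) 0 (\<tau> / 2) * jtheta 0 0 (\<tau> / 2) * jtheta 0 (1 / 2) (\<tau> / 2) / 2"
proof -
  define p where "p = nome (\<tau> / 2)"
  have p: "norm p < 1" "norm (p ^ 2) < 1" "norm (p ^ 4) < 1"
    using norm_nome_less_1[of "\<tau> / 2"] assms by (simp_all add: p_def norm_power power_less_one_iff)
  have im: "Im (\<tau> / 2) > 0" using assms by simp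
  have q: "nome \<tau> = p ^ 2" by (simp add: p_def flip: nome_of_nat_mult)
  have 8: "nome (\<tau> / 24) ^ 3 = nome (\<tau> / 2 / 4)" by (simp flip: nome_of_nat_mult)
  show ?thesis
    unfolding jtheta_half_0_product[OF im] jtheta_00(1)[OF im] jtheta_0_half_product[OF im] eta_def
      power_mult_distrib 8 q
    using p[THEN euler_nonzero] by (simp add: p_def[symmetric] field_simps eval_nat_numeral)
qed

text \<open>Squaring removes the choice of square roots: each squared theta constant, including the
  two that are exchanged, picks up the same factor -i \<tau>.\<close>

lemma eta_inversion_sixth:
  assumes \<tau>: "Im \<tau> > 0"
  shows "(eta (- 1 / \<tau>) ^ 2) ^ 3 = (- \<i> * \<tau> * eta \<tau> ^ 2) ^ 3"
proof -
  have \<tau>0: "\<tau> \<noteq> 0" using \<tau> by auto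
  have im: "Im (\<tau> / 2) > 0" "Im (- 1 / \<tau>) > 0" "Im (- 1 / \<tau> / 2) > 0"
    unfolding Im_divide_numeral using \<tau> uhp_inverse[OF \<tau>] by auto
  have s: "- 1 / (4 * (\<tau> / 2)) = - 1 / \<tau> / 2" by (simp add: field_simps)
  have s': "- 1 / (4 * (- 1 / \<tau> / 2)) = \<tau> / 2" using \<tau>0 by (simp add: field_simps)
  have r: "- 2 * \<i> * (\<tau> / 2) = - \<i> * \<tau>" by simp
  have r': "- 2 * \<i> * (- 1 / \<tau> / 2) = \<i> / \<tau>" by simp
  note inv = jtheta_inversion[OF im(1), unfolded s r] jtheta_inversion[OF im(3), unfolded s' r']
  have A: "(jtheta (1 / 2) 0 (- 1 / \<tau> / 2))\<^sup>2 = - \<i> * \<tau> * (jtheta 0 (1 / 2) (\<tau> / 2))\<^sup>2"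
    "(jtheta 0 0 (- 1 / \<tau> / 2))\<^sup>2 = - \<i> * \<tau> * (jtheta 0 0 (\<tau> / 2))\<^sup>2"
    unfolding inv(1) power_mult_distrib power2_csqrt by (rule refl)+
  have "(jtheta (1 / 2) 0 (\<tau> / 2))\<^sup>2 = \<i> / \<tau> * (jtheta 0 (1 / 2) (- 1 / \<tau> / 2))\<^sup>2"
    unfolding inv(2) power_mult_distrib power2_csqrt by (rule refl)
  hence B: "(jtheta 0 (1 / 2) (- 1 / \<tau> / 2))\<^sup>2 = - \<i> * \<tau> * (jtheta (1 / 2) 0 (\<tau> / 2))\<^sup>2"
    using \<tau>0 by (simp add: field_simps)
  have "(eta (- 1 / \<tau>) ^ 2) ^ 3 = (eta (- 1 / \<tau>) ^ 3)\<^sup>2" by (simp flip: power_mult)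
  also have "\<dots> = (- \<i> * \<tau>) ^ 3 * (eta \<tau> ^ 3)\<^sup>2"
    unfolding eta_cubed[OF im(2)] eta_cubed[OF \<tau>] power_divide power_mult_distrib A B
    by (simp add: power_mult_distrib power3_eq_cube mult_ac)
  also have "\<dots> = (- \<i> * \<tau> * eta \<tau> ^ 2) ^ 3"
    unfolding power_mult_distrib by (simp flip: power_mult)
  finally show ?thesis .
qed

text \<open>
  The ratio of both sides is a cube root of unity that depends continuously on \<open>\<tau>\<close>, and it
  equals 1 at the fixed point \<open>\<i>\<close>.
\<close>

theorem eta_sq_inversion:
  assumes \<tau>: "Im \<tau> > 0"
  shows "eta (- 1 / \<tau>) ^ 2 = - \<i> * \<tau> * eta \<tau> ^ 2"
proof -
  define \<rho> where "\<rho> = (\<lambda>\<tau>. eta (- 1 / \<tau>) ^ 2 / (- \<i> * \<tau> * eta \<tau> ^ 2))"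
  have nz: "- \<i> * z * eta z ^ 2 \<noteq> 0" if "Im z > 0" for z
    using eta_nonzero[OF that] that by auto
  have cube: "\<rho> z ^ 3 = 1" if "Im z > 0" for z
    unfolding \<rho>_def power_divide eta_inversion_sixth[OF that] using nz[OF that] by simp
  have hol: "(\<lambda>z. eta (- 1 / z)) holomorphic_on uhp"
  proof (rule holomorphic_on_compose_gen[OF _ eta_holomorphic, unfolded o_def])
    show "(\<lambda>z. - 1 / z) holomorphic_on uhp" by (intro holomorphic_intros) auto
    show "(\<lambda>z. - 1 / z) ` uhp \<subseteq> uhp" using uhp_inverse by auto
  qed
  have "\<rho> holomorphic_on uhp"
    unfolding \<rho>_def using nz by (intro holomorphic_intros hol eta_holomorphic) auto
  hence "continuous_on uhp \<rho>" by (rule holomorphic_on_imp_continuous_on)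
  moreover have "finite (\<rho> ` uhp)"
  proof (rule finite_subset)
    show "\<rho> ` uhp \<subseteq> {z. z ^ 3 = 1}" using cube by auto
    show "finite {z::complex. z ^ 3 = 1}" by (rule finite_roots_unity) auto
  qed
  ultimately have "\<rho> constant_on uhp"
    by (intro continuous_finite_range_constant uhp_connected)
  then obtain c where c: "\<And>z. z \<in> uhp \<Longrightarrow> \<rho> z = c" unfolding constant_on_def by blast
  have "\<rho> \<i> = 1" using eta_nonzero[of \<i>] by (simp add: \<rho>_def)
  hence "\<rho> \<tau> = 1" using c[of \<tau>] c[of \<i>] \<tau> by simp
  thus ?thesis unfolding \<rho>_def by (rule divide_eq_1_iff[THEN iffD1, THEN conjunct2])
qed

section \<open>The multiplier of the squared eta function on the modular group\<close>

lemma eta_shift: "eta (\<tau> + of_int k) = nome (of_int k / 24) * eta \<tau>"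
  by (simp add: eta_def nome_add add_divide_distrib)

lemma eta_sq_shift: "eta (\<tau> + of_int k) ^ 2 = nome (of_int k / 12) * eta \<tau> ^ 2"
  by (simp add: eta_shift power_mult_distrib flip: nome_of_nat_mult)

text \<open>Since eta^2 has weight 1, its multiplier is a character of SL(2, Z), with values in the
  12th roots of unity. This polynomial represents its exponent modulo 12, with value 1 at the
  translation by 1 and -3 at the inversion.\<close>

definition eta_mult :: "int \<Rightarrow> int \<Rightarrow> int \<Rightarrow> int \<Rightarrow> int" where
  "eta_mult a b c d = (1 - c\<^sup>2) * (b * d + 3 * (c - 1) * d + c + 3) + c * (a + d - 3)"

text \<open>The two sides differ by -k (1 - c^2) (1 - d^2). The determinant makes c and d coprime:
  one that is odd gives the divisor 4, one that is prime to 3 gives the divisor 3.\<close>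

lemma eta_mult_T:
  assumes det: "a * d - b * c = 1"
  shows "[eta_mult (a + k * c) (b + k * d) c d = eta_mult a b c d + k] (mod 12)"
proof -
  have "4 dvd (1 - c\<^sup>2) * (1 - d\<^sup>2)"
  proof -
    have "odd c \<or> odd d"
    proof (rule ccontr)
      assume "\<not> (odd c \<or> odd d)"
      hence "even (a * d - b * c)" by simp
      thus False by (simp add: det)
    qed
    hence "4 dvd 1 - c\<^sup>2 \<or> 4 dvd 1 - d\<^sup>2"
    proof -
      have "4 dvd 1 - x\<^sup>2" if odd: "odd x" for x :: int
      proof -
        obtain y where "x = 2 * y + 1" using odd by (elim oddE)
        hence "1 - x\<^sup>2 = 4 * (- y\<^sup>2 - y)" by (simp add: power2_eq_square algebra_simps)
        thus ?thesis by simp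
      qed
      thus ?thesis using \<open>odd c \<or> odd d\<close> by blast
    qed
    thus ?thesis by (auto intro: dvd_mult dvd_mult2)
  qed
  moreover have "3 dvd (1 - c\<^sup>2) * (1 - d\<^sup>2)"
  proof -
    have "\<not> (3 dvd c \<and> 3 dvd d)"
    proof
      assume "3 dvd c \<and> 3 dvd d"
      hence "3 dvd a * d - b * c" by (intro dvd_diff) auto
      thus False by (simp add: det)
    qed
    moreover have "3 dvd 1 - x\<^sup>2" if "\<not> 3 dvd x" for x :: int
    proof -
      have "x mod 3 = 1 \<or> x mod 3 = 2" using that by presburger
      moreover have "[x\<^sup>2 = (x mod 3)\<^sup>2] (mod 3)" by (intro cong_pow) simp
      ultimately have "[1 = x\<^sup>2] (mod 3)" by (auto simp: cong_def)
      thus ?thesis unfolding cong_iff_dvd_diff .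
    qed
    ultimately have "3 dvd 1 - c\<^sup>2 \<or> 3 dvd 1 - d\<^sup>2" by blast
    thus ?thesis by (auto intro: dvd_mult dvd_mult2)
  qed
  moreover have "12 dvd x" if "4 dvd x" "3 dvd x" for x :: int using that by presburger
  ultimately have "12 dvd (1 - c\<^sup>2) * (1 - d\<^sup>2)" by blast
  moreover have "eta_mult (a + k * c) (b + k * d) c d - (eta_mult a b c d + k) = (1 - c\<^sup>2) * (1 - d\<^sup>2) * (- k)"
    by (simp add: eta_mult_def power2_eq_square algebra_simps)
  ultimately show ?thesis unfolding cong_iff_dvd_diff by simp
qed

lemma eta_mult_cong:
  assumes "[a = a'] (mod m)" "[b = b'] (mod m)" "[c = c'] (mod m)" "[d = d'] (mod m)"
  shows "[eta_mult a b c d = eta_mult a' b' c' d'] (mod m)"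
  unfolding eta_mult_def by (intro cong_add cong_diff cong_mult cong_pow cong_refl assms)

text \<open>The behaviour under inversion is a polynomial congruence modulo 12, settled by checking
  all residues modulo 3 and modulo 4 separately.\<close>

lemma eta_mult_S_mod_3: "\<forall>a\<in>set [0..2]. \<forall>b\<in>set [0..2]. \<forall>c\<in>set [0..2]. \<forall>d\<in>set [0..2].
    (a * d - b * c) mod 3 = 1 mod 3 \<longrightarrow> (eta_mult a b c d - (eta_mult (- c) (- d) a b + 3)) mod 3 = 0"
  by code_simp

lemma eta_mult_S_mod_4: "\<forall>a\<in>set [0..3]. \<forall>b\<in>set [0..3]. \<forall>c\<in>set [0..3]. \<forall>d\<in>set [0..3].
    (a * d - b * c) mod 4 = 1 mod 4 \<longrightarrow> (eta_mult a b c d - (eta_mult (- c) (- d) a b + 3)) mod 4 = 0"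
  by code_simp

lemma eta_mult_S:
  assumes det: "a * d - b * c = 1"
  shows "[eta_mult a b c d = eta_mult (- c) (- d) a b + 3] (mod 12)"
proof -
  define E where "E = (\<lambda>a b c d. eta_mult a b c d - (eta_mult (- c) (- d) a b + 3))"
  have E: "m dvd E a b c d" if m: "m = n + 1" "n > 0"
    "\<forall>a\<in>set [0..n]. \<forall>b\<in>set [0..n]. \<forall>c\<in>set [0..n]. \<forall>d\<in>set [0..n]. (a * d - b * c) mod m = 1 mod m \<longrightarrow>
      (eta_mult a b c d - (eta_mult (- c) (- d) a b + 3)) mod m = 0" for m n
  proof -
    have r: "[x mod m = x] (mod m)" for x by simp
    have "[(a mod m) * (d mod m) - (b mod m) * (c mod m) = 1] (mod m)"
      unfolding det[symmetric] by (intro cong_diff cong_mult r)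
    hence 1: "((a mod m) * (d mod m) - (b mod m) * (c mod m)) mod m = 1 mod m"
      by (simp only: cong_def)
    have mem: "x mod m \<in> set [0..n]" for x
    proof -
      have "m > 0" using m(1,2) by linarith
      hence "0 \<le> x mod m" "x mod m < n + 1" using m(1) by (simp_all only: pos_mod_sign) (metis pos_mod_bound)
      thus ?thesis unfolding set_upto by auto
    qed
    have "E (a mod m) (b mod m) (c mod m) (d mod m) mod m = 0"
      unfolding E_def by (rule m(3)[THEN bspec, OF mem, THEN bspec, OF mem, THEN bspec, OF mem, THEN bspec, OF mem, THEN mp, OF 1])
    moreover have "[E (a mod m) (b mod m) (c mod m) (d mod m) = E a b c d] (mod m)"
      unfolding E_def by (intro cong_diff cong_add eta_mult_cong cong_refl r cong_minus_minus_iff[THEN iffD2])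
    ultimately show ?thesis using cong_dvd_iff mod_0_imp_dvd by blast
  qed
  have "3 dvd E a b c d"
  proof (rule E)
    show "(3::int) = 2 + 1" "(2::int) > 0" by simp_all
    show "\<forall>a\<in>set [0..2]. \<forall>b\<in>set [0..2]. \<forall>c\<in>set [0..2]. \<forall>d\<in>set [0..2].
      (a * d - b * c) mod 3 = 1 mod 3 \<longrightarrow> (eta_mult a b c d - (eta_mult (- c) (- d) a b + 3)) mod 3 = 0"
      by (rule eta_mult_S_mod_3)
  qed
  moreover have "4 dvd E a b c d"
  proof (rule E)
    show "(4::int) = 3 + 1" "(3::int) > 0" by simp_all
    show "\<forall>a\<in>set [0..3]. \<forall>b\<in>set [0..3]. \<forall>c\<in>set [0..3]. \<forall>d\<in>set [0..3].
      (a * d - b * c) mod 4 = 1 mod 4 \<longrightarrow> (eta_mult a b c d - (eta_mult (- c) (- d) a b + 3)) mod 4 = 0"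
      by (rule eta_mult_S_mod_4)
  qed
  moreover have "12 dvd x" if "4 dvd x" "3 dvd x" for x :: int using that by presburger
  ultimately have "12 dvd E a b c d" by blast
  thus ?thesis unfolding cong_iff_dvd_diff E_def .
qed

lemma Im_moebius_pos:
  fixes a b c d :: int
  assumes det: "a * d - b * c = 1" and \<tau>: "Im \<tau> > 0"
  shows "of_int c * \<tau> + of_int d \<noteq> 0" and "Im ((of_int a * \<tau> + of_int b) / (of_int c * \<tau> + of_int d)) > 0"
proof -
  show nz: "of_int c * \<tau> + of_int d \<noteq> 0"
  proof
    assume 0: "of_int c * \<tau> + of_int d = 0"
    hence "Im (of_int c * \<tau> + of_int d) = 0" by simp
    hence "c = 0" using \<tau> by simp
    with 0 have "d = 0" by simp
    with \<open>c = 0\<close> det show False by simp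
  qed
  have "Im ((of_int a * \<tau> + of_int b) / (of_int c * \<tau> + of_int d)) =
      of_int (a * d - b * c) * Im \<tau> / (cmod (of_int c * \<tau> + of_int d)) ^ 2"
    unfolding Im_divide cmod_power2 by (simp add: algebra_simps)
  thus "Im ((of_int a * \<tau> + of_int b) / (of_int c * \<tau> + of_int d)) > 0"
    using nz \<tau> unfolding det by simp
qed

text \<open>The Euclidean algorithm on the first column: a translation reduces a modulo c, an
  inversion exchanges the rows, and |c| decreases until the matrix is a translation up to
  sign.\<close>

theorem eta_sq_moebius:
  fixes a b c d :: int
  assumes "a * d - b * c = 1" "Im \<tau> > 0"
  shows "eta ((of_int a * \<tau> + of_int b) / (of_int c * \<tau> + of_int d)) ^ 2 =
    nome (of_int (eta_mult a b c d) / 12) * (of_int c * \<tau> + of_int d) * eta \<tau> ^ 2"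
  using assms
proof (induction "nat \<bar>c\<bar>" arbitrary: a b c d rule: less_induct)
  case less
  note det = less.prems(1) and \<tau> = less.prems(2)
  show ?case
  proof (cases "c = 0")
    case True
    hence "a * d = 1" using det by simp
    hence "(a = 1 \<and> d = 1) \<or> (a = - 1 \<and> d = - 1)" by (auto simp: zmult_eq_1_iff)
    thus ?thesis
    proof
      assume "a = 1 \<and> d = 1"
      thus ?thesis using True by (simp add: eta_mult_def eta_sq_shift)
    next
      assume ad: "a = - 1 \<and> d = - 1"
      \<comment> \<open>Minus the identity has multiplier exponent 6, that is the value -1, which
        cancels the sign of \<open>d\<close>.\<close>
      have "of_int (6 - b) / 12 = (1 / 2 + of_int (- b) / 12 :: complex)" by simp
      hence "nome (of_int (6 - b) / 12) = - nome (of_int (- b) / 12)" by (simp only: nome_add nome_half) simp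
      moreover have "eta_mult a b c d = 6 - b" using True ad by (simp add: eta_mult_def)
      moreover have "(of_int a * \<tau> + of_int b) / (of_int c * \<tau> + of_int d) = \<tau> + of_int (- b)"
        using True ad by simp
      ultimately show ?thesis using True ad by (simp only: eta_sq_shift) simp
    qed
  next
    case False
    define k where "k = a div c"
    define a' b' where "a' = a - k * c" and "b' = b - k * d"
    have a': "a' = a mod c" by (simp add: a'_def k_def minus_div_mult_eq_mod)
    have "nat \<bar>a'\<bar> < nat \<bar>c\<bar>" unfolding a' using False by (simp add: abs_mod_less)
    moreover have det': "(- c) * b' - (- d) * a' = 1" using det by (simp add: a'_def b'_def algebra_simps)
    ultimately have IH: "eta ((of_int (- c) * \<tau> + of_int (- d)) / (of_int a' * \<tau> + of_int b')) ^ 2 =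
      nome (of_int (eta_mult (- c) (- d) a' b') / 12) * (of_int a' * \<tau> + of_int b') * eta \<tau> ^ 2"
      using \<tau> by (rule less.hyps)
    define z where "z = (of_int (- c) * \<tau> + of_int (- d)) / (of_int a' * \<tau> + of_int b')"
    have nz': "of_int a' * \<tau> + of_int b' \<noteq> 0" and z: "Im z > 0"
      unfolding z_def by (rule Im_moebius_pos[OF det' \<tau>])+
    have nz: "of_int c * \<tau> + of_int d \<noteq> 0" by (rule Im_moebius_pos[OF det \<tau>])
    have eq: "(of_int a * \<tau> + of_int b) / (of_int c * \<tau> + of_int d) = - 1 / z + of_int k"
    proof -
      have "- 1 / z = (of_int a' * \<tau> + of_int b') / (of_int c * \<tau> + of_int d)"
      proof -
        have "z = - (of_int c * \<tau> + of_int d) / (of_int a' * \<tau> + of_int b')" by (simp add: z_def)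
        moreover have "- 1 / (- X / Y) = Y / X" for X Y :: complex by simp
        ultimately show ?thesis by (simp only:)
      qed
      moreover have "of_int a * \<tau> + of_int b = (of_int a' * \<tau> + of_int b') + of_int k * (of_int c * \<tau> + of_int d)"
        by (simp add: a'_def b'_def algebra_simps)
      ultimately show ?thesis using nz by (simp add: add_divide_distrib)
    qed
    have zz: "z * (of_int a' * \<tau> + of_int b') = - (of_int c * \<tau> + of_int d)"
      using nz' by (simp add: z_def)
    have i: "\<i> = nome (3 / 12)"
    proof -
      have "2 * of_real pi * \<i> * (3 / 12) = \<i> * complex_of_real (pi / 2)" by simp
      thus ?thesis unfolding nome_def by (simp only: cis_conv_exp[symmetric] cis_pi_half)
    qed
    have "eta ((of_int a * \<tau> + of_int b) / (of_int c * \<tau> + of_int d)) ^ 2 =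
      nome (of_int k / 12) * (- \<i> * z * (nome (of_int (eta_mult (- c) (- d) a' b') / 12) * (of_int a' * \<tau> + of_int b') * eta \<tau> ^ 2))"
      unfolding eq eta_sq_shift eta_sq_inversion[OF z] IH[folded z_def] ..
    also have "\<dots> = nome (of_int k / 12) * nome (of_int (eta_mult (- c) (- d) a' b') / 12) * (- \<i>) * (z * (of_int a' * \<tau> + of_int b')) * eta \<tau> ^ 2"
      by (simp only: mult_ac)
    also have "\<dots> = nome (of_int k / 12) * nome (of_int (eta_mult (- c) (- d) a' b') / 12) * nome (3 / 12) * (of_int c * \<tau> + of_int d) * eta \<tau> ^ 2"
      unfolding zz i[symmetric] by (simp only: mult_minus_left mult_minus_right minus_minus)
    also have "nome (of_int k / 12) * nome (of_int (eta_mult (- c) (- d) a' b') / 12) * nome (3 / 12) =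
      nome (of_int (eta_mult (- c) (- d) a' b' + 3 + k) / of_nat 12)"
      unfolding nome_add[symmetric] by (rule arg_cong[of _ _ nome]) (simp add: field_simps)
    also have "\<dots> = nome (of_int (eta_mult a b c d) / of_nat 12)"
    proof (rule nome_cong)
      have det2: "a' * d - b' * c = 1" using det' by (simp add: algebra_simps)
      have "[eta_mult a b c d = eta_mult a' b' c d + k] (mod 12)"
        using eta_mult_T[OF det2, of k] by (simp add: a'_def b'_def)
      also have "[eta_mult a' b' c d + k = eta_mult (- c) (- d) a' b' + 3 + k] (mod 12)"
        by (intro cong_add eta_mult_S det2 cong_refl)
      finally show "[eta_mult (- c) (- d) a' b' + 3 + k = eta_mult a b c d] (mod int 12)"
        by (simp add: cong_sym)
    qed auto
    finally show ?thesis by simp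
  qed
qed

text \<open>A positive real factor respects the principal branch. It lets the positive Gauss sum
  cancel the N under the square root in \<open>jtheta_cusp\<close>.\<close>

lemma csqrt_divide_of_nat:
  assumes "N > 0"
  shows "csqrt (z / of_nat N) * of_real (sqrt (real N)) = csqrt z"
proof -
  have "csqrt z = csqrt (z / of_nat N) * of_real (sqrt (real N))"
  proof (rule csqrt_unique)
    have "(of_real (sqrt (real N)) :: complex)\<^sup>2 = of_nat N"
      by (simp flip: of_real_power)
    thus "(csqrt (z / of_nat N) * of_real (sqrt (real N)))\<^sup>2 = z"
      using assms by (simp add: power_mult_distrib)
    show "0 < Re (csqrt (z / of_nat N) * of_real (sqrt (real N))) \<or>
      Re (csqrt (z / of_nat N) * of_real (sqrt (real N))) = 0 \<and> 0 \<le> Im (csqrt (z / of_nat N) * of_real (sqrt (real N)))"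
      using csqrt_principal[of "z / of_nat N"] assms by auto
  qed
  thus ?thesis by simp
qed

text \<open>
  All matrices of determinant 4 that are needed have the shape \<open>(4 A, B; 4 N, 4 D)\<close> with
  \<open>N\<close> a power of 5; they send \<open>(V - D) / N\<close> to \<open>A / N - 1 / (4 N V)\<close>. The automorphy factor
  depends on the matrix only through \<open>N\<close> modulo 6.
\<close>

theorem frobenius_quotient_cusp:
  fixes A D :: int and N b k :: nat
  defines "N \<equiv> 5 ^ k"
  assumes A: "[A = 1] (mod 60)" and D: "3 dvd D" and AD: "int N dvd 4 * A * D - 1" and V: "Im V > 0"
  defines "\<tau> \<equiv> of_int A / of_nat N - 1 / (4 * of_nat N * V)" and "\<tau>' \<equiv> (V - of_int D) / of_nat N"
  shows "jtheta (b / 2) 0 \<tau> / eta \<tau> ^ 2 =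
    nome (of_nat (b\<^sup>2) / 4) * csqrt (- 2 * \<i> * V) / (nome (- of_nat N / 6) * (4 * V)) *
    (jtheta 0 (b / 2) \<tau>' / eta (4 * \<tau>') ^ 2)"
proof -
  have N0: "N > 0" and oddN: "odd N" by (simp_all add: N_def)
  have A5: "[A = 1] (mod 5)" and A12: "[A = 1] (mod 12)" and A4: "[A = 1] (mod 4)"
    using A by (auto intro: cong_modulus_mult[of _ _ 5 12] cong_modulus_mult[of _ _ 12 5] cong_modulus_mult[of _ _ 4 15])
  have N4: "[int N = 1] (mod 4)"
    using cong_pow[of 5 1 "4::int" k] by (simp add: N_def cong_def)
  have N12: "[(int N)\<^sup>2 = 1] (mod 12)"
    using cong_pow[of 25 1 "12::int" k] by (simp add: N_def cong_def power2_eq_square flip: power_mult_distrib)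
  have \<tau>': "Im \<tau>' > 0" using V N0 by (simp add: \<tau>'_def Im_divide_of_nat)
  have V0: "V \<noteq> 0" using V by auto
  have "jtheta (b / 2) 0 \<tau> = nome (of_nat (b\<^sup>2) * of_int A * of_nat N / 4) * csqrt (- 2 * \<i> * (V / of_nat N)) * of_real (sqrt (real N)) * jtheta 0 (b / 2) \<tau>'"
    unfolding \<tau>_def \<tau>'_def jtheta_cusp[OF oddN AD V] using gauss_sum_5_power[OF A5, of k] by (simp add: N_def)
  also have "nome (of_nat (b\<^sup>2) * of_int A * of_nat N / 4) = nome (of_nat (b\<^sup>2) / 4)"
  proof -
    have "[int (b\<^sup>2) * (A * int N) = int (b\<^sup>2) * (1 * 1)] (mod int 4)"
      using A4 N4 by (intro cong_mult cong_refl) auto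
    from nome_cong[OF this] show ?thesis by (simp add: mult_ac)
  qed
  also have "nome (of_nat (b\<^sup>2) / 4) * csqrt (- 2 * \<i> * (V / of_nat N)) * of_real (sqrt (real N)) = nome (of_nat (b\<^sup>2) / 4) * csqrt (- 2 * \<i> * V)"
    using csqrt_divide_of_nat[OF N0, of "- 2 * \<i> * V"] by simp
  finally have th: "jtheta (b / 2) 0 \<tau> = nome (of_nat (b\<^sup>2) / 4) * csqrt (- 2 * \<i> * V) * jtheta 0 (b / 2) \<tau>'" .
  \<comment> \<open>The matrix (A, B; N, 4 D) is the part of determinant 1: it takes 4 \<tau>' to
    \<tau> with automorphy factor 4 V.\<close>
  obtain B where B: "4 * A * D - 1 = int N * B" using AD by (elim dvdE)
  have det: "A * (4 * D) - B * int N = 1" using B by (simp add: algebra_simps)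
  have im4: "Im (4 * \<tau>') > 0" using \<tau>' by simp
  have den: "of_int (int N) * (4 * \<tau>') + of_int (4 * D) = 4 * V"
    using N0 by (simp add: \<tau>'_def field_simps)
  have "(of_int A * (4 * \<tau>') + of_int B) / (of_int (int N) * (4 * \<tau>') + of_int (4 * D)) = \<tau>"
  proof -
    have "of_nat N * of_int B = (4 * of_int A * of_int D - 1 :: complex)"
      using arg_cong[OF B, of "of_int :: int \<Rightarrow> complex"] by simp
    moreover have "of_nat N * \<tau>' = V - of_int D" using N0 by (simp add: \<tau>'_def)
    moreover have "of_nat N * (of_int A * (4 * \<tau>') + of_int B) = 4 * of_int A * (of_nat N * \<tau>') + of_nat N * of_int B"
      by (simp add: algebra_simps)
    ultimately have "of_nat N * (of_int A * (4 * \<tau>') + of_int B) = 4 * of_int A * V - 1"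
      by (simp only:) (simp add: algebra_simps)
    hence eq: "of_int A * (4 * \<tau>') + of_int B = (4 * of_int A * V - 1) / of_nat N"
      using N0 by (simp add: eq_divide_eq mult.commute)
    have "(4 * A' * V - 1) / M / (4 * V) = A' / M - 1 / (4 * M * V)" if "M \<noteq> 0" for A' M :: complex
      using that V0 by (simp add: field_simps)
    thus ?thesis unfolding den eq \<tau>_def using N0 by simp
  qed
  hence "eta \<tau> ^ 2 = nome (of_int (eta_mult A B (int N) (4 * D)) / of_nat 12) * (4 * V) * eta (4 * \<tau>') ^ 2"
    using eta_sq_moebius[OF det im4] unfolding den by simp
  also have "nome (of_int (eta_mult A B (int N) (4 * D)) / of_nat 12) = nome (of_int (- 2 * int N) / of_nat 12)"
  proof (rule nome_cong)
    \<comment> \<open>Modulo 12 the entries A and 4 D are 1 and 0 and N^2 is 1, so only N (1 + 0 -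
      3) survives.\<close>
    have "[4 * D = 0] (mod 12)" using D by (auto simp: cong_0_iff)
    hence "[eta_mult A B (int N) (4 * D) = eta_mult 1 B (int N) 0] (mod 12)"
      by (intro eta_mult_cong A12 cong_refl)
    also have "[eta_mult 1 B (int N) 0 = (1 - 1) * (int N + 3) + int N * (1 + 0 - 3)] (mod 12)"
      unfolding eta_mult_def using N12 by (intro cong_add cong_mult cong_diff cong_refl) auto
    finally show "[eta_mult A B (int N) (4 * D) = - 2 * int N] (mod int 12)"
      by (simp add: mult.commute)
  qed auto
  also have "nome (of_int (- 2 * int N) / of_nat 12) = nome (- of_nat N / 6)" by simp
  finally show ?thesis unfolding th by simp
qed

section \<open>Power series with integer coefficients\<close>

text \<open>Holomorphy on the disc is included so that formal products, inverses and substitutions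
  can be evaluated again as convergent series.\<close>

definition int_series :: "nat set \<Rightarrow> (complex \<Rightarrow> complex) \<Rightarrow> bool" where
  "int_series R f \<longleftrightarrow> f holomorphic_on ball 0 1 \<and>
     (\<forall>n. fps_nth (fps_expansion f 0) n \<in> \<int> \<and> (fps_nth (fps_expansion f 0) n \<noteq> 0 \<longrightarrow> n mod 4 \<in> R))"

lemma has_fps_expansion_ball:
  "f holomorphic_on ball 0 1 \<Longrightarrow> f has_fps_expansion fps_expansion f 0"
  by (rule has_fps_expansion_fps_expansion[of "ball 0 1"]) auto

lemma int_seriesI:
  assumes "f holomorphic_on ball 0 1" "f has_fps_expansion F"
    "\<And>n. fps_nth F n \<in> \<int>" "\<And>n. fps_nth F n \<noteq> 0 \<Longrightarrow> n mod 4 \<in> R"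
  shows "int_series R f"
  using assms unfolding int_series_def fps_expansion_eqI[OF assms(2)] by auto

lemma int_series_has_sum:
  assumes "int_series R f" "norm q < 1"
  shows "((\<lambda>n. fps_nth (fps_expansion f 0) n * q ^ n) has_sum f q) UNIV"
proof (rule norm_summable_imp_has_sum)
  have hol: "f holomorphic_on ball 0 1" using assms by (simp add: int_series_def)
  hence hol': "f holomorphic_on eball 0 1" by (simp add: one_ereal_def)
  show "(\<lambda>n. fps_nth (fps_expansion f 0) n * q ^ n) sums f q"
    using has_fps_expansion_imp_sums_complex[OF has_fps_expansion_ball[OF hol] hol'] assms(2) by simp
  have "fps_conv_radius (fps_expansion f 0) \<ge> 1" by (rule conv_radius_fps_expansion[OF hol'])
  thus "summable (\<lambda>n. norm (fps_nth (fps_expansion f 0) n * q ^ n))"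
    using assms(2) by (intro norm_summable_fps) (meson ereal_less(3) less_le_trans)
qed

lemma int_series_of_sums:
  assumes sums: "\<And>q. norm q < 1 \<Longrightarrow> (\<lambda>n. of_int (c n) * q ^ n) sums f q"
    and R: "\<And>n. c n \<noteq> 0 \<Longrightarrow> n mod 4 \<in> R"
  shows "int_series R f"
proof (rule int_seriesI)
  define F where "F = Abs_fps (\<lambda>n. of_int (c n) :: complex)"
  show "f holomorphic_on ball 0 1"
    by (rule power_series_holomorphic[where a = "\<lambda>n. of_int (c n)"]) (use sums in auto)
  have "summable (\<lambda>n. fps_nth F n * (1 / 2) ^ n)"
    using sums[of "1 / 2"] by (auto simp: F_def sums_iff)
  hence "fps_conv_radius F \<ge> norm (1 / 2 :: complex)"
    unfolding fps_conv_radius_def by (rule conv_radius_geI)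
  moreover have "ereal (norm (1 / 2 :: complex)) > 0" by simp
  ultimately have "fps_conv_radius F > 0" by order
  moreover have "\<forall>\<^sub>F z in nhds 0. eval_fps F z = f z"
  proof (rule eventually_mono)
    show "\<forall>\<^sub>F z in nhds (0::complex). z \<in> ball 0 1" by (rule eventually_nhds_in_open) auto
    show "eval_fps F z = f z" if "z \<in> ball 0 1" for z
      using sums[of z] that by (simp add: eval_fps_def F_def sums_iff)
  qed
  ultimately show "f has_fps_expansion F" unfolding has_fps_expansion_def by blast
qed (use R in \<open>auto\<close>)

text \<open>A factor supported on multiples of 4 preserves the residues of the exponents of the
  other factor.\<close>

lemma int_series_mult:
  assumes f: "int_series {0} f" and g: "int_series R g"
  shows "int_series R (\<lambda>q. f q * g q)"
proof (rule int_seriesI)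
  have hol: "f holomorphic_on ball 0 1" "g holomorphic_on ball 0 1" using assms by (auto simp: int_series_def)
  show "(\<lambda>q. f q * g q) holomorphic_on ball 0 1" by (intro holomorphic_intros hol)
  let ?F = "fps_expansion f 0" and ?G = "fps_expansion g 0"
  show "(\<lambda>q. f q * g q) has_fps_expansion ?F * ?G"
    by (intro has_fps_expansion_mult has_fps_expansion_ball hol)
  show "fps_nth (?F * ?G) n \<in> \<int>" for n
    unfolding fps_mult_nth using assms by (intro Ints_sum Ints_mult) (auto simp: int_series_def)
  show "n mod 4 \<in> R" if nz: "fps_nth (?F * ?G) n \<noteq> 0" for n
  proof -
    obtain i where i: "i \<in> {0..n}" "fps_nth ?F i * fps_nth ?G (n - i) \<noteq> 0"
      using nz unfolding fps_mult_nth by (rule sum.not_neutral_contains_not_neutral)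
    hence mods: "i mod 4 = 0" "(n - i) mod 4 \<in> R" using assms by (auto simp: int_series_def)
    have "n mod 4 = ((n - i) + i) mod 4" using i by simp
    also have "\<dots> = (n - i) mod 4" by (metis mods(1) add_0_right mod_add_right_eq)
    finally show ?thesis using mods(2) by simp
  qed
qed

lemma int_series_mult_UNIV:
  assumes "int_series UNIV f" "int_series UNIV g"
  shows "int_series UNIV (\<lambda>q. f q * g q)"
proof (rule int_seriesI)
  have hol: "f holomorphic_on ball 0 1" "g holomorphic_on ball 0 1" using assms by (auto simp: int_series_def)
  show "(\<lambda>q. f q * g q) holomorphic_on ball 0 1" by (intro holomorphic_intros hol)
  show "(\<lambda>q. f q * g q) has_fps_expansion fps_expansion f 0 * fps_expansion g 0"
    by (intro has_fps_expansion_mult has_fps_expansion_ball hol)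
  show "fps_nth (fps_expansion f 0 * fps_expansion g 0) n \<in> \<int>" for n
    unfolding fps_mult_nth using assms by (intro Ints_sum Ints_mult) (auto simp: int_series_def)
qed auto

text \<open>With constant term 1 the recursion for the coefficients of the reciprocal never
  divides.\<close>

lemma int_series_inverse:
  assumes f: "int_series UNIV f" and f0: "f 0 = 1" and nz: "\<And>q. norm q < 1 \<Longrightarrow> f q \<noteq> 0"
  shows "int_series UNIV (\<lambda>q. inverse (f q))"
proof (rule int_seriesI)
  have hol: "f holomorphic_on ball 0 1" using assms by (auto simp: int_series_def)
  show "(\<lambda>q. inverse (f q)) holomorphic_on ball 0 1" using nz by (intro holomorphic_intros hol) auto
  define F where "F = fps_expansion f 0"
  have F: "f has_fps_expansion F" unfolding F_def by (rule has_fps_expansion_ball[OF hol])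
  have F0: "fps_nth F 0 = 1" using f0 by (simp add: F_def fps_expansion_def)
  show "(\<lambda>q. inverse (f q)) has_fps_expansion inverse F"
    by (rule has_fps_expansion_inverse[OF F]) (simp add: F0)
  show "fps_nth (inverse F) n \<in> \<int>" for n
  proof (induction n rule: less_induct)
    case (less n)
    show ?case
    proof (cases n)
      case 0
      thus ?thesis by (simp add: F0)
    next
      case (Suc m)
      have "fps_nth (F * inverse F) n = 0"
        using inverse_mult_eq_1'[of F] F0 Suc by simp
      hence "(\<Sum>i=0..n. fps_nth F i * fps_nth (inverse F) (n - i)) = 0" by (simp add: fps_mult_nth)
      hence "fps_nth (inverse F) n + (\<Sum>i=1..n. fps_nth F i * fps_nth (inverse F) (n - i)) = 0"
        by (subst (asm) sum.atLeast_Suc_atMost) (auto simp: F0)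
      hence "fps_nth (inverse F) n = - (\<Sum>i=1..n. fps_nth F i * fps_nth (inverse F) (n - i))"
        by (simp add: eq_neg_iff_add_eq_0)
      also have "\<dots> \<in> \<int>"
        using f less.IH by (intro Ints_minus Ints_sum Ints_mult) (auto simp: int_series_def F_def)
      finally show ?thesis .
    qed
  qed
qed auto

lemma int_series_compose_power:
  assumes f: "int_series UNIV f" and k: "4 dvd k" "k > 0"
  shows "int_series {0} (\<lambda>q. f (q ^ k))"
proof (rule int_seriesI)
  have hol: "f holomorphic_on ball 0 1" using assms by (auto simp: int_series_def)
  have "(\<lambda>q::complex. q ^ k) ` ball 0 1 \<subseteq> ball 0 1"
    using k by (auto simp: norm_power power_less_one_iff)
  thus "(\<lambda>q. f (q ^ k)) holomorphic_on ball 0 1"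
    by (intro holomorphic_on_compose_gen[OF _ hol, unfolded o_def] holomorphic_intros)
  have "(f \<circ> (\<lambda>q. q ^ k)) has_fps_expansion (fps_expansion f 0 oo fps_X ^ k)"
    using k by (intro has_fps_expansion_compose has_fps_expansion_ball hol has_fps_expansion_fps_X_power) auto
  thus "(\<lambda>q. f (q ^ k)) has_fps_expansion (fps_expansion f 0 oo fps_X ^ k)" by (simp add: o_def)
  show "fps_nth (fps_expansion f 0 oo fps_X ^ k) n \<in> \<int>" for n
    using f by (simp add: fps_nth_compose_X_power int_series_def)
  show "n mod 4 \<in> {0}" if "fps_nth (fps_expansion f 0 oo fps_X ^ k) n \<noteq> 0" for n
    using that k by (auto simp: fps_nth_compose_X_power dvd_imp_mod_0 split: if_splits intro: dvd_trans)
qed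

lemma qfact_int_series: "int_series UNIV (\<lambda>q. qfact q N)"
proof (induction N)
  case 0
  have "((\<lambda>_. 1) :: complex \<Rightarrow> complex) has_fps_expansion 1" by (intro fps_expansion_intros)
  thus ?case unfolding qfact_def by (intro int_seriesI[where F = 1]) auto
next
  case (Suc N)
  have "(\<lambda>q::complex. 1 - q ^ Suc N) has_fps_expansion 1 - fps_X ^ Suc N"
    by (intro has_fps_expansion_diff has_fps_expansion_fps_X_power has_fps_expansion_1)
  hence "int_series UNIV (\<lambda>q. 1 - q ^ Suc N)"
    by (rule int_seriesI[rotated]) (auto intro!: holomorphic_intros)
  from int_series_mult_UNIV[OF Suc this] show ?case by (simp only: qfact_Suc)
qed

text \<open>The derivatives at 0 of the partial products converge, so the coefficients are limits of
  integers, and the integers form a closed set.\<close>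

lemma euler_int_series: "int_series UNIV euler"
proof (rule int_seriesI)
  show hol: "euler holomorphic_on ball 0 1"
    using qpoch_holomorphic[of 1 1] by (simp add: euler_def[abs_def])
  show "euler has_fps_expansion fps_expansion euler 0" by (rule has_fps_expansion_ball[OF hol])
  have "uniformly_convergent_on (cball 0 (1/2)) (\<lambda>N q::complex. \<Prod>m<N. 1 - q ^ (1 * m + 1))"
    by (rule qpoch_aux) auto
  then obtain g where g: "uniform_limit (cball 0 (1/2)) (\<lambda>N q. qfact q N) g sequentially"
    unfolding uniformly_convergent_on_def qfact_def by auto
  have "g q = euler q" if "q \<in> cball 0 (1/2)" for q
    using that tendsto_uniform_limitI[OF g that] qfact_LIMSEQ[of q] by (intro LIMSEQ_unique) auto
  hence lim: "uniform_limit (ball 0 (1/2)) (\<lambda>N q. qfact q N) euler sequentially"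
    using uniform_limit_on_subset[OF g, of "ball 0 (1/2)"] by (subst uniform_limit_cong'[where g = "\<lambda>N q. qfact q N" and i = g]) auto
  show "fps_nth (fps_expansion euler 0) n \<in> \<int>" for n
  proof (rule closed_sequentially[OF closed_Ints])
    show "fps_nth (fps_expansion (\<lambda>q. qfact q N) 0) n \<in> \<int>" for N
      using qfact_int_series by (simp add: int_series_def)
    have "(\<lambda>N. (deriv ^^ n) (\<lambda>q. qfact q N) 0) \<longlonglongrightarrow> (deriv ^^ n) euler 0"
      by (rule higher_deriv_complex_uniform_limit[OF lim])
         (auto simp: qfact_def intro!: holomorphic_intros always_eventually)
    thus "(\<lambda>N. fps_nth (fps_expansion (\<lambda>q. qfact q N) 0) n) \<longlonglongrightarrow> fps_nth (fps_expansion euler 0) n"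
      by (simp add: fps_expansion_def tendsto_divide)
  qed
qed auto

lemma euler_0: "euler 0 = 1"
proof -
  have "qfact 0 = (\<lambda>_. 1)" by (auto simp: qfact_def)
  thus ?thesis using LIMSEQ_unique[OF qfact_LIMSEQ[of 0], of 1] by simp
qed

lemma theta_summable:
  assumes "norm (q::complex) < 1"
  shows "(\<lambda>n::int. q ^ nat (n\<^sup>2)) summable_on UNIV"
proof (cases "q = 0")
  case True
  have "(\<lambda>n::int. q ^ nat (n\<^sup>2)) summable_on {0}" by simp
  also have "?this \<longleftrightarrow> (\<lambda>n::int. q ^ nat (n\<^sup>2)) summable_on UNIV"
    by (rule summable_on_cong_neutral) (auto simp: True)
  finally show ?thesis .
next
  case False
  from summable_on_jacobi[OF assms this, of 1] show ?thesis
    using abs_summable_summable[of "\<lambda>n::int. q ^ nat (n\<^sup>2)"] by simp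
qed

text \<open>Collecting equal squares, the coefficient of q^k is s^k times the number of integers
  with square k.\<close>

lemma theta_int_series:
  assumes s: "s = 1 \<or> s = (- 1 :: int)"
  shows "int_series {0, 1} (\<lambda>q. ramanujan_phi (of_int s * q))"
proof (rule int_series_of_sums)
  define sq where "sq = (\<lambda>k. {n::int. nat (n\<^sup>2) = k})"
  have fin: "finite (sq k)" for k
  proof (rule finite_subset)
    show "sq k \<subseteq> {- int k..int k}"
    proof
      fix n assume "n \<in> sq k"
      hence "n\<^sup>2 = int k" by (auto simp: sq_def)
      moreover have "\<bar>n\<bar> \<le> n\<^sup>2"
      proof (cases "n = 0")
        case False
        hence "1 * \<bar>n\<bar> \<le> \<bar>n\<bar> * \<bar>n\<bar>" by (intro mult_right_mono) auto
        thus ?thesis by (simp add: power2_eq_square)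
      qed auto
      ultimately show "n \<in> {- int k..int k}" by auto
    qed
  qed auto
  show "(\<lambda>k. of_int (s ^ k * int (card (sq k))) * q ^ k) sums ramanujan_phi (of_int s * q)" if q: "norm q < 1" for q
  proof -
    have "norm (of_int s * q) < 1" using q s by auto
    from has_sum_infsum[OF theta_summable[OF this]]
    have "((\<lambda>n::int. (of_int s * q) ^ nat (n\<^sup>2)) has_sum ramanujan_phi (of_int s * q)) UNIV"
      by (simp add: ramanujan_phi_def)
    also have "?this \<longleftrightarrow> ((\<lambda>(k, n). (of_int s * q) ^ k) has_sum ramanujan_phi (of_int s * q)) (Sigma UNIV sq)"
      by (rule has_sum_reindex_bij_witness[of _ snd "\<lambda>n. (nat (n\<^sup>2), n)"]) (auto simp: sq_def)
    finally have S: "((\<lambda>(k, n). (of_int s * q) ^ k) has_sum ramanujan_phi (of_int s * q)) (Sigma UNIV sq)" .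
    have "((\<lambda>k. of_int (s ^ k * int (card (sq k))) * q ^ k) has_sum ramanujan_phi (of_int s * q)) UNIV"
    proof (rule has_sum_SigmaD[OF S])
      fix k
      have "((\<lambda>n. (of_int s * q) ^ k) has_sum (\<Sum>n\<in>sq k. (of_int s * q) ^ k)) (sq k)"
        by (rule has_sum_finite[OF fin])
      thus "((\<lambda>n. case (k, n) of (k, n) \<Rightarrow> (of_int s * q) ^ k) has_sum of_int (s ^ k * int (card (sq k))) * q ^ k) (sq k)"
        by (simp add: power_mult_distrib mult_ac)
    qed
    thus ?thesis by (rule has_sum_imp_sums)
  qed
  show "k mod 4 \<in> {0, 1}" if nz: "s ^ k * int (card (sq k)) \<noteq> 0" for k
  proof -
    obtain n where "n \<in> sq k" using nz by (cases "sq k = {}") auto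
    hence n: "n\<^sup>2 = int k" by (auto simp: sq_def)
    have "int k mod 4 = (n mod 4)\<^sup>2 mod 4" unfolding n[symmetric] by (simp add: power_mod)
    moreover have "n mod 4 = 0 \<or> n mod 4 = 1 \<or> n mod 4 = 2 \<or> n mod 4 = 3" by presburger
    ultimately have "int k mod 4 = 0 \<or> int k mod 4 = 1" by auto
    hence "k mod 4 = 0 \<or> k mod 4 = 1" by presburger
    thus ?thesis by simp
  qed
qed

lemma theta_quotient_int_series:
  assumes "s = 1 \<or> s = (- 1 :: int)"
  shows "int_series {0, 1} (\<lambda>q. ramanujan_phi (of_int s * q) / euler (q ^ 4) ^ 2)"
proof -
  have "int_series UNIV (\<lambda>q. inverse (euler q))"
    by (intro int_series_inverse euler_int_series euler_0 euler_nonzero)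
  hence "int_series {0} (\<lambda>q. inverse (euler (q ^ 4)))"
    by (rule int_series_compose_power) auto
  from int_series_mult[OF this int_series_mult[OF this theta_int_series[OF assms]]]
  show ?thesis by (simp add: divide_inverse power2_eq_square mult_ac)
qed

lemma euler_square_int_series:
  assumes "k > 0"
  shows "int_series {0} (\<lambda>q. euler (q ^ (4 * k)) ^ 2)"
  unfolding power2_eq_square using assms
  by (intro int_series_mult int_series_compose_power euler_int_series) auto

section \<open>Dissections modulo powers of 5\<close>

text \<open>
  Up to a constant and a power of \<open>q\<close> (24 times its exponent is \<open>frob_shift \<beta>\<close>), \<open>frob (1 - \<beta>)\<close> is the
  generating function \<open>CPsi2 \<beta>\<close>; \<open>frob_dual\<close> is its image under the involution at 4.
\<close>

definition frob :: "nat \<Rightarrow> complex \<Rightarrow> complex" where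
  "frob b \<tau> = jtheta (b / 2) 0 \<tau> / eta \<tau> ^ 2"

definition frob_dual :: "nat \<Rightarrow> complex \<Rightarrow> complex" where
  "frob_dual b \<tau> = jtheta 0 (b / 2) \<tau> / eta (4 * \<tau>) ^ 2"

text \<open>Replacing \<tau> by \<tau> + 24 r multiplies the term n by the root of unity with
  exponent (24 n - e) r / m, because the step 24 cancels the denominator of the exponents. Averaging
  over r then keeps one progression.\<close>

lemma has_sum_dissection:
  fixes c :: "nat \<Rightarrow> complex" and e :: int
  assumes m: "m > 0" and \<tau>: "Im \<tau> > 0"
    and F: "\<And>\<sigma>. Im \<sigma> > 0 \<Longrightarrow> ((\<lambda>n. c n * nome (of_int (24 * int n - e) * \<sigma> / 24)) has_sum F \<sigma>) UNIV"
  shows "((\<lambda>n. c n * nome (of_int (24 * int n - e) * \<tau> / (24 * of_nat m))) has_sum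
    ((\<Sum>r<m. F ((\<tau> + 24 * of_nat r) / of_nat m)) / of_nat m)) {n. int m dvd 24 * int n - e}"
proof -
  define t where "t = (\<lambda>n. c n * nome (of_int (24 * int n - e) * \<tau> / (24 * of_nat m)))"
  have "c n * nome (of_int (24 * int n - e) * ((\<tau> + 24 * of_nat r) / of_nat m) / 24) =
      t n * nome (of_int (24 * int n - e) * of_nat r / of_nat m)" for n r
  proof -
    have "x * ((\<tau> + 24 * of_nat r) / of_nat m) / 24 = x * \<tau> / (24 * of_nat m) + x * of_nat r / of_nat m" for x
      using m by (simp add: field_simps)
    thus ?thesis by (simp only: t_def nome_add mult.assoc)
  qed
  moreover have "((\<lambda>n. \<Sum>r<m. c n * nome (of_int (24 * int n - e) * ((\<tau> + 24 * of_nat r) / of_nat m) / 24)) has_sum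
      (\<Sum>r<m. F ((\<tau> + 24 * of_nat r) / of_nat m))) UNIV"
    using m \<tau> by (intro has_sum_finite_sum F) (auto simp: Im_divide_of_nat)
  ultimately have "((\<lambda>n. \<Sum>r<m. t n * nome (of_int (24 * int n - e) * of_nat r / of_nat m)) has_sum
      (\<Sum>r<m. F ((\<tau> + 24 * of_nat r) / of_nat m))) UNIV" by (simp only:)
  hence "((\<lambda>n. t n * (if int m dvd 24 * int n - e then of_nat m else 0)) has_sum
      (\<Sum>r<m. F ((\<tau> + 24 * of_nat r) / of_nat m))) UNIV"
    by (simp only: sum_distrib_left[symmetric] sum_roots_of_unity[OF m])
  from has_sum_cmult_left[OF this, of "1 / of_nat m"]
  have "((\<lambda>n. t n * (if int m dvd 24 * int n - e then of_nat m else 0) * (1 / of_nat m)) has_sum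
      ((\<Sum>r<m. F ((\<tau> + 24 * of_nat r) / of_nat m)) / of_nat m)) UNIV"
    by simp
  also have "?this \<longleftrightarrow> (t has_sum ((\<Sum>r<m. F ((\<tau> + 24 * of_nat r) / of_nat m)) / of_nat m)) {n. int m dvd 24 * int n - e}"
    by (rule has_sum_cong_neutral) (use m in auto)
  finally show ?thesis unfolding t_def .
qed

section \<open>The function \<open>L_fun\<close> as a normalised average of
  \<open>frob\<close>\<close>

lemma cpsi2_has_sum:
  assumes q: "norm q < 1"
  shows "((\<lambda>n. cpsi2 \<beta> n * q ^ n) has_sum CPsi2 \<beta> q) UNIV"
proof (rule norm_summable_imp_has_sum[OF _ sums_cpsi2[OF q]])
  obtain r where r: "norm q < r" "r < 1" using dense[OF q] by blast
  have r0: "r > 0" using r(1) norm_ge_zero[of q] by linarith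
  have "summable (\<lambda>n. cpsi2 \<beta> n * of_real r ^ n)"
    by (rule sums_summable[OF sums_cpsi2]) (use r r0 in simp)
  thus "summable (\<lambda>n. norm (cpsi2 \<beta> n * q ^ n))"
    by (rule powser_insidea) (use r r0 in auto)
qed

text \<open>In units of 1/24 the leading exponents are 2 for eta^2, 6 for
  \<open>jtheta (1/2) 0\<close> and 0 for \<open>jtheta 0 0\<close>; hence 2 - 6 and 2 - 0.\<close>

definition frob_shift :: "nat \<Rightarrow> int" where
  "frob_shift \<beta> = (if \<beta> = 0 then - 4 else 2)"

text \<open>The series \<open>jtheta (1/2) 0\<close> takes each exponent twice, at n and at -1 -
  n.\<close>

definition frob_const :: "nat \<Rightarrow> complex" where
  "frob_const \<beta> = (if \<beta> = 0 then 1 / 2 else 1)"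

lemma CPsi2_frob:
  assumes \<beta>: "\<beta> \<in> {0, 1}" and \<tau>: "Im \<tau> > 0"
  shows "CPsi2 \<beta> (nome \<tau>) = frob_const \<beta> * nome (of_int (frob_shift \<beta>) * \<tau> / 24) * frob (1 - \<beta>) \<tau>"
proof -
  define q where "q = nome \<tau>"
  have q: "norm q < 1" using norm_nome_less_1[OF \<tau>] by (simp add: q_def)
  have q': "norm (q ^ 2) < 1" "norm (q ^ 4) < 1" using q by (simp_all add: norm_power power_less_one_iff)
  note nz = euler_nonzero[OF q] euler_nonzero[OF q'(1)] euler_nonzero[OF q'(2)]
  have eta2: "eta \<tau> ^ 2 = nome (\<tau> / 12) * euler q ^ 2"
    by (simp add: eta_def q_def power_mult_distrib flip: nome_of_nat_mult)
  show ?thesis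
  proof (cases "\<beta> = 0")
    case True
    have "nome (- 4 * \<tau> / 24) * nome (\<tau> / 4) = nome (\<tau> / 12)"
      unfolding nome_add[symmetric] by (rule arg_cong[of _ _ nome]) simp
    hence "nome (- 4 * \<tau> / 24) * (nome (\<tau> / 4) * x / (nome (\<tau> / 12) * y)) = x / y" for x y
      by (metis mult.assoc nome_nonzero times_divide_eq_right mult_divide_mult_cancel_left)
    moreover have "frob 1 \<tau> = nome (\<tau> / 4) * (2 * euler (q ^ 4) ^ 2 / euler (q ^ 2)) / (nome (\<tau> / 12) * euler q ^ 2)"
      unfolding frob_def eta2 using jtheta_half_0_product[OF \<tau>] by (simp add: q_def)
    ultimately have "nome (- 4 * \<tau> / 24) * frob 1 \<tau> = 2 * euler (q ^ 4) ^ 2 / euler (q ^ 2) / euler q ^ 2"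
      by (simp only:)
    thus ?thesis using True nz
      by (simp add: CPsi2_def frob_const_def frob_shift_def qpoch_eq_euler q_def[symmetric] mult_ac)
  next
    case False
    hence "\<beta> = 1" using \<beta> by auto
    have "nome (2 * \<tau> / 24) * frob 0 \<tau> = jtheta 0 0 \<tau> / euler q ^ 2"
      unfolding frob_def eta2 by simp
    also have "\<dots> = euler (q ^ 2) ^ 5 / (euler q ^ 4 * euler (q ^ 4) ^ 2)"
      unfolding jtheta_00(1)[OF \<tau>] using nz by (simp add: q_def[symmetric] field_simps eval_nat_numeral)
    finally show ?thesis using \<open>\<beta> = 1\<close>
      by (simp add: CPsi2_def frob_const_def frob_shift_def qpoch_eq_euler q_def[symmetric])
  qed
qed

lemma frob_has_sum:
  assumes \<beta>: "\<beta> \<in> {0, 1}" and \<sigma>: "Im \<sigma> > 0"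
  shows "((\<lambda>n. cpsi2 \<beta> n / frob_const \<beta> * nome (of_int (24 * int n - frob_shift \<beta>) * \<sigma> / 24)) has_sum frob (1 - \<beta>) \<sigma>) UNIV"
proof -
  define k where "k = frob_const \<beta> * nome (of_int (frob_shift \<beta>) * \<sigma> / 24)"
  have k: "k \<noteq> 0" by (simp add: k_def frob_const_def)
  have "((\<lambda>n. cpsi2 \<beta> n * nome \<sigma> ^ n * (1 / k)) has_sum CPsi2 \<beta> (nome \<sigma>) * (1 / k)) UNIV"
    by (intro has_sum_cmult_left cpsi2_has_sum norm_nome_less_1 \<sigma>)
  moreover have "CPsi2 \<beta> (nome \<sigma>) * (1 / k) = frob (1 - \<beta>) \<sigma>"
    using k unfolding CPsi2_frob[OF \<beta> \<sigma>] k_def by simp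
  moreover have "cpsi2 \<beta> n * nome \<sigma> ^ n * (1 / k) = cpsi2 \<beta> n / frob_const \<beta> * nome (of_int (24 * int n - frob_shift \<beta>) * \<sigma> / 24)" for n
  proof -
    have eq: "of_int (24 * int n - frob_shift \<beta>) * \<sigma> / 24 = of_nat n * \<sigma> - of_int (frob_shift \<beta>) * \<sigma> / 24"
      by (simp add: field_simps)
    show ?thesis unfolding eq nome_diff nome_of_nat_mult k_def by simp
  qed
  ultimately show ?thesis by simp
qed

lemma five_power_mod_12: "(5::int) ^ n mod 12 = (if even n then 1 else 5)"
proof (induction n)
  case (Suc n)
  have "(5::int) ^ Suc n mod 12 = 5 * (5 ^ n mod 12) mod 12" by (simp add: mod_mult_right_eq)
  thus ?case using Suc by auto
qed auto

lemma coprime_five_power: "\<not> 5 dvd x \<Longrightarrow> coprime ((5::int) ^ n) x"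
  by (auto intro: prime_imp_coprime)

text \<open>The exponent of q, cleared of denominators. The congruence leaves one residue x of n
  modulo m, for which 6 x + 1 or 12 x - 1 is a multiple m t. Since m is p modulo 12, the bounds on t
  force t = p or t = 12 - p. This explains the summand \<beta> in the exponents of
  \<open>L_fun\<close> and the scale p in its denominator.\<close>

lemma progression_floor:
  fixes \<alpha> \<beta> n :: nat
  defines "m \<equiv> 5 ^ \<alpha>" and "p \<equiv> 1 + 4 * (\<alpha> mod 2)"
  assumes \<alpha>: "\<alpha> \<ge> 1" and \<beta>: "\<beta> \<in> {0, 1}" and n: "int m dvd 24 * int n - frob_shift \<beta>"
  shows "24 * int n - frob_shift \<beta> + frob_shift \<beta> * int p * int m = 24 * int m * (int (n div m) + int \<beta>)"
proof -
  have m5: "int m \<ge> 5" using \<alpha> self_le_power[of "5::int" \<alpha>] by (simp add: m_def)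
  have "int m mod 12 = int p"
    using five_power_mod_12[of \<alpha>] by (cases "even \<alpha>") (auto simp: m_def p_def even_iff_mod_2_eq_zero odd_iff_mod_2_eq_one)
  then obtain u where u: "int m = 12 * u + int p" by (metis mult_div_mod_eq)
  have p: "int p = 1 \<or> int p = 5" by (auto simp: p_def)
  define x where "x = int (n mod m)"
  have x: "0 \<le> x" "x < int m" using m5 by (auto simp: x_def)
  have nx: "int n = int m * int (n div m) + x" by (simp add: x_def flip: of_nat_mult of_nat_add)
  have cop: "coprime (int m) 2" "coprime (int m) 4" unfolding m_def of_nat_power
    using coprime_five_power[of 2 \<alpha>] coprime_five_power[of 4 \<alpha>] by auto
  have "24 * int n - frob_shift \<beta> = int m * (24 * int (n div m)) + (24 * x - frob_shift \<beta>)"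
    unfolding nx by (simp add: algebra_simps)
  hence dvd: "int m dvd 24 * x - frob_shift \<beta>" using n by (metis dvd_add_right_iff dvd_triv_left)
  have "24 * x - frob_shift \<beta> + frob_shift \<beta> * int p * int m = 24 * int m * int \<beta>"
  proof (cases "\<beta> = 0")
    case True
    have "int m dvd 4 * (6 * x + 1)" using dvd True by (simp add: frob_shift_def)
    hence "int m dvd 6 * x + 1" using cop(2) coprime_dvd_mult_right_iff by blast
    then obtain t where t: "6 * x + 1 = int m * t" by (elim dvdE)
    have "0 < int m * t" "int m * t < int m * 6" unfolding t[symmetric] using x by simp_all
    hence t6: "0 < t" "t < 6" using m5 by (simp_all only: zero_less_mult_iff mult_less_cancel_left) linarith+
    \<comment> \<open>Thus p t is 1 modulo 6, and both 1 and 5 are their own inverses.\<close>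
    have "int p * t - 1 = 6 * (x - 2 * (u * t))" using t unfolding u by (simp add: algebra_simps)
    then obtain y where "int p * t - 1 = 6 * y" by blast
    with t6 p have "t = int p" by (elim disjE) (simp, presburger)+
    thus ?thesis using t True by (simp add: frob_shift_def algebra_simps)
  next
    case False
    hence \<beta>1: "\<beta> = 1" using \<beta> by simp
    have "int m dvd 2 * (12 * x - 1)" using dvd \<beta>1 by (simp add: frob_shift_def)
    hence "int m dvd 12 * x - 1" using cop(1) coprime_dvd_mult_right_iff by blast
    then obtain t where t: "12 * x - 1 = int m * t" by (elim dvdE)
    have "int m * t > int m * (- 1)" "int m * t < int m * 12" unfolding t[symmetric] using x m5 by simp_all
    hence t12: "0 \<le> t" "t < 12" using m5 by (simp_all only: mult_less_cancel_left) linarith+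
    have "int p * t + 1 = 12 * (x - u * t)" using t unfolding u by (simp add: algebra_simps)
    then obtain y where "int p * t + 1 = 12 * y" by blast
    with t12 p have t_eq: "t = 12 - int p" by (elim disjE) (simp, presburger)+
    have "24 * x - 2 + 2 * int p * int m = 2 * (12 * x - 1) + 2 * int p * int m" by simp
    also have "\<dots> = 24 * int m" unfolding t t_eq by (simp add: algebra_simps)
    finally show ?thesis using \<beta>1 by (simp add: frob_shift_def)
  qed
  thus ?thesis unfolding nx by (simp add: algebra_simps nx[symmetric])
qed

lemma L_fun_frob:
  fixes \<alpha> \<beta> :: nat
  defines "m \<equiv> 5 ^ \<alpha>" and "p \<equiv> 1 + 4 * (\<alpha> mod 2)"
  assumes \<alpha>: "\<alpha> \<ge> 1" and \<beta>: "\<beta> \<in> {0, 1}" and \<tau>: "Im \<tau> > 0"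
  shows "L_fun \<beta> \<alpha> \<tau> = (\<Sum>r<m. frob (1 - \<beta>) ((\<tau> + 24 * of_nat r) / of_nat m)) / of_nat m / frob (1 - \<beta>) (of_nat p * \<tau>)"
proof -
  let ?S = "{n. int m dvd 24 * int n - frob_shift \<beta>}"
  \<comment> \<open>Multiplication by 4 or 2, which are units modulo powers of 5, turns both
    congruences into 24 n = \<open>frob_shift \<beta>\<close>.\<close>
  have S: "{n. [3 * 2 ^ (\<beta> + 1) * int n = (- 1) ^ (\<beta> + 1)] (mod 5 ^ \<alpha>)} = ?S"
  proof -
    have cop: "coprime (int m) 2" "coprime (int m) 4" unfolding m_def of_nat_power
      using coprime_five_power[of 2 \<alpha>] coprime_five_power[of 4 \<alpha>] by auto
    have m: "(5::int) ^ \<alpha> = int m" by (simp add: m_def)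
    have "[3 * 2 ^ (\<beta> + 1) * int n = (- 1) ^ (\<beta> + 1)] (mod int m) \<longleftrightarrow> int m dvd 24 * int n - frob_shift \<beta>" for n
    proof (cases "\<beta> = 0")
      case True
      have "24 * int n - frob_shift \<beta> = 4 * (6 * int n + 1)" using True by (simp add: frob_shift_def)
      thus ?thesis using True cop(2) by (simp only: coprime_dvd_mult_right_iff) (simp add: cong_iff_dvd_diff)
    next
      case False
      hence \<beta>1: "\<beta> = 1" using \<beta> by simp
      have "24 * int n - frob_shift \<beta> = 2 * (12 * int n - 1)" using \<beta>1 by (simp add: frob_shift_def)
      thus ?thesis using \<beta>1 cop(1) by (simp only: coprime_dvd_mult_right_iff) (simp add: cong_iff_dvd_diff)
    qed
    thus ?thesis unfolding m by simp
  qed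
  have m0: "m > 0" by (simp add: m_def)
  define s where "s = (\<Sum>r<m. frob (1 - \<beta>) ((\<tau> + 24 * of_nat r) / of_nat m)) / of_nat m"
  \<comment> \<open>The factor between \<open>CPsi2\<close> and \<open>frob\<close> at p \<tau>. It
    also completes the fractional exponents of the average to integers, so it cancels in the
    quotient.\<close>
  define k where "k = frob_const \<beta> * nome (of_int (frob_shift \<beta>) * (of_nat p * \<tau>) / 24)"
  have k0: "k \<noteq> 0" by (simp add: k_def frob_const_def)
  have "((\<lambda>n. k * (cpsi2 \<beta> n / frob_const \<beta> * nome (of_int (24 * int n - frob_shift \<beta>) * \<tau> / (24 * of_nat m)))) has_sum k * s) ?S"
    unfolding s_def by (intro has_sum_cmult_right has_sum_dissection[OF m0 \<tau>] frob_has_sum \<beta>)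
  hence "(\<Sum>\<^sub>\<infinity>n\<in>?S. k * (cpsi2 \<beta> n / frob_const \<beta> * nome (of_int (24 * int n - frob_shift \<beta>) * \<tau> / (24 * of_nat m)))) = k * s"
    by (rule infsumI)
  also have "(\<Sum>\<^sub>\<infinity>n\<in>?S. k * (cpsi2 \<beta> n / frob_const \<beta> * nome (of_int (24 * int n - frob_shift \<beta>) * \<tau> / (24 * of_nat m))))
      = (\<Sum>\<^sub>\<infinity>n\<in>?S. cpsi2 \<beta> n * nome \<tau> ^ (n div m + \<beta>))"
  proof (rule infsum_cong)
    fix n assume "n \<in> ?S"
    hence "24 * int n - frob_shift \<beta> + frob_shift \<beta> * int p * int m = 24 * int m * (int (n div m) + int \<beta>)"
      using progression_floor[OF \<alpha> \<beta>, of n] by (simp add: m_def p_def)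
    hence eq: "of_int (24 * int n - frob_shift \<beta>) + of_int (frob_shift \<beta>) * of_nat p * of_nat m = 24 * of_nat m * (of_nat (n div m + \<beta>) :: complex)"
      by (metis (mono_tags) of_int_add of_int_mult of_int_numeral of_int_of_nat_eq of_nat_add)
    have "(x + y * z * w) * t / (24 * w) = x * t / (24 * w) + y * (z * t) / 24" if "w \<noteq> 0" for x y z w t :: complex
      using that by (simp add: field_simps)
    from this[of "of_nat m"] have "of_int (24 * int n - frob_shift \<beta>) * \<tau> / (24 * of_nat m) + of_int (frob_shift \<beta>) * (of_nat p * \<tau>) / 24
       = 24 * of_nat m * of_nat (n div m + \<beta>) * \<tau> / (24 * of_nat m)"
      using m0 eq by (metis of_nat_0_eq_iff less_numeral_extra(3))
    also have "\<dots> = of_nat (n div m + \<beta>) * \<tau>" using m0 by simp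
    finally have "nome (of_int (24 * int n - frob_shift \<beta>) * \<tau> / (24 * of_nat m)) * nome (of_int (frob_shift \<beta>) * (of_nat p * \<tau>) / 24) = nome \<tau> ^ (n div m + \<beta>)"
      by (simp only: nome_add[symmetric] nome_of_nat_mult)
    moreover have "frob_const \<beta> \<noteq> 0" by (simp add: frob_const_def)
    moreover have "f * y * (c / f * x) = c * (x * y)" if "f \<noteq> 0" for c f x y :: complex
      using that by simp
    ultimately show "k * (cpsi2 \<beta> n / frob_const \<beta> * nome (of_int (24 * int n - frob_shift \<beta>) * \<tau> / (24 * of_nat m))) = cpsi2 \<beta> n * nome \<tau> ^ (n div m + \<beta>)"
      by (simp only: k_def not_False_eq_True)
  qed
  finally have sum: "(\<Sum>\<^sub>\<infinity>n\<in>?S. cpsi2 \<beta> n * nome \<tau> ^ (n div m + \<beta>)) = k * s" .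
  have "Im (of_nat p * \<tau>) > 0" using \<tau> by (simp add: p_def add_pos_nonneg)
  hence C: "CPsi2 \<beta> (nome \<tau> ^ (1 + 4 * (\<alpha> mod 2))) = k * frob (1 - \<beta>) (of_nat p * \<tau>)"
    using CPsi2_frob[OF \<beta>, of "of_nat p * \<tau>"] by (simp only: nome_of_nat_mult p_def k_def)
  show ?thesis
    unfolding L_fun_def S C sum[unfolded m_def, folded m_def] s_def[symmetric]
    using sum k0 by (simp add: m_def)
qed

section \<open>The action of \<open>W_map\<close> on the average\<close>

lemma dual_residue_bij:
  fixes \<alpha> :: nat
  defines "m \<equiv> 5 ^ \<alpha>"
  obtains f where "bij_betw f {..<m} {..<m}"
    "\<And>r. r < m \<Longrightarrow> int m dvd 1 + 96 * int (f r) + 576 * int r + 57600 * int r * int (f r)"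
proof -
  have m0: "int m > 0" by (simp add: m_def)
  \<comment> \<open>For A = 1 + 600 r and D = -(6 + 600 r') the number 4 A D - 1 is -25 times 1 + 96
    r' + 576 r + 57600 r r'. Modulo 5 the coefficients 96 and 576 are 1 and 57600 is 0, so r and r'
    determine each other.\<close>
  have cop: "coprime (int m) (96 + 57600 * x)" "coprime (int m) (576 + 57600 * x)" for x
  proof -
    have "\<not> 5 dvd 1 + 5 * y" for y :: int by presburger
    from this[of "19 + 11520 * x"] this[of "115 + 11520 * x"]
    have h: "\<not> 5 dvd 96 + 57600 * x" "\<not> 5 dvd 576 + 57600 * x" by (simp_all add: algebra_simps)
    show "coprime (int m) (96 + 57600 * x)" "coprime (int m) (576 + 57600 * x)"
      unfolding m_def of_nat_power of_nat_numeral by (rule coprime_five_power h)+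
  qed
  have "\<exists>y<m. int m dvd 1 + 96 * int y + 576 * int r + 57600 * int r * int y" for r :: nat
  proof -
    have "coprime (96 + 57600 * int r) (int m)" using cop(1) by (simp add: coprime_commute)
    then obtain x' where "[(96 + 57600 * int r) * x' = 1] (mod int m)"
      using cong_solve_coprime_int by blast
    from cong_scalar_right[OF this, of "- (1 + 576 * int r)"]
    obtain x where x: "[(96 + 57600 * int r) * x = - (1 + 576 * int r)] (mod int m)"
      by (simp only: mult.assoc mult_1)
    define y where "y = nat (x mod int m)"
    have y: "int y = x mod int m" using m0 by (simp add: y_def)
    have "[(96 + 57600 * int r) * int y = (96 + 57600 * int r) * x] (mod int m)"
      unfolding y by (intro cong_mult cong_refl) simp
    from cong_trans[OF this x] have "int m dvd (96 + 57600 * int r) * int y - - (1 + 576 * int r)"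
      unfolding cong_iff_dvd_diff .
    also have "(96 + 57600 * int r) * int y - - (1 + 576 * int r) = 1 + 96 * int y + 576 * int r + 57600 * int r * int y"
      by (simp add: algebra_simps)
    finally have "int m dvd 1 + 96 * int y + 576 * int r + 57600 * int r * int y" .
    moreover have "int y < int m" unfolding y using m0 by simp
    ultimately show ?thesis by auto
  qed
  then obtain f where f: "\<And>r. f r < m" "\<And>r. int m dvd 1 + 96 * int (f r) + 576 * int r + 57600 * int r * int (f r)"
    by metis
  have "inj_on f {..<m}"
  proof (rule inj_onI)
    fix r s assume rs: "r \<in> {..<m}" "s \<in> {..<m}" "f r = f s"
    have "int m dvd (1 + 96 * int (f r) + 576 * int r + 57600 * int r * int (f r)) - (1 + 96 * int (f s) + 576 * int s + 57600 * int s * int (f s))"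
      by (intro dvd_diff f)
    also have "\<dots> = (576 + 57600 * int (f r)) * (int r - int s)" using rs(3) by (simp add: algebra_simps)
    finally have "int m dvd int r - int s" using cop(2) by (simp add: coprime_dvd_mult_right_iff)
    hence "[int r = int s] (mod int m)" by (simp add: cong_iff_dvd_diff)
    thus "r = s" using rs by (simp add: cong_def)
  qed
  moreover have "f ` {..<m} \<subseteq> {..<m}" using f(1) by auto
  ultimately have "bij_betw f {..<m} {..<m}" by (simp add: bij_betw_def endo_inj_surj)
  thus ?thesis using f(2) by (intro that) auto
qed

text \<open>The same \<open>C\<close> for a single value and for the sum is what makes it cancel in
  \<open>L_fun\<close>: all points involved share one V, and the factor depends on N only modulo
  6.\<close>

lemma frob_W:
  fixes \<alpha> b :: nat
  defines "m \<equiv> 5 ^ \<alpha>" and "p \<equiv> 1 + 4 * (\<alpha> mod 2)"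
  assumes \<tau>: "Im \<tau> > 0"
  obtains C where "C \<noteq> 0"
    "frob b (of_nat p * W_map \<tau>) = C * frob_dual b (of_nat p * \<tau>)"
    "(\<Sum>r<m. frob b ((W_map \<tau> + 24 * of_nat r) / of_nat m)) = C * (\<Sum>r<m. frob_dual b ((\<tau> + 24 * of_nat r) / of_nat m))"
proof -
  \<comment> \<open>This gives 1/25 - 1/(100 V) for the image point, the shape required by
    \<open>frobenius_quotient_cusp\<close>.\<close>
  define V where "V = 25 * \<tau> - 6"
  have V: "Im V > 0" using \<tau> by (simp add: V_def)
  hence V0: "V \<noteq> 0" by auto
  have W: "W_map \<tau> = (4 * V - 1) / (100 * V)"
  proof -
    have "100 * V = 25 * (100 * \<tau> - 24)" "4 * V - 1 = 25 * (4 * \<tau> - 1)" by (simp_all add: V_def)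
    thus ?thesis unfolding W_map_def by (simp only: mult_divide_mult_cancel_left_if) simp
  qed
  define C where "C = (\<lambda>N::nat. nome (of_nat (b\<^sup>2) / 4) * csqrt (- 2 * \<i> * V) / (nome (- of_nat N / 6) * (4 * V)))"
  have C0: "C N \<noteq> 0" for N using V0 by (simp add: C_def)
  have cusp: "frob b (of_int A / of_nat (5 ^ k) - 1 / (4 * of_nat (5 ^ k) * V)) =
      C (5 ^ k) * frob_dual b ((V - of_int D) / of_nat (5 ^ k))"
    if "[A = 1] (mod 60)" "3 dvd D" "int (5 ^ k) dvd 4 * A * D - 1" for A D k
    using frobenius_quotient_cusp[OF that V, of b] by (simp only: frob_def frob_dual_def C_def)
  have C_eq: "C (5 ^ (\<alpha> + 2)) = C (5 ^ (2 - \<alpha> mod 2))"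
  proof -
    have par: "even (\<alpha> + 2) \<longleftrightarrow> even (2 - \<alpha> mod 2)" by (cases "even \<alpha>") (auto simp: odd_iff_mod_2_eq_one even_iff_mod_2_eq_zero)
    have "[(5::int) ^ (\<alpha> + 2) = 5 ^ (2 - \<alpha> mod 2)] (mod 12)"
      unfolding cong_def five_power_mod_12 par ..
    hence "[(5::int) ^ (\<alpha> + 2) = 5 ^ (2 - \<alpha> mod 2)] (mod 6)"
      by (rule cong_modulus_mult[of _ _ 6 2, simplified])
    hence "[- int (5 ^ (\<alpha> + 2)) = - int (5 ^ (2 - \<alpha> mod 2))] (mod int 6)"
      by (simp add: cong_minus_minus_iff)
    from nome_cong[OF this] have "nome (- of_nat (5 ^ (\<alpha> + 2)) / 6) = nome (- of_nat (5 ^ (2 - \<alpha> mod 2)) / 6)"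
      by simp
    thus ?thesis unfolding C_def by (simp only:)
  qed
  obtain f where f: "bij_betw f {..<m} {..<m}"
    "\<And>r. r < m \<Longrightarrow> int m dvd 1 + 96 * int (f r) + 576 * int r + 57600 * int r * int (f r)"
    using dual_residue_bij unfolding m_def by blast
  have m0: "(of_nat m :: complex) \<noteq> 0" by (simp add: m_def)
  have N: "5 ^ (\<alpha> + 2) = 25 * m" by (simp add: m_def)
  have main: "frob b ((W_map \<tau> + 24 * of_nat r) / of_nat m) = C (5 ^ (\<alpha> + 2)) * frob_dual b ((\<tau> + 24 * of_nat (f r)) / of_nat m)"
    if r: "r < m" for r
  proof -
    \<comment> \<open>Adding 24 r to the image point adds 600 r to the numerator over 25 m;
      \<open>D\<close> is such that (V - D) / (25 m) is the point with index f r on the dual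
      side.\<close>
    define A D where "A = 1 + 600 * int r" and "D = - (6 + 600 * int (f r))"
    have AD: "int (5 ^ (\<alpha> + 2)) dvd 4 * A * D - 1"
    proof -
      have eq: "4 * A * D - 1 = (25 :: int) * - (1 + 96 * int (f r) + 576 * int r + 57600 * int r * int (f r))"
        by (simp add: A_def D_def algebra_simps)
      show ?thesis unfolding N eq of_nat_mult of_nat_numeral
        by (intro mult_dvd_mono dvd_refl) (simp only: dvd_minus_iff f(2)[OF r])
    qed
    have "[A = 1] (mod 60)" by (simp add: A_def cong_iff_dvd_diff)
    moreover have "3 dvd D" by (simp add: D_def)
    ultimately have "frob b (of_int A / of_nat (5 ^ (\<alpha> + 2)) - 1 / (4 * of_nat (5 ^ (\<alpha> + 2)) * V)) =
      C (5 ^ (\<alpha> + 2)) * frob_dual b ((V - of_int D) / of_nat (5 ^ (\<alpha> + 2)))"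
      using AD by (intro cusp)
    moreover have "of_int A / of_nat (25 * m) - 1 / (4 * of_nat (25 * m) * V) = (W_map \<tau> + 24 * of_nat r) / of_nat m"
      using m0 V0 by (simp add: W A_def field_simps)
    moreover have "(V - of_int D) / of_nat (25 * m) = (\<tau> + 24 * of_nat (f r)) / of_nat m"
      using m0 by (simp add: V_def D_def field_simps)
    ultimately show ?thesis unfolding N by simp
  qed
  \<comment> \<open>Scaling by p = 5 lowers N from 25 to 5. The choice A = 1, D = -6 serves both, as
    4 A D - 1 = -25.\<close>
  have den: "frob b (of_nat p * W_map \<tau>) = C (5 ^ (2 - \<alpha> mod 2)) * frob_dual b (of_nat p * \<tau>)"
  proof (cases "even \<alpha>")
    case True
    hence a: "\<alpha> mod 2 = 0" by simp
    have "frob b (of_int 1 / of_nat (5 ^ 2) - 1 / (4 * of_nat (5 ^ 2) * V)) =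
        C (5 ^ 2) * frob_dual b ((V - of_int (- 6)) / of_nat (5 ^ 2))"
      by (rule cusp) auto
    moreover have "of_int 1 / of_nat (5 ^ 2) - 1 / (4 * of_nat (5 ^ 2) * V) = W_map \<tau>"
      using V0 by (simp add: W field_simps)
    ultimately show ?thesis by (simp add: a p_def V_def)
  next
    case False
    hence a: "\<alpha> mod 2 = 1" by (simp add: odd_iff_mod_2_eq_one)
    have "frob b (of_int 1 / of_nat (5 ^ 1) - 1 / (4 * of_nat (5 ^ 1) * V)) =
        C (5 ^ 1) * frob_dual b ((V - of_int (- 6)) / of_nat (5 ^ 1))"
      by (rule cusp) auto
    moreover have "of_int 1 / of_nat (5 ^ 1) - 1 / (4 * of_nat (5 ^ 1) * V) = 5 * W_map \<tau>"
      using V0 by (simp add: W field_simps)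
    moreover have "(V - of_int (- 6)) / of_nat (5 ^ 1) = 5 * \<tau>" by (simp add: V_def)
    ultimately show ?thesis by (simp add: a p_def)
  qed
  have "(\<Sum>r<m. frob b ((W_map \<tau> + 24 * of_nat r) / of_nat m)) = C (5 ^ (\<alpha> + 2)) * (\<Sum>r<m. frob_dual b ((\<tau> + 24 * of_nat (f r)) / of_nat m))"
    using main by (simp add: sum_distrib_left)
  also have "(\<Sum>r<m. frob_dual b ((\<tau> + 24 * of_nat (f r)) / of_nat m)) = (\<Sum>r<m. frob_dual b ((\<tau> + 24 * of_nat r) / of_nat m))"
    by (rule sum.reindex_bij_betw[OF f(1)])
  finally show ?thesis using den C0 unfolding C_eq by (intro that[of "C (5 ^ (2 - \<alpha> mod 2))"])
qed

section \<open>Integral expansions on the dual side\<close>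

lemma Im_W_map_pos:
  assumes "Im \<tau> > 0"
  shows "Im (W_map \<tau>) > 0"
proof -
  have V: "Im (100 * (25 * \<tau> - 6)) > 0" using assms by simp
  hence "100 * \<tau> - 24 \<noteq> 0" by (auto simp: complex_eq_iff)
  hence "W_map \<tau> = 1 / 25 + - 1 / (100 * (25 * \<tau> - 6))"
    by (simp add: W_map_def field_simps)
  thus ?thesis using uhp_inverse[OF V] by simp
qed

lemma jtheta_eq_ramanujan_phi:
  assumes "b \<in> {0, 1}" "Im \<tau> > 0"
  shows "jtheta 0 (real b / 2) \<tau> = ramanujan_phi ((- 1) ^ b * nome \<tau>)"
proof -
  have "nome (\<tau> + 1 / 2) = - nome \<tau>" by (simp add: nome_add)
  thus ?thesis
    using assms jtheta_00(2)[of \<tau>] jtheta_00(2)[of "\<tau> + 1 / 2"] by (auto simp: ramanujan_phi_def jtheta_0_half)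
qed

lemma jtheta_dual_nonzero:
  assumes "b \<in> {0, 1}" "Im \<tau> > 0"
  shows "jtheta 0 (real b / 2) \<tau> \<noteq> 0"
proof -
  have q: "norm (nome \<tau>) < 1" by (rule norm_nome_less_1[OF assms(2)])
  hence "norm (nome \<tau> ^ 2) < 1" "norm (nome \<tau> ^ 4) < 1" by (simp_all add: norm_power power_less_one_iff)
  thus ?thesis
    using assms jtheta_00(1)[of \<tau>] jtheta_0_half_product[of \<tau>] q by (auto simp: euler_nonzero)
qed

lemma Zq4_plus_q_Zq4_I:
  fixes F :: "int fps"
  assumes "\<And>n. fps_nth F n \<noteq> 0 \<Longrightarrow> n mod 4 \<in> {0, 1}"
  shows "F \<in> Zq4_plus_q_Zq4"
proof -
  define A B where "A = Abs_fps (\<lambda>n. fps_nth F (4 * n))" and "B = Abs_fps (\<lambda>n. fps_nth F (4 * n + 1))"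
  have "F = (A oo fps_X ^ 4) + fps_X * (B oo fps_X ^ 4)"
  proof (rule fps_ext)
    fix n :: nat
    have n: "n = 4 * (n div 4) + n mod 4" by simp
    consider "n mod 4 = 0" | "n mod 4 = 1" | "n mod 4 \<notin> {0, 1}" by auto
    thus "fps_nth F n = fps_nth ((A oo fps_X ^ 4) + fps_X * (B oo fps_X ^ 4)) n"
    proof cases
      case 1
      hence "4 dvd n" "\<not> 4 dvd n - 1 \<or> n = 0" by presburger+
      thus ?thesis by (auto simp: A_def B_def fps_nth_compose_X_power)
    next
      case 2
      hence d: "\<not> 4 dvd n" "4 dvd n - 1" "n \<noteq> 0" "4 * ((n - 1) div 4) + 1 = n" by presburger+
      thus ?thesis by (simp add: A_def B_def fps_nth_compose_X_power)
    next
      case 3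
      hence "\<not> 4 dvd n" "\<not> 4 dvd n - 1 \<or> n = 0" by (auto, presburger+)
      moreover have "fps_nth F n = 0" using assms[of n] 3 by blast
      ultimately show ?thesis by (auto simp: fps_nth_compose_X_power)
    qed
  qed
  thus ?thesis unfolding Zq4_plus_q_Zq4_def by blast
qed

definition dual_coeff :: "nat \<Rightarrow> nat \<Rightarrow> complex" where
  "dual_coeff b = fps_nth (fps_expansion (\<lambda>q. ramanujan_phi (of_int ((- 1) ^ b) * q) / euler (q ^ 4) ^ 2) 0)"

lemma dual_int_series:
  "int_series {0, 1} (\<lambda>q. ramanujan_phi (of_int ((- 1) ^ b) * q) / euler (q ^ 4) ^ 2)"
  by (rule theta_quotient_int_series) (cases "even b"; simp)

lemma eta_4_sq: "eta (4 * \<sigma>) ^ 2 = nome (\<sigma> / 3) * euler (nome \<sigma> ^ 4) ^ 2"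
proof -
  have "nome (4 * \<sigma>) = nome \<sigma> ^ 4" using nome_of_nat_mult[of 4 \<sigma>] by simp
  moreover have "nome (4 * \<sigma> / 24) ^ 2 = nome (\<sigma> / 3)"
    unfolding nome_of_nat_mult[symmetric] by (rule arg_cong[of _ _ nome]) simp
  ultimately show ?thesis by (simp only: eta_def power_mult_distrib)
qed

text \<open>The 8 is 24 times 1/3, the leading exponent of
  \<open>eta (4 * \<sigma>) ^ 2\<close>.\<close>

lemma frob_dual_has_sum:
  assumes b: "b \<in> {0, 1}" and \<sigma>: "Im \<sigma> > 0"
  shows "((\<lambda>n. dual_coeff b n * nome (of_int (24 * int n - 8) * \<sigma> / 24)) has_sum frob_dual b \<sigma>) UNIV"
proof -
  have "((\<lambda>n. dual_coeff b n * nome \<sigma> ^ n * (1 / nome (\<sigma> / 3))) has_sum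
     ramanujan_phi (of_int ((- 1) ^ b) * nome \<sigma>) / euler (nome \<sigma> ^ 4) ^ 2 * (1 / nome (\<sigma> / 3))) UNIV"
    unfolding dual_coeff_def
    by (intro has_sum_cmult_left int_series_has_sum[OF dual_int_series] norm_nome_less_1 \<sigma>)
  moreover have "ramanujan_phi (of_int ((- 1) ^ b) * nome \<sigma>) / euler (nome \<sigma> ^ 4) ^ 2 * (1 / nome (\<sigma> / 3)) = frob_dual b \<sigma>"
    unfolding frob_dual_def eta_4_sq jtheta_eq_ramanujan_phi[OF b \<sigma>] by simp
  moreover have "dual_coeff b n * nome \<sigma> ^ n * (1 / nome (\<sigma> / 3)) = dual_coeff b n * nome (of_int (24 * int n - 8) * \<sigma> / 24)" for n
  proof -
    have eq: "of_int (24 * int n - 8) * \<sigma> / 24 = of_nat n * \<sigma> - \<sigma> / 3" by (simp add: field_simps)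
    show ?thesis unfolding eq nome_diff nome_of_nat_mult by simp
  qed
  ultimately show ?thesis by simp
qed

text \<open>The factor \<open>nome (of_nat p * \<tau> / 3)\<close> is the leading power of the
  squared eta function at 4 p \<tau>. It turns the exponent (3 n - 1) / (3 m) into (n + c) / m, an
  integer k on the progression. The test c <= m k guards the truncated subtraction.\<close>

lemma frob_dual_dissection_has_sum:
  fixes m p c b :: nat
  assumes b: "b \<in> {0, 1}" and \<tau>: "Im \<tau> > 0" and m: "coprime (int m) 3" "coprime (int m) 8" "m > 0"
    and c: "3 * c + 1 = m * p"
  shows "((\<lambda>k. (if c \<le> m * k then dual_coeff b (m * k - c) else 0) * nome \<tau> ^ k) has_sum
    nome (of_nat p * \<tau> / 3) * ((\<Sum>r<m. frob_dual b ((\<tau> + 24 * of_nat r) / of_nat m)) / of_nat m)) UNIV"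
proof -
  let ?S = "{n. int m dvd 24 * int n - 8}"
  let ?s = "(\<Sum>r<m. frob_dual b ((\<tau> + 24 * of_nat r) / of_nat m)) / of_nat m"
  have c_int: "3 * int c + 1 = int m * int p" using arg_cong[OF c, of int] by simp
  have S: "n \<in> ?S \<longleftrightarrow> m dvd n + c" for n
  proof -
    have "n \<in> ?S \<longleftrightarrow> int m dvd 8 * (3 * int n - 1)" by (simp add: algebra_simps)
    also have "\<dots> \<longleftrightarrow> int m dvd 3 * int n - 1" using m(2) by (rule coprime_dvd_mult_right_iff)
    also have "3 * int n - 1 = 3 * (int n + int c) + int m * (- int p)" using c_int by simp
    also have "int m dvd \<dots> \<longleftrightarrow> int m dvd 3 * (int n + int c)" by (rule dvd_add_left_iff) simp
    also have "\<dots> \<longleftrightarrow> int m dvd int n + int c" using m(1) by (rule coprime_dvd_mult_right_iff)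
    also have "\<dots> \<longleftrightarrow> m dvd n + c" by (simp only: of_nat_add[symmetric] of_nat_dvd_iff)
    finally show ?thesis .
  qed
  have "((\<lambda>n. nome (of_nat p * \<tau> / 3) * (dual_coeff b n * nome (of_int (24 * int n - 8) * \<tau> / (24 * of_nat m))))
      has_sum nome (of_nat p * \<tau> / 3) * ?s) ?S"
    by (intro has_sum_cmult_right has_sum_dissection[OF m(3) \<tau>] frob_dual_has_sum b)
  also have "?this \<longleftrightarrow> ((\<lambda>k. dual_coeff b (m * k - c) * nome \<tau> ^ k) has_sum nome (of_nat p * \<tau> / 3) * ?s) {k. c \<le> m * k}"
  proof (rule has_sum_reindex_bij_witness[of _ "\<lambda>k. m * k - c" "\<lambda>n. (n + c) div m"])
    fix n assume "n \<in> ?S"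
    then obtain k where k: "n + c = m * k" unfolding S by (elim dvdE)
    hence n: "n = m * k - c" and ck: "c \<le> m * k" and kn: "(n + c) div m = k" using m(3) by auto
    show "m * ((n + c) div m) - c = n" unfolding kn using n by simp
    show "(n + c) div m \<in> {k. c \<le> m * k}" unfolding kn using ck by simp
    have nk: "of_nat n + of_nat c = of_nat m * (of_nat k :: complex)"
      using arg_cong[OF k, of "of_nat :: nat \<Rightarrow> complex"] by simp
    have cp: "3 * of_nat c + 1 = of_nat m * (of_nat p :: complex)"
      using arg_cong[OF c, of "of_nat :: nat \<Rightarrow> complex"] by (simp add: add.commute)
    have "of_nat p * \<tau> / 3 + of_int (24 * int n - 8) * \<tau> / (24 * of_nat m) =
      (of_nat m * of_nat p + (3 * of_nat n - 1)) * \<tau> / (3 * of_nat m)"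
      using m(3) by (simp add: field_simps)
    also have "of_nat m * of_nat p + (3 * of_nat n - 1) = 3 * (of_nat n + of_nat c :: complex)"
      unfolding cp[symmetric] by simp
    also have "\<dots> * \<tau> / (3 * of_nat m) = of_nat k * \<tau>" unfolding nk using m(3) by simp
    finally have "nome (of_nat p * \<tau> / 3) * nome (of_int (24 * int n - 8) * \<tau> / (24 * of_nat m)) = nome \<tau> ^ k"
      by (simp only: nome_add[symmetric] nome_of_nat_mult)
    thus "dual_coeff b (m * ((n + c) div m) - c) * nome \<tau> ^ ((n + c) div m) =
      nome (of_nat p * \<tau> / 3) * (dual_coeff b n * nome (of_int (24 * int n - 8) * \<tau> / (24 * of_nat m)))"
      unfolding kn n[symmetric] by (simp only: mult.left_commute)
  next
    fix k assume "k \<in> {k. c \<le> m * k}"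
    hence "m * k - c + c = m * k" by simp
    thus "(m * k - c + c) div m = k" "m * k - c \<in> ?S" unfolding S using m(3) by simp_all
  qed simp
  also have "\<dots> \<longleftrightarrow> ((\<lambda>k. (if c \<le> m * k then dual_coeff b (m * k - c) else 0) * nome \<tau> ^ k) has_sum
      nome (of_nat p * \<tau> / 3) * ?s) UNIV"
    by (rule has_sum_cong_neutral) auto
  finally show ?thesis .
qed

lemma Cauchy_product_has_sum:
  fixes a b :: "nat \<Rightarrow> complex"
  assumes "((\<lambda>n. a n * q ^ n) has_sum A) UNIV" "((\<lambda>n. b n * q ^ n) has_sum B) UNIV"
  shows "(\<lambda>n. (\<Sum>i\<le>n. a i * b (n - i)) * q ^ n) sums (A * B)"
proof -
  have abs: "summable (\<lambda>n. norm (f n))" if "(f has_sum S) UNIV" for f :: "nat \<Rightarrow> complex" and S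
    using that summable_on_iff_abs_summable_on_complex summable_on_imp_summable
    by (metis summable_on_def)
  have "(\<lambda>n. \<Sum>i\<le>n. a i * q ^ i * (b (n - i) * q ^ (n - i))) sums ((\<Sum>n. a n * q ^ n) * (\<Sum>n. b n * q ^ n))"
    by (rule Cauchy_product_sums) (rule abs[OF assms(1)] abs[OF assms(2)])+
  moreover have "(\<Sum>n. a n * q ^ n) = A" "(\<Sum>n. b n * q ^ n) = B"
    using assms[THEN has_sum_imp_sums] by (simp_all add: sums_iff)
  moreover have "(\<Sum>i\<le>n. a i * q ^ i * (b (n - i) * q ^ (n - i))) = (\<Sum>i\<le>n. a i * b (n - i)) * q ^ n" for n
    unfolding sum_distrib_right
  proof (rule sum.cong[OF refl])
    fix i assume "i \<in> {..n}"
    hence "q ^ n = q ^ i * q ^ (n - i)" by (simp flip: power_add)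
    thus "a i * q ^ i * (b (n - i) * q ^ (n - i)) = a i * b (n - i) * q ^ n" by simp
  qed
  ultimately show ?thesis by simp
qed

theorem theorem6p2:
  fixes \<alpha> \<beta> a :: nat
  assumes "\<alpha> \<ge> 1" and "\<beta> \<in> {0, 1}" and "a \<in> {0, 1}" and "[a = \<alpha>] (mod 2)"
  shows "\<exists>F \<in> Zq4_plus_q_Zq4. \<forall>\<tau>. Im \<tau> > 0 \<longrightarrow>
           (\<lambda>n. of_int (fps_nth F n) * nome \<tau> ^ n) sums
             (ramanujan_phi ((- 1) ^ (\<beta> + 1) * nome \<tau> ^ (1 + 4 * a)) * L_fun \<beta> \<alpha> (W_map \<tau>))"
proof -
  define m p b where "m = (5::nat) ^ \<alpha>" and "p = 1 + 4 * (\<alpha> mod 2)" and "b = 1 - \<beta>"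
  have a: "a = \<alpha> mod 2" using assms(3,4) by (auto simp: cong_def)
  have b: "b \<in> {0, 1}" using assms(2) by (auto simp: b_def)
  have sign: "(- 1 :: complex) ^ (\<beta> + 1) = (- 1) ^ b" using assms(2) by (auto simp: b_def)
  have m0: "m > 0" by (simp add: m_def)
  have m12: "int m mod 12 = int p"
    using five_power_mod_12[of \<alpha>] by (cases "even \<alpha>") (auto simp: m_def p_def odd_iff_mod_2_eq_one even_iff_mod_2_eq_zero)
  have p15: "p = 1 \<or> p = 5" by (auto simp: p_def)
  have cop: "coprime (int m) 3" "coprime (int m) 8"
    using coprime_five_power[of 3 \<alpha>] coprime_five_power[of 8 \<alpha>] by (auto simp: m_def)
  obtain u where u: "m = 12 * u + p"
  proof -
    have "m mod 12 = p" using m12 by (metis of_nat_eq_iff of_nat_mod of_nat_numeral)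
    thus ?thesis using that[of "m div 12"] by (metis mult_div_mod_eq)
  qed
  \<comment> \<open>As p^2 is 1 modulo 12, m p - 1 is a multiple of 12, so c = (m p - 1) / 3 is a
    multiple of 4.\<close>
  obtain c where c: "3 * c + 1 = m * p" "c mod 4 = 0"
    using p15
  proof
    assume "p = 1"
    thus ?thesis using that[of "4 * u"] by (simp add: u)
  next
    assume "p = 5"
    thus ?thesis using that[of "20 * u + 8"] by (simp add: u)
  qed
  have m4: "m mod 4 = 1" using u p15 by presburger
  define g where "g = fps_nth (fps_expansion (\<lambda>q. euler (q ^ (4 * p)) ^ 2) 0)"
  define d where "d = (\<lambda>k. if c \<le> m * k then dual_coeff b (m * k - c) else 0)"
  have p0: "p > 0" by (simp add: p_def)
  have g: "g n \<in> \<int>" "g n \<noteq> 0 \<Longrightarrow> n mod 4 = 0" for n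
    using euler_square_int_series[OF p0] by (auto simp: g_def int_series_def)
  have dual: "dual_coeff b n \<in> \<int>" "dual_coeff b n \<noteq> 0 \<Longrightarrow> n mod 4 \<in> {0, 1}" for n
    using dual_int_series[of b] unfolding int_series_def dual_coeff_def by blast+
  have d: "d k \<in> \<int>" "d k \<noteq> 0 \<Longrightarrow> k mod 4 \<in> {0, 1}" for k
  proof -
    show "d k \<in> \<int>" using dual(1) by (auto simp: d_def)
    assume "d k \<noteq> 0"
    hence ck: "c \<le> m * k" and nz: "dual_coeff b (m * k - c) \<noteq> 0" by (auto simp: d_def split: if_splits)
    \<comment> \<open>Modulo 4, m is 1 and c is 0, so k and m k - c have the same residue.\<close>
    have "k mod 4 = (m mod 4) * (k mod 4) mod 4" by (simp add: m4)
    also have "\<dots> = m * k mod 4" by (rule mod_mult_eq)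
    also have "\<dots> = ((m * k - c) + c) mod 4" using ck by simp
    also have "\<dots> = (m * k - c) mod 4" by (metis c(2) add_0_right mod_add_right_eq)
    finally show "k mod 4 \<in> {0, 1}" using dual(2)[OF nz] by simp
  qed
  \<comment> \<open>The coefficients are integers given as complex numbers; the floor of the real
    part recovers them.\<close>
  define F where "F = Abs_fps (\<lambda>n. \<Sum>i\<le>n. \<lfloor>Re (g i)\<rfloor> * \<lfloor>Re (d (n - i))\<rfloor>)"
  have F: "of_int (fps_nth F n) = (\<Sum>i\<le>n. g i * d (n - i))" for n
  proof -
    have "of_int \<lfloor>Re z\<rfloor> = z" if "z \<in> \<int>" for z using that by (elim Ints_cases) simp
    thus ?thesis using g(1) d(1) by (simp add: F_def)
  qed
  have "F \<in> Zq4_plus_q_Zq4"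
  proof (rule Zq4_plus_q_Zq4_I)
    fix n assume "fps_nth F n \<noteq> 0"
    hence "(\<Sum>i\<le>n. g i * d (n - i)) \<noteq> 0" by (simp flip: F)
    then obtain i where i: "i \<in> {..n}" "g i * d (n - i) \<noteq> 0" by (rule sum.not_neutral_contains_not_neutral)
    hence "i mod 4 = 0" "(n - i) mod 4 \<in> {0, 1}" using g(2) d(2) by auto
    moreover have "n mod 4 = ((n - i) + i) mod 4" using i by simp
    ultimately show "n mod 4 \<in> {0, 1}" by (metis add_0_right mod_add_right_eq)
  qed
  moreover have "(\<lambda>n. of_int (fps_nth F n) * nome \<tau> ^ n) sums
      (ramanujan_phi ((- 1) ^ (\<beta> + 1) * nome \<tau> ^ (1 + 4 * a)) * L_fun \<beta> \<alpha> (W_map \<tau>))" if \<tau>: "Im \<tau> > 0" for \<tau>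
  proof -
    let ?s = "(\<Sum>r<m. frob_dual b ((\<tau> + 24 * of_nat r) / of_nat m)) / of_nat m"
    have "((\<lambda>n. g n * nome \<tau> ^ n) has_sum euler (nome \<tau> ^ (4 * p)) ^ 2) UNIV"
      unfolding g_def by (rule int_series_has_sum[OF euler_square_int_series[OF p0] norm_nome_less_1[OF \<tau>]])
    moreover have "((\<lambda>k. d k * nome \<tau> ^ k) has_sum nome (of_nat p * \<tau> / 3) * ?s) UNIV"
      unfolding d_def by (rule frob_dual_dissection_has_sum[OF b \<tau> cop m0 c(1)])
    ultimately have "(\<lambda>n. of_int (fps_nth F n) * nome \<tau> ^ n) sums (euler (nome \<tau> ^ (4 * p)) ^ 2 * (nome (of_nat p * \<tau> / 3) * ?s))"
      unfolding F by (rule Cauchy_product_has_sum)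
    \<comment> \<open>The product and the fractional power recombine to the eta factor of
      \<open>frob_dual\<close> at p \<tau>; the theta factor there is cancelled by
      \<open>ramanujan_phi\<close>.\<close>
    also have "euler (nome \<tau> ^ (4 * p)) ^ 2 * (nome (of_nat p * \<tau> / 3) * ?s) = eta (4 * (of_nat p * \<tau>)) ^ 2 * ?s"
      unfolding eta_4_sq nome_of_nat_mult by (simp add: power_mult[symmetric] mult_ac)
    also have "\<dots> = ramanujan_phi ((- 1) ^ (\<beta> + 1) * nome \<tau> ^ (1 + 4 * a)) * L_fun \<beta> \<alpha> (W_map \<tau>)"
    proof -
      have p\<tau>: "Im (of_nat p * \<tau>) > 0" using \<tau> p0 by simp
      obtain C where C: "C \<noteq> 0"
        "frob b (of_nat p * W_map \<tau>) = C * frob_dual b (of_nat p * \<tau>)"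
        "(\<Sum>r<m. frob b ((W_map \<tau> + 24 * of_nat r) / of_nat m)) = C * (\<Sum>r<m. frob_dual b ((\<tau> + 24 * of_nat r) / of_nat m))"
  by (rule frob_W[OF \<tau>, where \<alpha> = \<alpha> and b = b, folded m_def p_def]) (rule that)
      have "L_fun \<beta> \<alpha> (W_map \<tau>) = (\<Sum>r<m. frob b ((W_map \<tau> + 24 * of_nat r) / of_nat m)) / of_nat m / frob b (of_nat p * W_map \<tau>)"
        unfolding m_def p_def b_def by (rule L_fun_frob[OF assms(1,2) Im_W_map_pos[OF \<tau>]])
      also have "\<dots> = ?s / frob_dual b (of_nat p * \<tau>)"
        unfolding C(2,3) using C(1) by simp
      also have "frob_dual b (of_nat p * \<tau>) = ramanujan_phi ((- 1) ^ b * nome (of_nat p * \<tau>)) / eta (4 * (of_nat p * \<tau>)) ^ 2"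
        unfolding frob_dual_def jtheta_eq_ramanujan_phi[OF b p\<tau>] ..
      also have "nome (of_nat p * \<tau>) = nome \<tau> ^ (1 + 4 * a)" by (simp only: nome_of_nat_mult p_def a)
      finally have "L_fun \<beta> \<alpha> (W_map \<tau>) = ?s / (ramanujan_phi ((- 1) ^ b * nome \<tau> ^ (1 + 4 * a)) / eta (4 * (of_nat p * \<tau>)) ^ 2)" .
      moreover have "ramanujan_phi ((- 1) ^ b * nome \<tau> ^ (1 + 4 * a)) \<noteq> 0"
        using jtheta_dual_nonzero[OF b p\<tau>] unfolding jtheta_eq_ramanujan_phi[OF b p\<tau>]
        by (simp only: nome_of_nat_mult p_def a not_False_eq_True)
      ultimately show ?thesis unfolding sign by simp
    qed
    finally show ?thesis .
  qed
  ultimately show ?thesis by blast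
qed

end
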